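(* Let $d\ge 1$, let $\mathcal{O}\subset\mathbb{R}^d$ be a bounded domain with smooth boundary and $H=L^2(\mathcal{O})$. Let $A:D(A)\subset H\to H$ be a self-adjoint negative operator, and let $\{e_k\}_{k\ge1}$ be an orthonormal basis of $H$ (of real-valued functions) with $e_k\in D(A)$ and $Ae_k=-\alpha_k e_k$ for all $k\ge 1$, where $0<\alpha_1\le\alpha_2\le\dots$ and $\alpha_k\uparrow\infty$. Assume further that there are a constant $M>0$ and an increasing sequence of positive numbers $\{c_k\}_{k\ge1}$ such that $|e_k(\xi)|\le Mc_k$ and $|\nabla e_k(\xi)|\le M\alpha_k^{1/2}c_k$ for all $\xi\in\mathcal{O}$, $k\ge1$. Let $K:\mathbb{R}\to[0,\infty)$ be continuous, not identically zero, symmetric, eventually decreasing to zero as $t\to\infty$, and completely monotone on $(0,\infty)$. Let $\{\lambda_k\}_{k\ge1}$ be a sequence of positive constants, and assume that there is a constant $\eta\in(0,1)$ such that $$\sum_{k\ge1}\frac{\lambda_k^2c_k^2}{\alpha_k^{\eta}}<\infty .$$ Let $u(t,\mathbf{x})$ be the stationary solution (in the sense defined in the context) of $$\dot u(t,\mathbf{x})=\int_{-\infty}^t K(t-s)\,A u(s,\mathbf{x})\,\mathrm{d}s+\mathbf{F}(t,\mathbf{x}),\qquad \mathbf{F}(t,\mathbf{x})=\sum_{k\ge1}\lambda_kF_k(t)e_k(\mathbf{x}),$$ where $\{F_k\}_{k\ge1}$ are i.i.d. stationary Gaussian processes with $\mathbb{E}[F_k(t)F_k(s)]=K(|t-s|)$.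 Then there exists a modification $U(t,\mathbf{x})$ of $u(t,\mathbf{x})$ such that $U$ is $\gamma$-Hölder continuous in time and space for any $\gamma\in(0,1-\eta)$.
   Context: Complete monotonicity: $K$ is completely monotone on $(0,\infty)$ if $K\in C^\infty(0,\infty)$ and $(-1)^nK^{(n)}(t)\ge0$ for all $n\ge0$, $t>0$. Notation. $\mathcal{S}$ is the Schwartz space on $\mathbb{R}$ and $\mathcal{S}'$ the tempered distributions. For a function $f$, $\widehat f(\omega)=\int_{\mathbb{R}}f(t)e^{-it\omega}\,\mathrm{d}t$; for $f\in\mathcal{S}'$, $\langle\mathcal{F}[f],\varphi\rangle=\langle f,\widehat\varphi\rangle$. $\widetilde f(x)=f(-x)$, $K^+(t)=K(t)1_{\{t\ge0\}}$, and $\delta_t$ is the Dirac distribution at $t$. $L^2(\Omega)$ is the space of complex-valued random variables with finite second moment on a probability space $\Omega$ (assumed rich enough to carry all objects considered). Operators associated with a measure. Let $\nu$ be a non-negative measure on $\mathbb{R}$, absolutely continuous with respect to Lebesgue measure, with $\int_{\mathbb{R}}(1+x^2)^{-m}\nu(\mathrm{d}x)<\infty$ for some integer $m$. An operator associated with $\nu$ is a linear map $V:\mathrm{Dom}(V)\subset\mathcal{S}'\to L^2(\Omega)$, where $\mathrm{Dom}(V)$ consists of those $f\in\mathcal{S}'$ such that $\mathcal{F}[f]$ is a function in $L^2(\nu)$, satisfying $\mathbb{E}\big[\langle V,f_1\rangle\overline{\langle V,f_2\rangle}\big]=\int_{\mathbb{R}}\mathcal{F}[f_1](y)\overline{\mathcal{F}[f_2](y)}\,\nu(\mathrm{d}y)$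 for all $f_1,f_2\in\mathrm{Dom}(V)$. By convention all such operators are taken centered Gaussian, with the processes $t\mapsto\langle V,\delta_t\rangle$ real-valued. Weak stationary solution of the mode equation. The $k$-th mode equation is, formally, $\dot u_k(t)=-\alpha_k\int_{-\infty}^tK(t-s)u_k(s)\,\mathrm{d}s+\lambda_kF_k(t)$. An operator $V$ associated with a non-negative measure $\nu$ on $\mathbb{R}$ that is absolutely continuous with respect to Lebesgue measure and satisfies $\int_{\mathbb{R}}(1+x^2)^{-m}\nu(\mathrm{d}x)<\infty$ for some integer $m$ (that is, a centered Gaussian linear map $V:\mathrm{Dom}(V)\to L^2(\Omega)$ with $\mathrm{Dom}(V)=\{f\in\mathcal{S}':\mathcal{F}[f]\in L^2(\nu)\}$, with $t\mapsto\langle V,\delta_t\rangle$ real-valued, and with $\mathbb{E}\big[\langle V,f_1\rangle\overline{\langle V,f_2\rangle}\big]=\int_{\mathbb{R}}\mathcal{F}[f_1](y)\overline{\mathcal{F}[f_2](y)}\,\nu(\mathrm{d}y)$ for all $f_1,f_2\in\mathrm{Dom}(V)$) is a weak stationary solution of it if: (a) for all $\varphi\in\mathcal{S}$, $K^+*\varphi\in\mathrm{Dom}(V)$; and (b) for all $\varphi,\psi\in\mathcal{S}$, $$\mathbb{E}\Big[\big\langle V,-\varphi'+\alpha_k\widetilde{K^+*\widetilde\varphi}\big\rangle\overline{\big\langle V,-\psi'+\alpha_k\widetilde{K^+*\widetilde\psi}\big\rangle}\Big]=\lambda_k^2\,\mathbb{E}\big[\langle F_k,\varphi\rangle\overline{\langle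 F_k,\psi\rangle}\big],$$ where $\mathbb{E}\big[\langle F_k,\varphi\rangle\overline{\langle F_k,\psi\rangle}\big]=\int_{\mathbb{R}}K(t)\,(\varphi*\widetilde{\overline\psi})(t)\,\mathrm{d}t$. Stationary solution of the full equation. A random field $u(t,\mathbf{x})=\sum_{k\ge1}u_k(t)e_k(\mathbf{x})$, $(t,\mathbf{x})\in\mathbb{R}\times\mathcal{O}$, is a stationary solution if (a) for all $t\in\mathbb{R}$, $u(t,\cdot)\in L^2(\Omega;H)$, i.e. $\mathbb{E}\|u(t,\cdot)\|_H^2<\infty$; and (b) $u_k(t)=\langle V_k,\delta_t\rangle$, where $\{V_k\}_{k\ge1}$ are mutually independent and, for each $k$, $V_k$ is a weak stationary solution of the $k$-th mode equation. It is known that the $k$-th mode equation has a weak stationary solution with spectral measure $\nu_k(\mathrm{d}\omega)=\rho_k(\omega)\mathrm{d}\omega$, $\rho_k(\omega)=\dfrac{\lambda_k^2\widehat K(\omega)}{2\pi|i\omega+\alpha_k\widehat{K^+}(\omega)|^2}$ (Fourier transforms as improper integrals, $\omega\ne0$), that this is the only possible spectral measure, and that $\mathbb{E}[u_k(t)u_k(s)]=\int_{\mathbb{R}}e^{i(t-s)\omega}\rho_k(\omega)\,\mathrm{d}\omega$. The summability hypothesis implies $\sum_k\lambda_k^2/\alpha_k<\infty$, under which stationary solutions exist. Hölder continuity. A modification of $u$ is a random field $U$ with $\mathbb{P}(U(t,\mathbf{x})=u(t,\mathbf{x}))=1$ for every $(t,\mathbf{x})$. "$U$ is $\gamma$-Hölder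 continuous in time and space" means that, almost surely, for every $T>0$ there is a (random) finite constant $C$ with $|U(t,\mathbf{x})-U(s,\mathbf{y})|\le C(|t-s|^\gamma+|\mathbf{x}-\mathbf{y}|^\gamma)$ for all $s,t\in[-T,T]$, $\mathbf{x},\mathbf{y}\in\mathcal{O}$. *)

theory Defs
  imports "HOL-Analysis.Analysis" "HOL-Probability.Probability"
begin

section \<open>Complete monotonicity\<close>

definition completely_monotone :: "(real \<Rightarrow> real) \<Rightarrow> bool" where
  "completely_monotone K \<longleftrightarrow>
     (\<forall>n. \<forall>t>0. ((deriv ^^ n) K) field_differentiable (at t) \<and> (-1) ^ n * (deriv ^^ n) K t \<ge> 0)"

definition eventually_decreasing_to_zero :: "(real \<Rightarrow> real) \<Rightarrow> bool" where
  "eventually_decreasing_to_zero K \<longleftrightarrow>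
     (\<exists>T. \<forall>s t. T \<le> s \<longrightarrow> s \<le> t \<longrightarrow> K t \<le> K s) \<and> (K \<longlongrightarrow> 0) at_top"

section \<open>Bounded domains with smooth boundary\<close>

primrec C_diff :: "nat \<Rightarrow> ('a::real_normed_vector \<Rightarrow> 'b::real_normed_vector) \<Rightarrow> bool" where
  "C_diff 0 f \<longleftrightarrow> continuous_on UNIV f"
| "C_diff (Suc n) f \<longleftrightarrow>
     (\<forall>x. f differentiable (at x)) \<and> (\<forall>v. C_diff n (\<lambda>x. frechet_derivative f (at x) v))"

definition C_infinity :: "('a::real_normed_vector \<Rightarrow> 'b::real_normed_vector) \<Rightarrow> bool" where
  "C_infinity f \<longleftrightarrow> (\<forall>n. C_diff n f)"

text \<open>Near each boundary point the domain is the strict epigraph, in the direction of some unit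
  vector \<open>n\<close>, of a smooth function of the component orthogonal to \<open>n\<close>. The function \<open>h\<close> is
  defined on the whole space, but only its values on the hyperplane orthogonal to \<open>n\<close> are used.\<close>

definition smooth_boundary :: "'a::euclidean_space set \<Rightarrow> bool" where
  "smooth_boundary D \<longleftrightarrow>
     (\<forall>p\<in>frontier D. \<exists>r>0. \<exists>n. \<exists>h::'a \<Rightarrow> real. norm n = 1 \<and> C_infinity h \<and>
        D \<inter> ball p r = {x \<in> ball p r. h (x - (x \<bullet> n) *\<^sub>R n) < x \<bullet> n})"

definition smooth_bounded_domain :: "'a::euclidean_space set \<Rightarrow> bool" where
  "smooth_bounded_domain D \<longleftrightarrow>
     open D \<and> connected D \<and> D \<noteq> {} \<and> bounded D \<and> smooth_boundary D"

definition gradient :: "(real ^ 'd \<Rightarrow> real) \<Rightarrow> real ^ 'd \<Rightarrow> real ^ 'd" where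
  "gradient f x = (\<chi> i. frechet_derivative f (at x) (axis i 1))"

section \<open>Unbounded operators on the space of square-integrable functions\<close>

text \<open>Elements of \<open>L\<^sup>2(D)\<close> are represented by square-integrable complex-valued functions;
  two functions represent the same element if they agree almost everywhere on \<open>D\<close>.\<close>

definition L2 :: "'a::euclidean_space set \<Rightarrow> ('a \<Rightarrow> complex) set" where
  "L2 D = {f \<in> borel_measurable (lebesgue_on D). integrable (lebesgue_on D) (\<lambda>x. (cmod (f x))\<^sup>2)}"

definition L2_eq :: "'a::euclidean_space set \<Rightarrow> ('a \<Rightarrow> complex) \<Rightarrow> ('a \<Rightarrow> complex) \<Rightarrow> bool" where
  "L2_eq D f g \<longleftrightarrow> (AE x in lebesgue_on D. f x = g x)"

definition L2_inner :: "'a::euclidean_space set \<Rightarrow> ('a \<Rightarrow> complex) \<Rightarrow> ('a \<Rightarrow> complex) \<Rightarrow> complex" where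
  "L2_inner D f g = (LINT x|lebesgue_on D. f x * cnj (g x))"

definition L2_norm :: "'a::euclidean_space set \<Rightarrow> ('a \<Rightarrow> complex) \<Rightarrow> real" where
  "L2_norm D f = sqrt (LINT x|lebesgue_on D. (cmod (f x))\<^sup>2)"

definition L2_orthonormal_basis ::
    "'a::euclidean_space set \<Rightarrow> (nat \<Rightarrow> 'a \<Rightarrow> complex) \<Rightarrow> bool" where
  "L2_orthonormal_basis D e \<longleftrightarrow>
     (\<forall>k. e k \<in> L2 D) \<and>
     (\<forall>j k. L2_inner D (e j) (e k) = (if j = k then 1 else 0)) \<and>
     (\<forall>f\<in>L2 D. (\<lambda>n. L2_norm D (\<lambda>x. f x - (\<Sum>k<n. L2_inner D f (e k) * e k x))) \<longlonglongrightarrow> 0)"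

text \<open>A linear operator with domain \<open>DA\<close>, compatible with the identification of functions that
  agree almost everywhere.\<close>

definition L2_linear_operator ::
    "'a::euclidean_space set \<Rightarrow> ('a \<Rightarrow> complex) set \<Rightarrow> (('a \<Rightarrow> complex) \<Rightarrow> 'a \<Rightarrow> complex) \<Rightarrow> bool" where
  "L2_linear_operator D DA A \<longleftrightarrow>
     DA \<subseteq> L2 D \<and> (\<lambda>x. 0) \<in> DA \<and> (\<forall>f\<in>DA. A f \<in> L2 D) \<and>
     (\<forall>f\<in>DA. \<forall>g\<in>L2 D. L2_eq D f g \<longrightarrow> g \<in> DA \<and> L2_eq D (A f) (A g)) \<and>
     (\<forall>f\<in>DA. \<forall>g\<in>DA. \<forall>a b. (\<lambda>x. a * f x + b * g x) \<in> DA \<and>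
        L2_eq D (A (\<lambda>x. a * f x + b * g x)) (\<lambda>x. a * A f x + b * A g x))"

definition L2_dense :: "'a::euclidean_space set \<Rightarrow> ('a \<Rightarrow> complex) set \<Rightarrow> bool" where
  "L2_dense D DA \<longleftrightarrow> (\<forall>f\<in>L2 D. \<forall>\<epsilon>>0. \<exists>g\<in>DA. L2_norm D (\<lambda>x. f x - g x) < \<epsilon>)"

text \<open>\<open>L2_adjoint D DA A g h\<close>: \<open>g\<close> lies in the domain of the adjoint of \<open>A\<close> and is mapped to \<open>h\<close>.\<close>

definition L2_adjoint ::
    "'a::euclidean_space set \<Rightarrow> ('a \<Rightarrow> complex) set \<Rightarrow> (('a \<Rightarrow> complex) \<Rightarrow> 'a \<Rightarrow> complex) \<Rightarrow>
       ('a \<Rightarrow> complex) \<Rightarrow> ('a \<Rightarrow> complex) \<Rightarrow> bool" where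
  "L2_adjoint D DA A g h \<longleftrightarrow>
     g \<in> L2 D \<and> h \<in> L2 D \<and> (\<forall>f\<in>DA. L2_inner D (A f) g = L2_inner D f h)"

definition L2_self_adjoint ::
    "'a::euclidean_space set \<Rightarrow> ('a \<Rightarrow> complex) set \<Rightarrow> (('a \<Rightarrow> complex) \<Rightarrow> 'a \<Rightarrow> complex) \<Rightarrow> bool" where
  "L2_self_adjoint D DA A \<longleftrightarrow>
     L2_linear_operator D DA A \<and> L2_dense D DA \<and>
     (\<forall>g h. L2_adjoint D DA A g h \<longleftrightarrow> g \<in> DA \<and> h \<in> L2 D \<and> L2_eq D h (A g))"

definition L2_negative ::
    "'a::euclidean_space set \<Rightarrow> ('a \<Rightarrow> complex) set \<Rightarrow> (('a \<Rightarrow> complex) \<Rightarrow> 'a \<Rightarrow> complex) \<Rightarrow> bool" where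
  "L2_negative D DA A \<longleftrightarrow> (\<forall>f\<in>DA. Re (L2_inner D (A f) f) \<le> 0)"

section \<open>Schwartz functions and tempered distributions on the real line\<close>

definition vderiv :: "nat \<Rightarrow> (real \<Rightarrow> complex) \<Rightarrow> real \<Rightarrow> complex" where
  "vderiv n = (\<lambda>f t. vector_derivative f (at t)) ^^ n"

definition schwartz :: "(real \<Rightarrow> complex) set" where
  "schwartz = {\<phi>. (\<forall>n t. vderiv n \<phi> differentiable (at t)) \<and>
                  (\<forall>m n. bounded (range (\<lambda>t. \<bar>t\<bar> ^ m * cmod (vderiv n \<phi> t))))}"

definition schwartz_seminorm :: "nat \<Rightarrow> nat \<Rightarrow> (real \<Rightarrow> complex) \<Rightarrow> real" where
  "schwartz_seminorm m n \<phi> = (SUP t. \<bar>t\<bar> ^ m * cmod (vderiv n \<phi> t))"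

text \<open>A tempered distribution is a linear functional on the Schwartz space that is continuous for
  the metrizable topology of the Schwartz seminorms, i.e. sequentially continuous at zero. Its
  value at functions outside the Schwartz space is irrelevant and is fixed to zero, so that equality
  of functionals is equality of distributions.\<close>

definition tempered_distributions :: "((real \<Rightarrow> complex) \<Rightarrow> complex) set" where
  "tempered_distributions =
     {f. (\<forall>\<phi>. \<phi> \<notin> schwartz \<longrightarrow> f \<phi> = 0) \<and>
         (\<forall>\<phi>\<in>schwartz. \<forall>\<psi>\<in>schwartz. \<forall>a b. f (\<lambda>t. a * \<phi> t + b * \<psi> t) = a * f \<phi> + b * f \<psi>) \<and>
         (\<forall>X. (\<forall>j. X j \<in> schwartz) \<longrightarrow> (\<forall>m n. (\<lambda>j. schwartz_seminorm m n (X j)) \<longlonglongrightarrow> 0) \<longrightarrow>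
              (\<lambda>j. f (X j)) \<longlonglongrightarrow> 0)}"

definition fourier :: "(real \<Rightarrow> complex) \<Rightarrow> real \<Rightarrow> complex" where
  "fourier f \<omega> = (LINT t|lborel. f t * exp (- \<i> * of_real t * of_real \<omega>))"

definition dist_fourier :: "((real \<Rightarrow> complex) \<Rightarrow> complex) \<Rightarrow> (real \<Rightarrow> complex) \<Rightarrow> complex" where
  "dist_fourier f \<phi> = (if \<phi> \<in> schwartz then f (fourier \<phi>) else 0)"

definition dist_of_fun :: "(real \<Rightarrow> complex) \<Rightarrow> (real \<Rightarrow> complex) \<Rightarrow> complex" where
  "dist_of_fun g \<phi> = (if \<phi> \<in> schwartz then (LINT t|lborel. g t * \<phi> t) else 0)"

definition dirac :: "real \<Rightarrow> (real \<Rightarrow> complex) \<Rightarrow> complex" where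
  "dirac t \<phi> = (if \<phi> \<in> schwartz then \<phi> t else 0)"

text \<open>The distribution \<open>f\<close> is the function \<open>g\<close>; this determines \<open>g\<close> up to Lebesgue-null sets.\<close>

definition is_function :: "((real \<Rightarrow> complex) \<Rightarrow> complex) \<Rightarrow> (real \<Rightarrow> complex) \<Rightarrow> bool" where
  "is_function f g \<longleftrightarrow>
     g \<in> borel_measurable borel \<and> (\<forall>\<phi>\<in>schwartz. integrable lborel (\<lambda>x. g x * \<phi> x)) \<and>
     f = dist_of_fun g"

definition refl_fun :: "(real \<Rightarrow> complex) \<Rightarrow> real \<Rightarrow> complex" where
  "refl_fun f x = f (- x)"

definition conv :: "(real \<Rightarrow> complex) \<Rightarrow> (real \<Rightarrow> complex) \<Rightarrow> real \<Rightarrow> complex" where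
  "conv f g t = (LINT s|lborel. f (t - s) * g s)"

definition Kplus :: "(real \<Rightarrow> real) \<Rightarrow> real \<Rightarrow> complex" where
  "Kplus K t = (if t \<ge> 0 then of_real (K t) else 0)"

section \<open>Gaussian random variables and processes\<close>

text \<open>The almost surely vanishing variable counts as a (degenerate) centered Gaussian.\<close>

definition centered_gaussian :: "'w measure \<Rightarrow> ('w \<Rightarrow> real) \<Rightarrow> bool" where
  "centered_gaussian M X \<longleftrightarrow> X \<in> borel_measurable M \<and>
     ((AE w in M. X w = 0) \<or> (\<exists>\<sigma>>0. distributed M lborel X (\<lambda>x. ennreal (normal_density 0 \<sigma> x))))"

definition centered_gaussian_process :: "'w measure \<Rightarrow> (real \<Rightarrow> 'w \<Rightarrow> real) \<Rightarrow> bool" where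
  "centered_gaussian_process M X \<longleftrightarrow>
     (\<forall>I c. finite I \<longrightarrow> centered_gaussian M (\<lambda>w. \<Sum>t\<in>I. c t * X t w))"

definition stationary_process :: "'w measure \<Rightarrow> (real \<Rightarrow> 'w \<Rightarrow> real) \<Rightarrow> bool" where
  "stationary_process M X \<longleftrightarrow>
     (\<forall>t. X t \<in> borel_measurable M) \<and>
     (\<forall>h. distr M (Pi\<^sub>M UNIV (\<lambda>_. borel)) (\<lambda>w t. X (t + h) w)
         = distr M (Pi\<^sub>M UNIV (\<lambda>_. borel)) (\<lambda>w t. X t w))"

definition iid_processes :: "'w measure \<Rightarrow> (nat \<Rightarrow> real \<Rightarrow> 'w \<Rightarrow> real) \<Rightarrow> bool" where
  "iid_processes M F \<longleftrightarrow>
     prob_space.indep_vars M (\<lambda>_. Pi\<^sub>M UNIV (\<lambda>_. borel)) (\<lambda>k w t. F k t w) UNIV \<and>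
     (\<forall>j k. distr M (Pi\<^sub>M UNIV (\<lambda>_. borel)) (\<lambda>w t. F j t w)
          = distr M (Pi\<^sub>M UNIV (\<lambda>_. borel)) (\<lambda>w t. F k t w))"

definition forcing_noise :: "'w measure \<Rightarrow> (real \<Rightarrow> real) \<Rightarrow> (nat \<Rightarrow> real \<Rightarrow> 'w \<Rightarrow> real) \<Rightarrow> bool" where
  "forcing_noise M K F \<longleftrightarrow>
     iid_processes M F \<and>
     (\<forall>k. stationary_process M (F k) \<and> centered_gaussian_process M (F k) \<and>
          (\<forall>t s. (LINT w|M. F k t w * F k s w) = K \<bar>t - s\<bar>))"

section \<open>Operators associated with a measure\<close>

definition spectral_measure :: "real measure \<Rightarrow> bool" where
  "spectral_measure \<nu> \<longleftrightarrow>
     sets \<nu> = sets borel \<and> absolutely_continuous lborel \<nu> \<and>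
     (\<exists>m::int. (\<integral>\<^sup>+x. ennreal ((1 + x\<^sup>2) powi (- m)) \<partial>\<nu>) < \<infinity>)"

definition fourier_in_L2 ::
    "real measure \<Rightarrow> ((real \<Rightarrow> complex) \<Rightarrow> complex) \<Rightarrow> (real \<Rightarrow> complex) \<Rightarrow> bool" where
  "fourier_in_L2 \<nu> f g \<longleftrightarrow>
     is_function (dist_fourier f) g \<and> (\<integral>\<^sup>+x. ennreal ((cmod (g x))\<^sup>2) \<partial>\<nu>) < \<infinity>"

definition op_dom :: "real measure \<Rightarrow> ((real \<Rightarrow> complex) \<Rightarrow> complex) set" where
  "op_dom \<nu> = {f \<in> tempered_distributions. \<exists>g. fourier_in_L2 \<nu> f g}"

text \<open>\<open>V f\<close> is the random variable written \<open>\<langle>V, f\<rangle>\<close>; only its values for \<open>f\<close> in \<open>op_dom \<nu>\<close> matter.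
  Centered Gaussian means that the real and imaginary parts of the \<open>V f\<close> are jointly Gaussian:
  every real linear combination of them is the real part of a complex one.\<close>

definition operator_assoc ::
    "'w measure \<Rightarrow> real measure \<Rightarrow> (((real \<Rightarrow> complex) \<Rightarrow> complex) \<Rightarrow> 'w \<Rightarrow> complex) \<Rightarrow> bool" where
  "operator_assoc M \<nu> V \<longleftrightarrow>
     spectral_measure \<nu> \<and>
     (\<forall>f\<in>op_dom \<nu>. V f \<in> borel_measurable M \<and> integrable M (\<lambda>w. (cmod (V f w))\<^sup>2)) \<and>
     (\<forall>f1\<in>op_dom \<nu>. \<forall>f2\<in>op_dom \<nu>. \<forall>a b.
        AE w in M. V (\<lambda>\<phi>. a * f1 \<phi> + b * f2 \<phi>) w = a * V f1 w + b * V f2 w) \<and>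
     (\<forall>f1\<in>op_dom \<nu>. \<forall>f2\<in>op_dom \<nu>. \<forall>g1 g2. fourier_in_L2 \<nu> f1 g1 \<longrightarrow> fourier_in_L2 \<nu> f2 g2 \<longrightarrow>
        (LINT w|M. V f1 w * cnj (V f2 w)) = (LINT y|\<nu>. g1 y * cnj (g2 y))) \<and>
     (\<forall>I c. finite I \<longrightarrow> I \<subseteq> op_dom \<nu> \<longrightarrow> centered_gaussian M (\<lambda>w. Re (\<Sum>f\<in>I. c f * V f w))) \<and>
     (\<forall>t. dirac t \<in> op_dom \<nu> \<longrightarrow> (AE w in M. Im (V (dirac t) w) = 0))"

section \<open>Stationary solutions\<close>

text \<open>The covariance of \<open>\<langle>F\<^sub>k, \<phi>\<rangle>\<close> and \<open>\<langle>F\<^sub>k, \<psi>\<rangle>\<close>; it is the same for all \<open>k\<close>.\<close>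

definition forcing_cov :: "(real \<Rightarrow> real) \<Rightarrow> (real \<Rightarrow> complex) \<Rightarrow> (real \<Rightarrow> complex) \<Rightarrow> complex" where
  "forcing_cov K \<phi> \<psi> = (LINT t|lborel. of_real (K t) * conv \<phi> (refl_fun (\<lambda>s. cnj (\<psi> s))) t)"

definition mode_adjoint ::
    "(real \<Rightarrow> real) \<Rightarrow> real \<Rightarrow> (real \<Rightarrow> complex) \<Rightarrow> (real \<Rightarrow> complex) \<Rightarrow> complex" where
  "mode_adjoint K a \<phi> =
     dist_of_fun (\<lambda>t. - vector_derivative \<phi> (at t) +
                      of_real a * refl_fun (conv (Kplus K) (refl_fun \<phi>)) t)"

text \<open>Weak stationary solution of the mode equation with \<open>\<alpha>\<^sub>k = a\<close> and \<open>\<lambda>\<^sub>k = l\<close>.\<close>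

definition weak_stationary_solution ::
    "'w measure \<Rightarrow> (real \<Rightarrow> real) \<Rightarrow> real \<Rightarrow> real \<Rightarrow> real measure \<Rightarrow>
       (((real \<Rightarrow> complex) \<Rightarrow> complex) \<Rightarrow> 'w \<Rightarrow> complex) \<Rightarrow> bool" where
  "weak_stationary_solution M K a l \<nu> V \<longleftrightarrow>
     operator_assoc M \<nu> V \<and>
     (\<forall>\<phi>\<in>schwartz. dist_of_fun (conv (Kplus K) \<phi>) \<in> op_dom \<nu>) \<and>
     (\<forall>\<phi>\<in>schwartz. \<forall>\<psi>\<in>schwartz.
        (LINT w|M. V (mode_adjoint K a \<phi>) w * cnj (V (mode_adjoint K a \<psi>) w))
          = of_real (l\<^sup>2) * forcing_cov K \<phi> \<psi>)"

text \<open>The operator \<open>A\<close> enters through its eigenvalues \<open>- \<alpha> k\<close> and eigenfunctions \<open>e k\<close>, the forcing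
  through \<open>lam\<close> and the covariance \<open>K\<close>. Convergence of the series \<open>u(t,x) = \<Sum>\<^sub>k u\<^sub>k(t) e\<^sub>k(x)\<close> is
  understood in \<open>L\<^sup>2(\<Omega>)\<close> at every point \<open>(t,x)\<close>, so that \<open>u t x\<close> is determined almost surely
  for every \<open>x\<close> and not just for almost every \<open>x\<close>.\<close>

definition stationary_solution ::
    "'w measure \<Rightarrow> 'a::euclidean_space set \<Rightarrow> (real \<Rightarrow> real) \<Rightarrow> (nat \<Rightarrow> real) \<Rightarrow> (nat \<Rightarrow> real) \<Rightarrow>
       (nat \<Rightarrow> 'a \<Rightarrow> real) \<Rightarrow> (real \<Rightarrow> 'a \<Rightarrow> 'w \<Rightarrow> real) \<Rightarrow> bool" where
  "stationary_solution M D K \<alpha> lam e u \<longleftrightarrow>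
     (\<forall>t. (\<lambda>(w, x). u t x w) \<in> borel_measurable (M \<Otimes>\<^sub>M lebesgue_on D) \<and>
          (\<integral>\<^sup>+w. (\<integral>\<^sup>+x. ennreal ((u t x w)\<^sup>2) \<partial>lebesgue_on D) \<partial>M) < \<infinity>) \<and>
     (\<exists>\<nu> V uk.
        (\<forall>k. weak_stationary_solution M K (\<alpha> k) (lam k) (\<nu> k) (V k)) \<and>
        prob_space.indep_vars M (\<lambda>k. Pi\<^sub>M (op_dom (\<nu> k)) (\<lambda>_. borel))
          (\<lambda>k w. \<lambda>f\<in>op_dom (\<nu> k). V k f w) UNIV \<and>
        (\<forall>k t. dirac t \<in> op_dom (\<nu> k) \<and> uk k t \<in> borel_measurable M \<and>
               (AE w in M. V k (dirac t) w = complex_of_real (uk k t w))) \<and>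
        (\<forall>t. \<forall>x\<in>D. (\<lambda>n. \<integral>\<^sup>+w. ennreal ((u t x w - (\<Sum>k<n. uk k t w * e k x))\<^sup>2) \<partial>M) \<longlonglongrightarrow> 0))"

section \<open>Modifications and Hoelder continuity\<close>

definition modification ::
    "'w measure \<Rightarrow> 'a set \<Rightarrow> (real \<Rightarrow> 'a \<Rightarrow> 'w \<Rightarrow> real) \<Rightarrow> (real \<Rightarrow> 'a \<Rightarrow> 'w \<Rightarrow> real) \<Rightarrow> bool" where
  "modification M D u U \<longleftrightarrow>
     (\<forall>t. \<forall>x\<in>D. U t x \<in> borel_measurable M \<and> (AE w in M. U t x w = u t x w))"

definition holder_time_space ::
    "'w measure \<Rightarrow> 'a::euclidean_space set \<Rightarrow> real \<Rightarrow> (real \<Rightarrow> 'a \<Rightarrow> 'w \<Rightarrow> real) \<Rightarrow> bool" where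
  "holder_time_space M D \<gamma> U \<longleftrightarrow>
     (AE w in M. \<forall>T>0. \<exists>C. \<forall>s\<in>{-T..T}. \<forall>t\<in>{-T..T}. \<forall>x\<in>D. \<forall>y\<in>D.
        \<bar>U t x w - U s y w\<bar> \<le> C * (\<bar>t - s\<bar> powr \<gamma> + norm (x - y) powr \<gamma>))"

end

(* Since the modes are independent centered Gaussians, E |u(t,x) - u(s,y)|^2 is a sum over k, and the
   theorem reduces to two bounds on the spectral measure nu_k: total mass O(lambda_k^2 / alpha_k) and second
   moment O(lambda_k^2). Interpolating them, and likewise the bounds on e_k and its gradient, gives the variance
   bound (|t - s| + |x - y|)^(2 (1 - eta)) times the convergent sum of lambda_k^2 c_k^2 / alpha_k^eta. Moments
   of all orders follow by Gaussianity, and the Hoelder modification by chaining over dyadic cells.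

   Testing the weak equation with derivatives of translated Gaussians identifies nu_k: up to a constant it has
   density lambda_k^2 / alpha_k * Re h(i omega), with h(z) = 1 / (z + alpha_k kappa(z)) and kappa the Laplace
   transform of K. With L = - K' and N = K'', the function D(z) = z kappa(z) is the integral of
   L(v) (1 - exp(- z v)), which makes sense on the closed half-plane even if K is not integrable, while
   kappa(z) is a mixture, with weight N(s), of the Laplace transforms of the tents max 0 (s - t); this gives
   Re kappa >= 0, hence Re h >= 0. As h(z) - 1 / z = O(|z|^(-3)), moving the line of integration to the right
   bounds the integral of Re h over vertical lines, and Fatou's lemma passes to the boundary. *)

theory Submission
  imports Defs "HOL-Complex_Analysis.Complex_Analysis" "HOL-Real_Asymp.Real_Asymp"
begin

section \<open>Dyadic chaining\<close>

text \<open>Only the sum of \<open>lambda^2 c^2 / alpha^eta\<close> is under control, so each bound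
  on a mode must show its dependence on alpha and be uniform otherwise. The decisive one is the
  total mass of order 1/alpha. It rests on a fluctuation-dissipation relation: forcing and memory
  share the kernel K, so the spectral density of the forcing is also the real part of the memory
  term. Hence the density of a mode is a real part, and its integral is compared with that of Re
  (1/z) over a vertical line, which is pi whatever alpha is.

  The obstacle is that K need not be integrable and K' may be unbounded at 0. Hence kappa is avoided
  on the imaginary axis: everything is multiplied by z, which leaves a bounded function D, and the
  weak equation is tested with derivatives, which supply this factor.

  Time and space get the same exponent because both trade alpha against squared distance at the same
  rate: replacing the order 1/alpha by the order 1 gains |t - s|^2 in one case and |x - y|^2 in the
  other. All moments are needed because chaining in dimension d + 1 costs a factor per level that a
  fixed moment beats only for small exponents.\<close>

definition dyadic_index :: "nat \<Rightarrow> 'a::euclidean_space \<Rightarrow> 'a \<Rightarrow> int" where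
  "dyadic_index j z = (\<lambda>b\<in>Basis. \<lfloor>2 ^ j * (z \<bullet> b)\<rfloor>)"

text \<open>The chosen point depends on \<open>z\<close> only through its cell. The approximations
  of a bounded piece of \<open>E\<close> therefore take finitely many values at each level, and they
  stay in \<open>E\<close>, where the process is controlled.\<close>

definition dyadic_rep :: "'a::euclidean_space set \<Rightarrow> nat \<Rightarrow> 'a \<Rightarrow> 'a" where
  "dyadic_rep E j z = (SOME w. w \<in> E \<and> dyadic_index j w = dyadic_index j z)"

lemma dyadic_rep:
  assumes "z \<in> E"
  shows "dyadic_rep E j z \<in> E" "dyadic_index j (dyadic_rep E j z) = dyadic_index j z"
  using someI[of "\<lambda>w. w \<in> E \<and> dyadic_index j w = dyadic_index j z" z] assms
  unfolding dyadic_rep_def by auto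

lemma norm_dyadic_rep_diff:
  fixes z :: "'a::euclidean_space"
  assumes "z \<in> E"
  shows "norm (dyadic_rep E j z - z) \<le> DIM('a) * (1/2) ^ j"
proof -
  define w where "w = dyadic_rep E j z"
  have "\<bar>(w - z) \<bullet> b\<bar> \<le> (1/2) ^ j" if "b \<in> Basis" for b
  proof -
    have "\<lfloor>2 ^ j * (w \<bullet> b)\<rfloor> = \<lfloor>2 ^ j * (z \<bullet> b)\<rfloor>"
      using dyadic_rep(2)[OF assms, of j] that
      by (auto simp: w_def dyadic_index_def restrict_def fun_eq_iff) metis
    then have "\<bar>2 ^ j * (w \<bullet> b) - 2 ^ j * (z \<bullet> b)\<bar> < 1"
      by linarith
    then have "2 ^ j * \<bar>(w - z) \<bullet> b\<bar> < 1"
      by (simp add: inner_diff_left abs_mult flip: right_diff_distrib)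
    then show ?thesis
      by (simp add: field_simps power_divide)
  qed
  then have "(\<Sum>b\<in>Basis. \<bar>(w - z) \<bullet> b\<bar>) \<le> DIM('a) * (1/2) ^ j"
    by (rule sum_bounded_above)
  then show ?thesis
    using norm_le_l1[of "w - z"] by (simp add: w_def)
qed

text \<open>Representatives are a function of the cell index, so counting the indices in a box of
  integers is enough.\<close>

lemma card_dyadic_rep:
  fixes E :: "'a::euclidean_space set" and R :: nat
  shows "finite (dyadic_rep E j ` (E \<inter> cball 0 R))"
    and "card (dyadic_rep E j ` (E \<inter> cball 0 R)) \<le> ((2 * R + 3) * 2 ^ j) ^ DIM('a)"
proof -
  define m :: int where "m = 2 ^ j * R + 1"
  define P where "P = PiE (Basis::'a set) (\<lambda>_. {-m..m})"
  define f where "f = (\<lambda>i. SOME w. w \<in> E \<and> dyadic_index j w = i)"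
  have "dyadic_index j z \<in> P" if "z \<in> cball 0 R" for z
  proof -
    have "\<lfloor>2 ^ j * (z \<bullet> b)\<rfloor> \<in> {-m..m}" if b: "b \<in> Basis" for b
    proof -
      have "\<bar>z \<bullet> b\<bar> \<le> R"
        using Basis_le_norm[OF b, of z] \<open>z \<in> cball 0 R\<close> by auto
      then have "\<bar>2 ^ j * (z \<bullet> b)\<bar> \<le> 2 ^ j * real R"
        by (simp add: abs_mult)
      then have "-(2 ^ j * real R) \<le> 2 ^ j * (z \<bullet> b)" "2 ^ j * (z \<bullet> b) \<le> 2 ^ j * real R"
        by linarith+
      moreover have "real_of_int m = 2 ^ j * real R + 1" by (simp add: m_def)
      ultimately have "- real_of_int m \<le> 2 ^ j * (z \<bullet> b)" "2 ^ j * (z \<bullet> b) \<le> real_of_int m"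
        by linarith+
      then show ?thesis
        unfolding atLeastAtMost_iff by linarith
    qed
    then show ?thesis by (auto simp: P_def dyadic_index_def)
  qed
  then have sub: "dyadic_rep E j ` (E \<inter> cball 0 R) \<subseteq> f ` P"
    by (auto simp: dyadic_rep_def f_def)
  have fin: "finite P" by (auto simp: P_def intro!: finite_PiE)
  show "finite (dyadic_rep E j ` (E \<inter> cball 0 R))"
    using sub fin finite_subset by blast
  have "card (dyadic_rep E j ` (E \<inter> cball 0 R)) \<le> card P"
    using sub fin by (meson surj_card_le)
  also have "card P = (nat (2 * m + 1)) ^ DIM('a)"
    by (simp add: P_def card_PiE)
  also have "nat (2 * m + 1) = 2 * (2 ^ j * R + 1) + 1"
    unfolding m_def by (simp add: nat_eq_iff)
  also have "(2 * (2 ^ j * R + 1) + 1) ^ DIM('a) \<le> ((2 * R + 3) * 2 ^ j) ^ DIM('a)"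
    by (intro power_mono) (auto simp: algebra_simps)
  finally show "card (dyadic_rep E j ` (E \<inter> cball 0 R)) \<le> ((2 * R + 3) * 2 ^ j) ^ DIM('a)" .
qed

lemma dyadic_scale_exists:
  fixes d :: real
  assumes "0 < d" "d \<le> (1/2) ^ J"
  obtains j where "J \<le> j" "d \<le> (1/2) ^ j" "(1/2) ^ j < 2 * d"
proof -
  define P where "P = (\<lambda>j. (1/2::real) ^ Suc j < d)"
  obtain n where "(1/2::real) ^ n < d"
    using real_arch_pow_inv[OF assms(1), of "1/2"] by auto
  then have "P n" using assms(1) by (simp add: P_def)
  define j where "j = (LEAST j. P j)"
  have Pj: "P j" unfolding j_def using \<open>P n\<close> by (rule LeastI)
  have "J \<le> j"
  proof (rule ccontr)
    assume "\<not> J \<le> j"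
    then have "(1/2::real) ^ J \<le> (1/2) ^ Suc j" by (intro power_decreasing) auto
    then show False using Pj assms by (auto simp: P_def)
  qed
  moreover have "d \<le> (1/2) ^ j"
  proof (cases j)
    case 0
    have "(1/2::real) ^ J \<le> 1" by (simp add: power_le_one)
    then show ?thesis using 0 assms by simp
  next
    case (Suc i)
    then have "\<not> P i" unfolding j_def by (metis j_def lessI not_less_Least)
    then show ?thesis using Suc by (simp add: P_def)
  qed
  moreover have "(1/2) ^ j < 2 * d" using Pj by (simp add: P_def)
  ultimately show ?thesis using that by blast
qed

text \<open>A deterministic statement about limits along representatives. The hypothesis is used
  twice: for the step from level j to j + 1 at one point, whose representatives are within (3/2) n
  2^-j of each other, and for two points at distance at most 2^-j, whose representatives are within
  (2 n + 1) 2^-j. The constant 4 n covers both, and \<open>S j\<close> holds two consecutive levels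
  for the sake of the first.\<close>

lemma dyadic_chaining:
  fixes f :: "'a::euclidean_space \<Rightarrow> real" and R :: nat
  assumes \<gamma>: "0 < \<gamma>"
    and E: "E' = E \<inter> cball 0 R"
    and S: "\<And>j. S j = dyadic_rep E j ` E' \<union> dyadic_rep E (Suc j) ` E'"
    and pairs: "\<And>j a b. J \<le> j \<Longrightarrow> a \<in> S j \<Longrightarrow> b \<in> S j \<Longrightarrow> norm (a - b) \<le> 4 * DIM('a) * (1/2) ^ j \<Longrightarrow>
      \<bar>f a - f b\<bar> \<le> (2 powr - \<gamma>) ^ j"
  shows "\<exists>C. \<forall>z\<in>E'. \<forall>w\<in>E'. \<bar>lim (\<lambda>j. f (dyadic_rep E j z)) - lim (\<lambda>j. f (dyadic_rep E j w))\<bar>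
     \<le> C * norm (z - w) powr \<gamma>"
proof -
  define n where "n = DIM('a)"
  have n1: "real n \<ge> 1" by (simp add: n_def Suc_leI)
  define q :: real where "q = 2 powr - \<gamma>"
  have q: "0 < q" "q < 1"
    using \<gamma> powr_less_mono[of "- \<gamma>" 0 2] by (auto simp: q_def)
  have qpow: "q ^ j = ((1/2) ^ j) powr \<gamma>" for j
  proof -
    have "q = (1/2) powr \<gamma>" by (simp add: q_def powr_minus powr_divide inverse_eq_divide)
    then show ?thesis
      by (simp add: powr_power powr_realpow flip: powr_realpow) (simp add: powr_powr mult.commute)
  qed
  define F where "F j z = f (dyadic_rep E j z)" for j z
  define G where "G z = lim (\<lambda>j. F j z)" for z
  have rep: "norm (dyadic_rep E j z - z) \<le> n * (1/2) ^ j" if "z \<in> E'" for j z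
    using norm_dyadic_rep_diff[of z E j] that E by (auto simp: n_def)
  have step: "\<bar>F (Suc j) z - F j z\<bar> \<le> q ^ j" if z: "z \<in> E'" and "J \<le> j" for j z
  proof -
    have "norm (dyadic_rep E (Suc j) z - dyadic_rep E j z)
       \<le> norm (dyadic_rep E (Suc j) z - z) + norm (dyadic_rep E j z - z)"
      by norm
    also have "\<dots> \<le> n * (1/2) ^ Suc j + n * (1/2) ^ j"
      using rep[OF z, of j] rep[OF z, of "Suc j"] by linarith
    also have "\<dots> \<le> 4 * n * (1/2) ^ j" by simp
    finally show ?thesis
      unfolding F_def q_def n_def using z that by (intro pairs) (auto simp: S)
  qed
  have diff: "\<bar>F (j + m) z - F j z\<bar> \<le> q ^ j / (1 - q)" if z: "z \<in> E'" and j: "J \<le> j" for j m z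
  proof -
    have "\<bar>F (j + m) z - F j z\<bar> \<le> q ^ j * (1 - q ^ m) / (1 - q)"
    proof (induction m)
      case (Suc m)
      have "\<bar>F (j + Suc m) z - F j z\<bar> \<le> \<bar>F (Suc (j + m)) z - F (j + m) z\<bar> + \<bar>F (j + m) z - F j z\<bar>"
        by simp
      also have "\<dots> \<le> q ^ (j + m) + q ^ j * (1 - q ^ m) / (1 - q)"
        using step[OF z, of "j + m"] j Suc.IH by linarith
      also have "\<dots> = q ^ j * (1 - q ^ Suc m) / (1 - q)"
        using q by (simp add: field_simps power_add)
      finally show ?case .
    qed simp
    also have "\<dots> \<le> q ^ j * 1 / (1 - q)"
      using q by (intro divide_right_mono mult_left_mono) auto
    finally show ?thesis by simp
  qed
  have conv: "(\<lambda>j. F j z) \<longlonglongrightarrow> G z" if z: "z \<in> E'" for z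
  proof -
    have "Cauchy (\<lambda>j. F j z)"
    proof (rule metric_CauchyI)
      fix e :: real assume e: "0 < e"
      have "(\<lambda>j. q ^ j / (1 - q)) \<longlonglongrightarrow> 0 / (1 - q)"
        using q by (intro tendsto_intros LIMSEQ_power_zero) auto
      then have "\<forall>\<^sub>F j in sequentially. q ^ j / (1 - q) < e / 2"
        using e by (intro order_tendstoD) auto
      then obtain j0 where j0: "\<And>j. j \<ge> j0 \<Longrightarrow> q ^ j / (1 - q) < e / 2"
        by (auto simp: eventually_sequentially)
      define k where "k = max J j0"
      have "dist (F a z) (F k z) < e / 2" if "a \<ge> k" for a
        using diff[OF z, of k "a - k"] j0[of k] that unfolding k_def dist_real_def
        by (metis le_add_diff_inverse le_less_trans max.cobounded1 max.cobounded2)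
      then have "dist (F a z) (F b z) < e" if "a \<ge> k" "b \<ge> k" for a b
        using that dist_triangle_half_l by blast
      then show "\<exists>M. \<forall>m\<ge>M. \<forall>n\<ge>M. dist (F m z) (F n z) < e" by blast
    qed
    then show ?thesis
      unfolding G_def by (metis real_Cauchy_convergent convergent_LIMSEQ_iff)
  qed
  have Gdiff: "\<bar>G z - F j z\<bar> \<le> q ^ j / (1 - q)" if z: "z \<in> E'" and j: "J \<le> j" for j z
  proof (rule tendsto_upperbound)
    show "(\<lambda>m. \<bar>F (m + j) z - F j z\<bar>) \<longlonglongrightarrow> \<bar>G z - F j z\<bar>"
      by (intro tendsto_intros LIMSEQ_ignore_initial_segment conv z)
    show "\<forall>\<^sub>F m in sequentially. \<bar>F (m + j) z - F j z\<bar> \<le> q ^ j / (1 - q)"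
      using diff[OF z j] by (simp add: add.commute)
  qed auto
  \<comment> \<open>Pairs farther apart than 2^-J are treated by boundedness: at level
    \<open>J\<close> only finitely many values of \<open>f\<close> occur.\<close>
  define A where "A = Max (insert 0 ((\<lambda>a. \<bar>f a\<bar>) ` (dyadic_rep E J ` E')))"
  have "finite (dyadic_rep E J ` E')" unfolding E by (rule card_dyadic_rep)
  then have A: "\<bar>F J z\<bar> \<le> A" if "z \<in> E'" for z
    unfolding A_def F_def using that by (intro Max_ge) auto
  define B where "B = 2 / (1 - q) + 2 * A + 1"
  have "A \<ge> 0" unfolding A_def using \<open>finite (dyadic_rep E J ` E')\<close> by (intro Max_ge) auto
  have GB: "\<bar>G z - G w\<bar> \<le> B" if "z \<in> E'" "w \<in> E'" for z w
  proof -
    have "q ^ J \<le> 1" using q by (simp add: power_le_one)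
    then have "q ^ J / (1 - q) \<le> 1 / (1 - q)" using q by (simp add: divide_right_mono)
    then show ?thesis using Gdiff[OF that(1), of J] Gdiff[OF that(2), of J] A[OF that(1)] A[OF that(2)]
      by (simp add: B_def)
  qed
  \<comment> \<open>The first summand serves pairs within 2^-J, the second all others, for which
    \<open>2 ^ J * norm (z - w)\<close> is at least 1.\<close>
  define C where "C = (1 + 2 / (1 - q)) * 2 powr \<gamma> + B * (2 ^ J) powr \<gamma>"
  have B0: "B \<ge> 0" using q \<open>A \<ge> 0\<close> by (simp add: B_def)
  have C0: "(1 + 2 / (1 - q)) * 2 powr \<gamma> \<le> C" "B * (2 ^ J) powr \<gamma> \<le> C"
    using q B0 by (auto simp: C_def)
  have "\<bar>G z - G w\<bar> \<le> C * norm (z - w) powr \<gamma>" if z: "z \<in> E'" and w: "w \<in> E'" for z w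
  proof (cases "z = w")
    case False
    define d where "d = norm (z - w)"
    have d: "d > 0" using False by (simp add: d_def)
    show ?thesis
    proof (cases "d \<le> (1/2) ^ J")
      case True
      then obtain j where j: "J \<le> j" "d \<le> (1/2) ^ j" "(1/2) ^ j < 2 * d"
        using dyadic_scale_exists d by blast
      have "norm (dyadic_rep E j z - dyadic_rep E j w)
          \<le> norm (dyadic_rep E j z - z) + norm (z - w) + norm (dyadic_rep E j w - w)"
        by norm
      also have "\<dots> \<le> n * (1/2) ^ j + 1 * (1/2) ^ j + n * (1/2) ^ j"
        using rep[OF z, of j] rep[OF w, of j] j by (simp add: d_def)
      also have "\<dots> = (n + 1 + n) * (1/2) ^ j" by (simp add: algebra_simps)
      also have "\<dots> \<le> 4 * n * (1/2) ^ j"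
        using n1 by (intro mult_right_mono) auto
      finally have "\<bar>F j z - F j w\<bar> \<le> q ^ j"
        unfolding F_def q_def n_def using z w j by (intro pairs) (auto simp: S)
      then have "\<bar>G z - G w\<bar> \<le> q ^ j + 2 * (q ^ j / (1 - q))"
        using Gdiff[OF z j(1)] Gdiff[OF w j(1)] by linarith
      also have "\<dots> = (1 + 2 / (1 - q)) * q ^ j" using q by (simp add: field_simps)
      also have "q ^ j \<le> (2 * d) powr \<gamma>"
        unfolding qpow using j \<gamma> by (intro powr_mono2) auto
      also have "(2 * d) powr \<gamma> = 2 powr \<gamma> * d powr \<gamma>" using d by (simp add: powr_mult)
      finally have "\<bar>G z - G w\<bar> \<le> ((1 + 2 / (1 - q)) * 2 powr \<gamma>) * d powr \<gamma>"
        using q by (simp add: mult.assoc mult_left_mono)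
      also have "\<dots> \<le> C * d powr \<gamma>" using C0 by (intro mult_right_mono) auto
      finally show ?thesis by (simp add: d_def)
    next
      case False
      then have "1 \<le> 2 ^ J * d" by (simp add: field_simps power_divide)
      then have "1 \<le> (2 ^ J * d) powr \<gamma>" using \<gamma> by (simp add: ge_one_powr_ge_zero)
      then have "B * 1 \<le> B * (2 ^ J * d) powr \<gamma>" using B0 by (intro mult_left_mono) auto
      also have "\<dots> = B * (2 ^ J) powr \<gamma> * d powr \<gamma>" using d by (simp add: powr_mult)
      also have "\<dots> \<le> C * d powr \<gamma>" using C0 by (intro mult_right_mono) auto
      finally show ?thesis using GB[OF z w] by (simp add: d_def)
    qed
  qed simp
  then show ?thesis unfolding G_def F_def by blast
qed

section \<open>Borel-Cantelli and the continuous modification\<close>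

lemma AE_eventually_less_if_summable:
  assumes M: "prob_space M"
    and A: "\<And>n. A n \<in> sets M" and le: "\<And>n. measure M (A n) \<le> c * r ^ n" and r: "0 \<le> r" "r < 1"
  shows "AE \<omega> in M. \<forall>\<^sub>F n in sequentially. \<omega> \<notin> A n"
proof -
  interpret prob_space M by fact
  have "summable (\<lambda>n. measure M (A n))"
  proof (rule summable_comparison_test')
    show "summable (\<lambda>n. c * r ^ n)" using r by (intro summable_mult summable_geometric) auto
    show "norm (measure M (A n)) \<le> c * r ^ n" if "0 \<le> n" for n using le[of n] by simp
  qed
  then have "AE x in M. eventually (\<lambda>n. x \<in> space M - A n) sequentially"
    using A by (intro borel_cantelli_AE1) (auto simp: emeasure_eq_measure)
  then show ?thesis by eventually_elim (auto elim: eventually_mono)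
qed

text \<open>Level j has of the order of 4^(n j) pairs of representatives, and a pair is bad with
  probability of the order of 2^(2 p (\<gamma> - \<beta>) j). For \<gamma> < \<beta> the product is
  summable once p is large, which is why the tail bound is assumed for every p. \<open>U\<close> is
  one limit for all exponents; only the exceptional set depends on \<gamma>.\<close>

theorem kolmogorov_continuity_dyadic:
  fixes X :: "'a::euclidean_space \<Rightarrow> 'w \<Rightarrow> real"
  assumes M: "prob_space M" and meas: "\<And>z. z \<in> E \<Longrightarrow> X z \<in> borel_measurable M"
    and \<beta>: "\<beta> > 0"
    and tail: "\<And>p::nat. \<exists>C. \<forall>z\<in>E. \<forall>w\<in>E. \<forall>\<epsilon>>0.
       measure M {\<omega> \<in> space M. \<epsilon> \<le> \<bar>X z \<omega> - X w \<omega>\<bar>} \<le> C * (norm (z - w) powr \<beta> / \<epsilon>) ^ (2 * p)"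
  shows "\<exists>U. (\<forall>z\<in>E. U z \<in> borel_measurable M \<and> (AE \<omega> in M. U z \<omega> = X z \<omega>)) \<and>
     (\<forall>\<gamma>. 0 < \<gamma> \<and> \<gamma> < \<beta> \<longrightarrow> (AE \<omega> in M. \<forall>R. \<exists>C. \<forall>z\<in>E \<inter> cball 0 R. \<forall>w\<in>E \<inter> cball 0 R.
        \<bar>U z \<omega> - U w \<omega>\<bar> \<le> C * norm (z - w) powr \<gamma>))"
proof -
  interpret prob_space M by fact
  define n where "n = DIM('a)"
  define U where "U z \<omega> = lim (\<lambda>j. X (dyadic_rep E j z) \<omega>)" for z \<omega>
  define s where "s = 2 powr - \<beta>"
  have s_pow: "((1/2) ^ j) powr \<beta> = s ^ j" for j
  proof -
    have "s = (1/2) powr \<beta>" by (simp add: s_def powr_minus powr_divide inverse_eq_divide)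
    then show ?thesis
      by (simp add: powr_power powr_realpow flip: powr_realpow) (simp add: powr_powr mult.commute)
  qed
  have incr: "\<exists>C. \<forall>z\<in>E. \<forall>w\<in>E. \<forall>j. norm (z - w) \<le> 4 * n * (1/2) ^ j \<longrightarrow>
       measure M {\<omega> \<in> space M. (2 powr - \<gamma>) ^ j \<le> \<bar>X z \<omega> - X w \<omega>\<bar>} \<le> C * ((2 powr (\<gamma> - \<beta>)) ^ (2 * p)) ^ j"
    for \<gamma> :: real and p :: nat
  proof -
    obtain C0 where C0: "\<forall>z\<in>E. \<forall>w\<in>E. \<forall>\<epsilon>>0. measure M {\<omega> \<in> space M. \<epsilon> \<le> \<bar>X z \<omega> - X w \<omega>\<bar>} \<le>
        C0 * (norm (z - w) powr \<beta> / \<epsilon>) ^ (2 * p)"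
      using tail by blast
    define C where "C = \<bar>C0\<bar> * ((4 * n) powr \<beta>) ^ (2 * p)"
    have "measure M {\<omega> \<in> space M. (2 powr - \<gamma>) ^ j \<le> \<bar>X z \<omega> - X w \<omega>\<bar>} \<le> C * ((2 powr (\<gamma> - \<beta>)) ^ (2 * p)) ^ j"
      if zw: "z \<in> E" "w \<in> E" and d: "norm (z - w) \<le> 4 * n * (1/2) ^ j" for z w j
    proof -
      define \<epsilon> :: real where "\<epsilon> = (2 powr - \<gamma>) ^ j"
      have \<epsilon>: "\<epsilon> > 0" by (simp add: \<epsilon>_def)
      have "norm (z - w) powr \<beta> \<le> (4 * n * (1/2) ^ j) powr \<beta>"
        using d \<beta> by (intro powr_mono2) auto
      also have "\<dots> = (4 * n) powr \<beta> * s ^ j"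
        by (subst powr_mult) (auto simp: s_pow)
      finally have "norm (z - w) powr \<beta> / \<epsilon> \<le> (4 * n) powr \<beta> * s ^ j / \<epsilon>"
        using \<epsilon> by (intro divide_right_mono) auto
      also have "\<dots> = (4 * n) powr \<beta> * (2 powr (\<gamma> - \<beta>)) ^ j"
        by (simp add: \<epsilon>_def s_def powr_diff powr_minus field_simps power_divide)
      finally have le: "(norm (z - w) powr \<beta> / \<epsilon>) ^ (2 * p) \<le> ((4 * n) powr \<beta> * (2 powr (\<gamma> - \<beta>)) ^ j) ^ (2 * p)"
        using \<epsilon> by (intro power_mono) auto
      have "measure M {\<omega> \<in> space M. \<epsilon> \<le> \<bar>X z \<omega> - X w \<omega>\<bar>} \<le> C0 * (norm (z - w) powr \<beta> / \<epsilon>) ^ (2 * p)"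
        using C0 zw \<epsilon> by blast
      also have "\<dots> \<le> \<bar>C0\<bar> * (norm (z - w) powr \<beta> / \<epsilon>) ^ (2 * p)"
        using \<epsilon> by (intro mult_right_mono) auto
      also have "\<dots> \<le> \<bar>C0\<bar> * ((4 * n) powr \<beta> * (2 powr (\<gamma> - \<beta>)) ^ j) ^ (2 * p)"
        using le by (intro mult_left_mono) auto
      also have "\<dots> = C * ((2 powr (\<gamma> - \<beta>)) ^ (2 * p)) ^ j"
        by (simp add: C_def power_mult_distrib flip: power_mult) (simp add: mult.commute)
      finally show ?thesis by (simp add: \<epsilon>_def)
    qed
    then show ?thesis by blast
  qed
  have "U z \<in> borel_measurable M \<and> (AE \<omega> in M. U z \<omega> = X z \<omega>)" if z: "z \<in> E" for z
  proof
    note [measurable] = meas[OF dyadic_rep(1)[OF z]] meas[OF z]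
    show "U z \<in> borel_measurable M" unfolding U_def by measurable
    \<comment> \<open>A single pair per level is compared here, so nothing has to be counted: the
      second moment and any exponent strictly between 0 and \<beta> suffice.\<close>
    define \<gamma> where "\<gamma> = \<beta> / 2"
    obtain C where C: "\<forall>z\<in>E. \<forall>w\<in>E. \<forall>j. norm (z - w) \<le> 4 * n * (1/2) ^ j \<longrightarrow>
       measure M {\<omega> \<in> space M. (2 powr - \<gamma>) ^ j \<le> \<bar>X z \<omega> - X w \<omega>\<bar>} \<le> C * ((2 powr (\<gamma> - \<beta>)) ^ (2 * 1)) ^ j"
      using incr[of \<gamma> 1] by blast
    have n4: "n * (1/2) ^ j \<le> 4 * n * (1/2::real) ^ j" for j by simp
    have "AE \<omega> in M. \<forall>\<^sub>F j in sequentially.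
        \<omega> \<notin> {\<omega> \<in> space M. (2 powr - \<gamma>) ^ j \<le> \<bar>X (dyadic_rep E j z) \<omega> - X z \<omega>\<bar>}"
    proof (rule AE_eventually_less_if_summable[OF M])
      show "measure M {\<omega> \<in> space M. (2 powr - \<gamma>) ^ j \<le> \<bar>X (dyadic_rep E j z) \<omega> - X z \<omega>\<bar>}
         \<le> C * ((2 powr (\<gamma> - \<beta>)) ^ (2 * 1)) ^ j" for j
        using order_trans[OF norm_dyadic_rep_diff[OF z] n4[of j, unfolded n_def]] C[rule_format, OF dyadic_rep(1)[OF z] z, of j]
        unfolding n_def by blast
      show "(2 powr (\<gamma> - \<beta>)) ^ (2 * 1) < 1"
        using \<beta> powr_less_mono[of "\<gamma> - \<beta>" 0 2] by (simp add: \<gamma>_def power_less_one_iff)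
    qed auto
    then show "AE \<omega> in M. U z \<omega> = X z \<omega>"
      using AE_space
    proof eventually_elim
      fix \<omega> assume *: "\<forall>\<^sub>F j in sequentially.
        \<omega> \<notin> {\<omega> \<in> space M. (2 powr - \<gamma>) ^ j \<le> \<bar>X (dyadic_rep E j z) \<omega> - X z \<omega>\<bar>}" and sp: "\<omega> \<in> space M"
      have "(\<lambda>j. X (dyadic_rep E j z) \<omega> - X z \<omega>) \<longlonglongrightarrow> 0"
      proof (rule Lim_null_comparison)
        show "\<forall>\<^sub>F j in sequentially. norm (X (dyadic_rep E j z) \<omega> - X z \<omega>) \<le> (2 powr - \<gamma>) ^ j"
          using * by eventually_elim (use sp in auto)
        show "(\<lambda>j. (2 powr - \<gamma>) ^ j) \<longlonglongrightarrow> 0"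
          using \<beta> powr_less_mono[of "- \<gamma>" 0 2] by (intro LIMSEQ_power_zero) (auto simp: \<gamma>_def)
      qed
      then have "(\<lambda>j. X (dyadic_rep E j z) \<omega>) \<longlonglongrightarrow> X z \<omega>"
        by (simp add: LIM_zero_iff)
      then show "U z \<omega> = X z \<omega>" by (simp add: U_def limI)
    qed
  qed
  moreover have "AE \<omega> in M. \<forall>R. \<exists>C. \<forall>z\<in>E \<inter> cball 0 R. \<forall>w\<in>E \<inter> cball 0 R.
        \<bar>U z \<omega> - U w \<omega>\<bar> \<le> C * norm (z - w) powr \<gamma>" if \<gamma>: "0 < \<gamma>" "\<gamma> < \<beta>" for \<gamma>
  proof -
    have "\<exists>p::nat. 4 ^ n * ((2 powr (\<gamma> - \<beta>))\<^sup>2) ^ p < (1::real)"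
    proof -
      have "(2 powr (\<gamma> - \<beta>))\<^sup>2 < 1"
        using \<gamma> powr_less_mono[of "\<gamma> - \<beta>" 0 2] by (simp add: power_less_one_iff)
      then obtain p where "((2 powr (\<gamma> - \<beta>))\<^sup>2) ^ p < 1 / 4 ^ n"
        using real_arch_pow_inv[of "1 / 4 ^ n" "(2 powr (\<gamma> - \<beta>))\<^sup>2"] by auto
      then have "4 ^ n * ((2 powr (\<gamma> - \<beta>))\<^sup>2) ^ p < 4 ^ n * (1 / 4 ^ n)"
        by (intro mult_strict_left_mono) auto
      then show ?thesis by auto
    qed
    then obtain p :: nat where p: "4 ^ n * (2 powr (\<gamma> - \<beta>)) ^ (2 * p) < (1::real)"
      by (auto simp: power_mult)
    obtain C where C: "\<forall>z\<in>E. \<forall>w\<in>E. \<forall>j. norm (z - w) \<le> 4 * n * (1/2) ^ j \<longrightarrow>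
       measure M {\<omega> \<in> space M. (2 powr - \<gamma>) ^ j \<le> \<bar>X z \<omega> - X w \<omega>\<bar>} \<le> C * ((2 powr (\<gamma> - \<beta>)) ^ (2 * p)) ^ j"
      using incr[of \<gamma> p] by blast
    have "AE \<omega> in M. \<exists>C. \<forall>z\<in>E \<inter> cball 0 (real R). \<forall>w\<in>E \<inter> cball 0 (real R).
        \<bar>U z \<omega> - U w \<omega>\<bar> \<le> C * norm (z - w) powr \<gamma>" for R :: nat
    proof -
      define E' where "E' = E \<inter> cball 0 (real R)"
      define S where "S j = dyadic_rep E j ` E' \<union> dyadic_rep E (Suc j) ` E'" for j
      have SE: "S j \<subseteq> E" for j by (auto simp: S_def E'_def dyadic_rep)
      have finS: "finite (S j)" for j unfolding S_def E'_def by (intro finite_UnI card_dyadic_rep)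
      define D where "D = 2 * ((2 * real R + 3) * 2) ^ n"
      have cardS: "real (card (S j)) \<le> D * (2 ^ n) ^ j" for j
      proof -
        have "card (S j) \<le> card (dyadic_rep E j ` E') + card (dyadic_rep E (Suc j) ` E')"
          unfolding S_def by (rule card_Un_le)
        also have "\<dots> \<le> ((2 * R + 3) * 2 ^ j) ^ n + ((2 * R + 3) * 2 ^ Suc j) ^ n"
          unfolding E'_def n_def by (intro add_mono card_dyadic_rep)
        also have "\<dots> \<le> ((2 * R + 3) * 2 ^ Suc j) ^ n + ((2 * R + 3) * 2 ^ Suc j) ^ n"
          by (intro add_mono power_mono) auto
        also have "\<dots> = 2 * ((2 * R + 3) * 2 * 2 ^ j) ^ n"
            by (simp only: power_Suc mult.assoc mult_2[symmetric])
        finally have "real (card (S j)) \<le> real (2 * ((2 * R + 3) * 2 * 2 ^ j) ^ n)"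
          by (simp only: of_nat_le_iff)
        also have "\<dots> = D * (2 ^ n) ^ j"
          by (simp add: D_def power_mult_distrib mult.commute flip: power_mult)
        finally show ?thesis .
      qed
      define bad where "bad j a b = {\<omega> \<in> space M. (2 powr - \<gamma>) ^ j \<le> \<bar>X a \<omega> - X b \<omega>\<bar>}" for j a b
      define I where "I j = {(a, b) \<in> S j \<times> S j. norm (a - b) \<le> 4 * n * (1/2) ^ j}" for j
      have finI: "finite (I j)" for j
        by (rule finite_subset[of _ "S j \<times> S j"]) (auto simp: I_def finS)
      define A where "A j = (\<Union>(a, b)\<in>I j. bad j a b)" for j
      have badsets: "bad j a b \<in> sets M" if "a \<in> E" "b \<in> E" for j a b
      proof -
        note [measurable] = meas[OF that(1)] meas[OF that(2)]
        show ?thesis unfolding bad_def by measurable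
      qed
      have IE: "a \<in> E" "b \<in> E" if "(a, b) \<in> I j" for a b j
        using that SE by (auto simp: I_def)
      have "AE \<omega> in M. \<forall>\<^sub>F j in sequentially. \<omega> \<notin> A j"
      proof (rule AE_eventually_less_if_summable[OF M])
        show "A j \<in> sets M" for j
          unfolding A_def using IE badsets finI by (intro sets.finite_UN) auto
        show "measure M (A j) \<le> (D * D * \<bar>C\<bar>) * (4 ^ n * (2 powr (\<gamma> - \<beta>)) ^ (2 * p)) ^ j" for j
        proof -
          define t where "t = ((2 powr (\<gamma> - \<beta>)) ^ (2 * p)) ^ j"
          have t: "t \<ge> 0" by (simp add: t_def)
          have "measure M (A j) \<le> (\<Sum>(a, b)\<in>I j. measure M (bad j a b))"
            unfolding A_def
            using measure_UNION_le[OF finI, where M = M and F = "\<lambda>ab. bad j (fst ab) (snd ab)"] IE badsets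
            by (auto simp: case_prod_beta')
          also have "\<dots> \<le> (\<Sum>(a, b)\<in>I j. \<bar>C\<bar> * t)"
          proof (rule sum_mono, clarify)
            fix a b assume ab: "(a, b) \<in> I j"
            then have "measure M (bad j a b) \<le> C * t"
              using C IE[OF ab] unfolding bad_def t_def by (auto simp: I_def)
            also have "\<dots> \<le> \<bar>C\<bar> * t" using t by (intro mult_right_mono) auto
            finally show "measure M (bad j a b) \<le> \<bar>C\<bar> * t" .
          qed
          also have "\<dots> = real (card (I j)) * (\<bar>C\<bar> * t)" by simp
          also have "\<dots> \<le> (D * (2 ^ n) ^ j * (D * (2 ^ n) ^ j)) * (\<bar>C\<bar> * t)"
          proof (rule mult_right_mono)
            have "card (I j) \<le> card (S j \<times> S j)"
              by (rule card_mono) (auto simp: I_def finS)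
            then have "real (card (I j)) \<le> real (card (S j)) * real (card (S j))"
              by (simp add: card_cartesian_product flip: of_nat_mult)
            also have "\<dots> \<le> (D * (2 ^ n) ^ j * (D * (2 ^ n) ^ j))"
              using cardS[of j] by (intro mult_mono) auto
            finally show "real (card (I j)) \<le> (D * (2 ^ n) ^ j * (D * (2 ^ n) ^ j))" .
          qed (use t in auto)
          also have "\<dots> = (D * D * \<bar>C\<bar>) * (((2 ^ n) ^ j * (2 ^ n) ^ j) * t)" by simp
          also have "(2 ^ n) ^ j * (2 ^ n) ^ j = ((4::real) ^ n) ^ j"
            by (simp flip: power_mult_distrib)
          finally show ?thesis by (simp add: t_def power_mult_distrib)
        qed
      qed (use p in auto)
      then show ?thesis
        using AE_space
      proof eventually_elim
        fix \<omega> assume "\<forall>\<^sub>F j in sequentially. \<omega> \<notin> A j" and sp: "\<omega> \<in> space M"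
        then obtain J where J: "\<And>j. j \<ge> J \<Longrightarrow> \<omega> \<notin> A j"
          by (auto simp: eventually_sequentially)
        have "\<exists>C. \<forall>z\<in>E'. \<forall>w\<in>E'. \<bar>lim (\<lambda>j. X (dyadic_rep E j z) \<omega>) - lim (\<lambda>j. X (dyadic_rep E j w) \<omega>)\<bar>
           \<le> C * norm (z - w) powr \<gamma>"
        proof (rule dyadic_chaining[where f = "\<lambda>a. X a \<omega>" and S = S and J = J, OF \<gamma>(1) E'_def S_def])
          fix j a b assume "J \<le> j" "a \<in> S j" "b \<in> S j" "norm (a - b) \<le> 4 * DIM('a) * (1/2) ^ j"
          then show "\<bar>X a \<omega> - X b \<omega>\<bar> \<le> (2 powr - \<gamma>) ^ j"
            using J[of j] sp by (force simp: A_def I_def bad_def n_def)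
        qed
        then show "\<exists>C. \<forall>z\<in>E \<inter> cball 0 (real R). \<forall>w\<in>E \<inter> cball 0 (real R).
          \<bar>U z \<omega> - U w \<omega>\<bar> \<le> C * norm (z - w) powr \<gamma>"
          unfolding U_def E'_def .
      qed
    qed
    then have "AE \<omega> in M. \<forall>R::nat. \<exists>C. \<forall>z\<in>E \<inter> cball 0 (real R). \<forall>w\<in>E \<inter> cball 0 (real R).
        \<bar>U z \<omega> - U w \<omega>\<bar> \<le> C * norm (z - w) powr \<gamma>"
      unfolding AE_all_countable by blast
    then show ?thesis
    proof eventually_elim
      fix \<omega> assume *: "\<forall>R::nat. \<exists>C. \<forall>z\<in>E \<inter> cball 0 (real R). \<forall>w\<in>E \<inter> cball 0 (real R).
        \<bar>U z \<omega> - U w \<omega>\<bar> \<le> C * norm (z - w) powr \<gamma>"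
      show "\<forall>R. \<exists>C. \<forall>z\<in>E \<inter> cball 0 R. \<forall>w\<in>E \<inter> cball 0 R. \<bar>U z \<omega> - U w \<omega>\<bar> \<le> C * norm (z - w) powr \<gamma>"
      proof
        fix R :: real
        obtain k :: nat where k: "R \<le> k" using real_arch_simple by blast
        then have sub: "cball (0::'a) R \<subseteq> cball 0 (real k)" by auto
        show "\<exists>C. \<forall>z\<in>E \<inter> cball 0 R. \<forall>w\<in>E \<inter> cball 0 R. \<bar>U z \<omega> - U w \<omega>\<bar> \<le> C * norm (z - w) powr \<gamma>"
          using *[rule_format, of k] sub by blast
      qed
    qed
  qed
  ultimately show ?thesis by blast
qed

section \<open>Gradient bounds on smooth domains\<close>

lemma frechet_derivative_eq_gradient:
  fixes f :: "real ^ 'd \<Rightarrow> real"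
  assumes "f differentiable (at x)"
  shows "frechet_derivative f (at x) v = gradient f x \<bullet> v"
proof -
  have lin: "linear (frechet_derivative f (at x))"
    using assms by (rule linear_frechet_derivative)
  have "v = (\<Sum>i\<in>UNIV. v $ i *\<^sub>R axis i 1)"
    using basis_expansion[of v] by (simp add: scalar_mult_eq_scaleR)
  then have "frechet_derivative f (at x) v = frechet_derivative f (at x) (\<Sum>i\<in>UNIV. v $ i *\<^sub>R axis i 1)"
    by (rule arg_cong)
  also have "\<dots> = (\<Sum>i\<in>UNIV. v $ i *\<^sub>R frechet_derivative f (at x) (axis i 1))"
    using lin by (simp add: linear_sum linear_scale)
  finally show ?thesis
    by (simp add: gradient_def inner_vec_def mult.commute)
qed

lemma segment_gradient_bound:
  fixes f :: "real ^ 'd \<Rightarrow> real"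
  assumes "\<And>\<xi>. \<xi> \<in> D \<Longrightarrow> f differentiable (at \<xi>)"
    and "\<And>\<xi>. \<xi> \<in> D \<Longrightarrow> norm (gradient f \<xi>) \<le> G"
    and "closed_segment x y \<subseteq> D"
  shows "\<bar>f x - f y\<bar> \<le> G * norm (x - y)"
proof -
  have "norm (f x - f y) \<le> G * norm (x - y)"
  proof (rule differentiable_bound[where f' = "\<lambda>z. frechet_derivative f (at z)"])
    show "convex (closed_segment x y)" by simp
    fix z assume z: "z \<in> closed_segment x y"
    then have d: "f differentiable (at z)" and g: "norm (gradient f z) \<le> G" using assms by auto
    show "(f has_derivative frechet_derivative f (at z)) (at z within closed_segment x y)"
      using d frechet_derivative_works has_derivative_at_withinI by blast
    show "onorm (frechet_derivative f (at z)) \<le> G"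
    proof (rule onorm_le)
      fix v
      have "norm (frechet_derivative f (at z) v) \<le> norm (gradient f z) * norm v"
        using Cauchy_Schwarz_ineq2[of "gradient f z" v] by (simp add: frechet_derivative_eq_gradient[OF d])
      also have "\<dots> \<le> G * norm v" using g by (intro mult_right_mono) auto
      finally show "norm (frechet_derivative f (at z) v) \<le> G * norm v" .
    qed
  qed auto
  then show ?thesis by simp
qed

text \<open>The sum of the moduli of the partial derivatives dominates the operator norm of the
  derivative and is continuous, hence bounded on the compact convex ball.\<close>

lemma C_infinity_imp_lipschitz:
  fixes h :: "'a::euclidean_space \<Rightarrow> real"
  assumes "C_infinity h"
  obtains \<Lambda> where "\<Lambda> \<ge> 0" "\<And>x y. x \<in> cball 0 R \<Longrightarrow> y \<in> cball 0 R \<Longrightarrow> \<bar>h x - h y\<bar> \<le> \<Lambda> * norm (x - y)"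
proof -
  have "C_diff (Suc 0) h" using assms unfolding C_infinity_def by blast
  then have d: "h differentiable (at x)" and c: "continuous_on UNIV (\<lambda>x. frechet_derivative h (at x) v)" for x v
    by auto
  define g where "g x = (\<Sum>b\<in>Basis. \<bar>frechet_derivative h (at x) b\<bar>)" for x
  have "continuous_on (cball 0 R) g"
    unfolding g_def by (intro continuous_intros continuous_on_subset[OF c]) auto
  then have "bounded (g ` cball 0 R)"
    by (intro compact_imp_bounded compact_continuous_image) auto
  then obtain B where B: "\<And>x. x \<in> cball 0 R \<Longrightarrow> \<bar>g x\<bar> \<le> B"
    unfolding bounded_iff real_norm_def by blast
  define \<Lambda> where "\<Lambda> = max 0 B"
  have "\<bar>h x - h y\<bar> \<le> \<Lambda> * norm (x - y)" if "x \<in> cball 0 R" "y \<in> cball 0 R" for x y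
  proof -
    have "norm (h x - h y) \<le> \<Lambda> * norm (x - y)"
    proof (rule differentiable_bound[where f' = "\<lambda>z. frechet_derivative h (at z)" and S = "cball 0 R"])
      show "(h has_derivative frechet_derivative h (at z)) (at z within cball 0 R)" for z
        using d frechet_derivative_works has_derivative_at_withinI by blast
      show "onorm (frechet_derivative h (at z)) \<le> \<Lambda>" if z: "z \<in> cball 0 R" for z
      proof (rule onorm_le)
        fix v :: 'a
        have lin: "linear (frechet_derivative h (at z))" using d by (rule linear_frechet_derivative)
        have "frechet_derivative h (at z) v = frechet_derivative h (at z) (\<Sum>b\<in>Basis. (v \<bullet> b) *\<^sub>R b)"
          by (simp add: euclidean_representation)
        also have "\<dots> = (\<Sum>b\<in>Basis. (v \<bullet> b) *\<^sub>R frechet_derivative h (at z) b)"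
          using lin by (simp add: linear_sum linear_scale)
        finally have "norm (frechet_derivative h (at z) v) \<le> (\<Sum>b\<in>Basis. norm ((v \<bullet> b) *\<^sub>R frechet_derivative h (at z) b))"
          by (metis norm_sum)
        also have "\<dots> \<le> (\<Sum>b\<in>Basis. norm v * \<bar>frechet_derivative h (at z) b\<bar>)"
          by (intro sum_mono) (auto simp: abs_mult intro!: mult_right_mono Basis_le_norm)
        also have "\<dots> = g z * norm v" by (simp add: g_def mult.commute flip: sum_distrib_left)
        also have "\<dots> \<le> \<Lambda> * norm v" using B[OF z] by (intro mult_right_mono) (auto simp: \<Lambda>_def)
        finally show "norm (frechet_derivative h (at z) v) \<le> \<Lambda> * norm v" .
      qed
    qed (use that in auto)
    then show ?thesis by simp
  qed
  then show ?thesis using that[of \<Lambda>] by (auto simp: \<Lambda>_def)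
qed

text \<open>Points near the boundary are joined by moving up in the direction of \<open>n\<close>, across, and down
  again; the ascent is chosen so large that the middle segment stays above the graph of \<open>h\<close>.\<close>

lemma epigraph_local_detour:
  fixes D :: "'a::euclidean_space set"
  assumes r: "r > 0" and n: "norm n = 1" and h: "C_infinity (h::'a \<Rightarrow> real)"
    and D: "D \<inter> ball p r = {x \<in> ball p r. h (x - (x \<bullet> n) *\<^sub>R n) < x \<bullet> n}"
  obtains s \<kappa> where "s > 0" "\<kappa> \<ge> 0"
    "\<And>x y. x \<in> D \<inter> ball p s \<Longrightarrow> y \<in> D \<inter> ball p s \<Longrightarrow>
       closed_segment x (x + (\<kappa> * norm (x - y)) *\<^sub>R n) \<subseteq> D \<and>
       closed_segment (x + (\<kappa> * norm (x - y)) *\<^sub>R n) (y + (\<kappa> * norm (x - y)) *\<^sub>R n) \<subseteq> D \<and>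
       closed_segment y (y + (\<kappa> * norm (x - y)) *\<^sub>R n) \<subseteq> D"
proof -
  define T where "T x = x - (x \<bullet> n) *\<^sub>R n" for x
  have nn: "n \<bullet> n = 1" using n by (simp add: norm_eq_1)
  have T_shift: "T (x + t *\<^sub>R n) = T x" for x t
    by (simp add: T_def inner_add_left nn scaleR_add_left)
  have T_diff: "T x - T y = T (x - y)" for x y
    by (simp add: T_def inner_diff_left scaleR_diff_left)
  have T_norm: "norm (T x) \<le> norm x" for x
  proof -
    have "(norm (T x))\<^sup>2 = (norm x)\<^sup>2 - (x \<bullet> n)\<^sup>2"
      unfolding T_def power2_norm_eq_inner
      by (simp add: inner_diff_left inner_diff_right inner_commute nn power2_eq_square)
    then have "(norm (T x))\<^sup>2 \<le> (norm x)\<^sup>2" by simp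
    then show ?thesis by (rule power2_le_imp_le) simp
  qed
  obtain \<Lambda> where \<Lambda>: "\<Lambda> \<ge> 0"
    and lip: "\<And>x y. x \<in> cball 0 (norm p + r) \<Longrightarrow> y \<in> cball 0 (norm p + r) \<Longrightarrow> \<bar>h x - h y\<bar> \<le> \<Lambda> * norm (x - y)"
    using C_infinity_imp_lipschitz[OF h] by blast
  \<comment> \<open>The ascent has to make up for a change of \<open>h\<close> by at most \<Lambda>
    |x - y| and for a change of the height along \<open>n\<close> by at most |x - y|.\<close>
  define \<kappa> where "\<kappa> = \<Lambda> + 1"
  \<comment> \<open>With this radius the whole detour stays within r / 2 of
    \<open>p\<close>.\<close>
  define s where "s = r / (2 * (2 * \<kappa> + 1))"
  have s: "s > 0" using r \<Lambda> by (simp add: s_def \<kappa>_def)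
  have sr: "(2 * \<kappa> + 1) * s = r / 2" using \<Lambda> by (simp add: s_def \<kappa>_def field_simps)
  have "s * 1 \<le> (2 * \<kappa> + 1) * s" using s \<Lambda> by (simp add: \<kappa>_def)
  then have sr': "s < r" using sr r by simp
  have inD: "z \<in> D" if "z \<in> ball p r" "h (T z) < z \<bullet> n" for z
    using D that unfolding T_def by blast
  have Dh: "h (T z) < z \<bullet> n" if "z \<in> D" "z \<in> ball p r" for z
    using D that unfolding T_def by blast
  have nrm: "T z \<in> cball 0 (norm p + r)" if "z \<in> ball p r" for z
  proof -
    have "norm z \<le> norm p + norm (p - z)" by norm
    then show ?thesis using T_norm[of z] that by (simp add: dist_norm)
  qed
  \<comment> \<open>One inequality covers all three segments: u is the progress from
    \<open>x\<close> to \<open>y\<close> and t the added height. The vertical segments have u = 0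
    (with \<open>x\<close> and \<open>y\<close> exchanged for the second), the middle one has t =
    \<kappa> |x - y|.\<close>
  have main: "(1 - u) *\<^sub>R x + u *\<^sub>R y + t *\<^sub>R n \<in> D"
    if x: "x \<in> D \<inter> ball p s" and y: "y \<in> D \<inter> ball p s" and u: "0 \<le> u" "u \<le> 1"
      and t: "0 \<le> t" "t \<le> \<kappa> * norm (x - y)" "u * (\<kappa> * norm (x - y)) \<le> t" for x y u t
  proof (rule inD)
    define w where "w = (1 - u) *\<^sub>R x + u *\<^sub>R y"
    have wp: "w \<in> ball p s"
      unfolding w_def using x y u convexD_alt[OF convex_ball[of p s], of x y u] by auto
    have "norm (x - y) \<le> norm (p - x) + norm (p - y)" by norm
    then have xy: "norm (x - y) \<le> 2 * s" using x y by (simp add: dist_norm)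
    have "norm (p - (w + t *\<^sub>R n)) \<le> norm (p - w) + norm (t *\<^sub>R n)"
      using norm_triangle_ineq4[of "p - w" "t *\<^sub>R n"] by (simp add: diff_diff_eq)
    also have "\<dots> \<le> s + \<kappa> * (2 * s)"
    proof (rule add_mono)
      have "\<kappa> * norm (x - y) \<le> \<kappa> * (2 * s)"
        using xy \<Lambda> by (intro mult_left_mono) (auto simp: \<kappa>_def)
      then show "norm (t *\<^sub>R n) \<le> \<kappa> * (2 * s)" using t n by simp
    qed (use wp in \<open>auto simp: dist_norm\<close>)
    also have "\<dots> = (2 * \<kappa> + 1) * s" by (simp add: algebra_simps)
    finally have "norm (p - (w + t *\<^sub>R n)) < r" using sr r by simp
    then show "(1 - u) *\<^sub>R x + u *\<^sub>R y + t *\<^sub>R n \<in> ball p r" by (simp add: dist_norm w_def)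
    have wx: "w - x = u *\<^sub>R (y - x)" by (simp add: w_def algebra_simps)
    then have nwx: "norm (w - x) = u * norm (x - y)" using u by (simp add: norm_minus_commute)
    have "x \<in> ball p r" "w \<in> ball p r" using x wp sr' by auto
    then have "\<bar>h (T w) - h (T x)\<bar> \<le> \<Lambda> * norm (T w - T x)" by (intro lip nrm)
    also have "\<dots> \<le> \<Lambda> * norm (w - x)" unfolding T_diff using \<Lambda> T_norm by (intro mult_left_mono)
    finally have "h (T w) \<le> h (T x) + \<Lambda> * (u * norm (x - y))" using nwx by simp
    also have "h (T x) < x \<bullet> n" using x \<open>x \<in> ball p r\<close> by (intro Dh) auto
    also have "x \<bullet> n \<le> w \<bullet> n + norm (w - x)"
      using Cauchy_Schwarz_ineq2[of "w - x" n] n by (simp add: inner_diff_left)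
    finally have "h (T w) < w \<bullet> n + u * (\<kappa> * norm (x - y))" using nwx by (simp add: \<kappa>_def algebra_simps)
    also have "\<dots> \<le> (w + t *\<^sub>R n) \<bullet> n" using t by (simp add: inner_add_left nn)
    finally show "h (T ((1 - u) *\<^sub>R x + u *\<^sub>R y + t *\<^sub>R n)) < ((1 - u) *\<^sub>R x + u *\<^sub>R y + t *\<^sub>R n) \<bullet> n"
      by (simp add: T_shift flip: w_def)
  qed
  have \<kappa>0: "\<kappa> \<ge> 0" using \<Lambda> by (simp add: \<kappa>_def)
  show ?thesis
  proof (rule that[OF s \<kappa>0])
    fix x y assume x: "x \<in> D \<inter> ball p s" and y: "y \<in> D \<inter> ball p s"
    define t where "t = \<kappa> * norm (x - y)"
    have t: "0 \<le> t" using \<kappa>0 by (simp add: t_def)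
    have up: "closed_segment x (x + t *\<^sub>R n) \<subseteq> D"
    proof
      fix z assume "z \<in> closed_segment x (x + t *\<^sub>R n)"
      then obtain u where u: "0 \<le> u" "u \<le> 1" "z = (1 - u) *\<^sub>R x + u *\<^sub>R (x + t *\<^sub>R n)"
        by (auto simp: in_segment)
      then have "z = (1 - 0) *\<^sub>R x + 0 *\<^sub>R y + (u * t) *\<^sub>R n" by (simp add: algebra_simps)
      then show "z \<in> D" using main[OF x y, of 0 "u * t"] u t by (simp add: t_def mult_left_le_one_le)
    qed
    have down: "closed_segment y (y + t *\<^sub>R n) \<subseteq> D"
    proof
      fix z assume "z \<in> closed_segment y (y + t *\<^sub>R n)"
      then obtain u where u: "0 \<le> u" "u \<le> 1" "z = (1 - u) *\<^sub>R y + u *\<^sub>R (y + t *\<^sub>R n)"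
        by (auto simp: in_segment)
      then have "z = (1 - 0) *\<^sub>R y + 0 *\<^sub>R x + (u * t) *\<^sub>R n" by (simp add: algebra_simps)
      then show "z \<in> D" using main[OF y x, of 0 "u * t"] u t
        by (simp add: t_def mult_left_le_one_le norm_minus_commute)
    qed
    have across: "closed_segment (x + t *\<^sub>R n) (y + t *\<^sub>R n) \<subseteq> D"
    proof
      fix z assume "z \<in> closed_segment (x + t *\<^sub>R n) (y + t *\<^sub>R n)"
      then obtain u where u: "0 \<le> u" "u \<le> 1" "z = (1 - u) *\<^sub>R (x + t *\<^sub>R n) + u *\<^sub>R (y + t *\<^sub>R n)"
        by (auto simp: in_segment)
      then have "z = (1 - u) *\<^sub>R x + u *\<^sub>R y + t *\<^sub>R n" by (simp add: algebra_simps)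
      then show "z \<in> D" using main[OF x y, of u t] u t by (simp add: t_def mult_left_le_one_le)
    qed
    show "closed_segment x (x + (\<kappa> * norm (x - y)) *\<^sub>R n) \<subseteq> D \<and>
       closed_segment (x + (\<kappa> * norm (x - y)) *\<^sub>R n) (y + (\<kappa> * norm (x - y)) *\<^sub>R n) \<subseteq> D \<and>
       closed_segment y (y + (\<kappa> * norm (x - y)) *\<^sub>R n) \<subseteq> D"
      using up down across by (simp add: t_def)
  qed
qed

text \<open>\<open>D\<close> need not be convex, so the mean value inequality is applied locally,
  inside a ball contained in \<open>D\<close> or along a detour of length (2 \<kappa> + 1) |x - y|,
  and compactness of the closure makes the constants uniform. They do not depend on
  \<open>f\<close>, since one pair of constants has to serve all eigenfunctions.\<close>

lemma smooth_domain_gradient_bound: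
  fixes D :: "(real ^ 'd) set"
  assumes D: "smooth_bounded_domain D"
  obtains C \<delta> where "\<delta> > 0" "C \<ge> 0"
    "\<And>f G x y. (\<And>\<xi>. \<xi> \<in> D \<Longrightarrow> f differentiable (at \<xi>)) \<Longrightarrow> (\<And>\<xi>. \<xi> \<in> D \<Longrightarrow> norm (gradient f \<xi>) \<le> G) \<Longrightarrow>
       x \<in> D \<Longrightarrow> y \<in> D \<Longrightarrow> dist x y < \<delta> \<Longrightarrow> \<bar>f x - f y\<bar> \<le> C * G * norm (x - y)"
proof -
  define good where "good p s C \<longleftrightarrow> s > 0 \<and> C \<ge> 0 \<and> (\<forall>f G x y. (\<forall>\<xi>\<in>D. f differentiable (at \<xi>)) \<longrightarrow>
     (\<forall>\<xi>\<in>D. norm (gradient f \<xi>) \<le> G) \<longrightarrow> x \<in> D \<inter> ball p s \<longrightarrow> y \<in> D \<inter> ball p s \<longrightarrow>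
     \<bar>f x - f y\<bar> \<le> C * G * norm (x - y))" for p s C
  have "\<exists>s C. good p s C" if p: "p \<in> closure D" for p
  proof (cases "p \<in> D")
    case True
    then obtain s where s: "s > 0" "ball p s \<subseteq> D"
      using D by (auto simp: smooth_bounded_domain_def open_contains_ball)
    have "\<bar>f x - f y\<bar> \<le> 1 * G * norm (x - y)"
      if "\<forall>\<xi>\<in>D. f differentiable (at \<xi>)" "\<forall>\<xi>\<in>D. norm (gradient f \<xi>) \<le> G" "x \<in> D \<inter> ball p s" "y \<in> D \<inter> ball p s"
      for f G x y
    proof -
      have "closed_segment x y \<subseteq> ball p s" using that by (intro closed_segment_subset) auto
      then show ?thesis using that s segment_gradient_bound[of D f G x y] by auto
    qed
    then have "good p s 1" using s unfolding good_def by simp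
    then show ?thesis by blast
  next
    case False
    then have "p \<in> frontier D"
      using p D by (simp add: frontier_def smooth_bounded_domain_def interior_open)
    then obtain r n and h :: "real ^ 'd \<Rightarrow> real" where *: "r > 0" "norm n = 1" "C_infinity h"
        "D \<inter> ball p r = {x \<in> ball p r. h (x - (x \<bullet> n) *\<^sub>R n) < x \<bullet> n}"
      using D unfolding smooth_bounded_domain_def smooth_boundary_def by blast
    obtain s \<kappa> where s: "s > 0" "\<kappa> \<ge> 0" and seg:
      "\<And>x y. x \<in> D \<inter> ball p s \<Longrightarrow> y \<in> D \<inter> ball p s \<Longrightarrow>
       closed_segment x (x + (\<kappa> * norm (x - y)) *\<^sub>R n) \<subseteq> D \<and>
       closed_segment (x + (\<kappa> * norm (x - y)) *\<^sub>R n) (y + (\<kappa> * norm (x - y)) *\<^sub>R n) \<subseteq> D \<and>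
       closed_segment y (y + (\<kappa> * norm (x - y)) *\<^sub>R n) \<subseteq> D"
      using epigraph_local_detour[OF *] by blast
    have "\<bar>f x - f y\<bar> \<le> (2 * \<kappa> + 1) * G * norm (x - y)"
      if f: "\<forall>\<xi>\<in>D. f differentiable (at \<xi>)" "\<forall>\<xi>\<in>D. norm (gradient f \<xi>) \<le> G"
        and xy: "x \<in> D \<inter> ball p s" "y \<in> D \<inter> ball p s"
      for f G x y
    proof -
      define v where "v = (\<kappa> * norm (x - y)) *\<^sub>R n"
      have nv: "norm v = \<kappa> * norm (x - y)" using s * by (simp add: v_def)
      note sb = segment_gradient_bound[of D f G]
      have "\<bar>f x - f (x + v)\<bar> \<le> G * norm (x - (x + v))"
        "\<bar>f (x + v) - f (y + v)\<bar> \<le> G * norm ((x + v) - (y + v))"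
        "\<bar>f y - f (y + v)\<bar> \<le> G * norm (y - (y + v))"
        using f seg[OF xy] unfolding v_def by (intro sb; blast)+
      then have "\<bar>f x - f y\<bar> \<le> G * norm v + G * norm (x - y) + G * norm v" by simp
      then show ?thesis by (simp add: nv algebra_simps)
    qed
    then have "good p s (2 * \<kappa> + 1)" using s unfolding good_def by simp
    then show ?thesis by blast
  qed
  then obtain s C where g: "\<And>p. p \<in> closure D \<Longrightarrow> good p (s p) (C p)" by metis
  have comp: "compact (closure D)" using D by (simp add: smooth_bounded_domain_def compact_closure)
  have "closure D \<subseteq> (\<Union>p\<in>closure D. ball p (s p / 2))" using g by (force simp: good_def)
  then obtain P where P: "P \<subseteq> closure D" "finite P" "closure D \<subseteq> (\<Union>p\<in>P. ball p (s p / 2))"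
    using compactE_image[OF comp, of "closure D" "\<lambda>p. ball p (s p / 2)"] by auto
  \<comment> \<open>A Lebesgue number: the cover uses half the radii, so a point within \<delta> of
    a point of the half ball is still in the full ball.\<close>
  define \<delta> where "\<delta> = Min (insert 1 ((\<lambda>p. s p / 2) ` P))"
  define C' where "C' = Max (insert 0 (C ` P))"
  have d0: "\<delta> > 0" unfolding \<delta>_def using P g by (subst Min_gr_iff) (auto simp: good_def)
  have C0: "C' \<ge> 0" unfolding C'_def using P by (intro Max_ge) auto
  show ?thesis
  proof (rule that[OF d0 C0])
    fix f :: "real ^ 'd \<Rightarrow> real" and G x y
    assume f: "\<And>\<xi>. \<xi> \<in> D \<Longrightarrow> f differentiable (at \<xi>)" "\<And>\<xi>. \<xi> \<in> D \<Longrightarrow> norm (gradient f \<xi>) \<le> G"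
      and xy: "x \<in> D" "y \<in> D" "dist x y < \<delta>"
    have "x \<in> closure D" using xy closure_subset by blast
    then obtain p where p: "p \<in> P" "dist p x < s p / 2" using P(3) by auto
    have gp: "good p (s p) (C p)" using p P g by blast
    have "\<delta> \<le> s p / 2" unfolding \<delta>_def using p P by (intro Min_le) auto
    then have "dist p y < s p" using xy p dist_triangle[of p y x] by linarith
    moreover have "dist p x < s p" using p gp by (simp add: good_def)
    ultimately have "\<bar>f x - f y\<bar> \<le> C p * G * norm (x - y)" using gp f xy unfolding good_def by simp
    also have "\<dots> \<le> C' * G * norm (x - y)"
    proof -
      have "G \<ge> 0" using f(2)[OF xy(1)] norm_ge_zero order_trans by blast
      moreover have "C p \<le> C'" unfolding C'_def using p P by (intro Max_ge) auto
      ultimately show ?thesis by (intro mult_right_mono) auto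
    qed
    finally show "\<bar>f x - f y\<bar> \<le> C' * G * norm (x - y)" .
  qed
qed

section \<open>Fourier transform of Schwartz functions\<close>

text \<open>Dominated convergence along \<open>at a within S\<close>, used both to differentiate
  under the integral sign and to approach the imaginary axis from the right half-plane.\<close>

lemma integral_tendsto_dominated_at:
  fixes F :: "'p::{metric_space} \<Rightarrow> 'a \<Rightarrow> 'b::{banach, second_countable_topology}"
  assumes "\<And>p. p \<in> S - {a} \<Longrightarrow> F p \<in> borel_measurable M" "G \<in> borel_measurable M" "integrable M w"
    and "\<And>p. p \<in> S - {a} \<Longrightarrow> AE t in M. norm (F p t) \<le> w t"
    and "AE t in M. ((\<lambda>p. F p t) \<longlongrightarrow> G t) (at a within S)"
  shows "((\<lambda>p. \<integral>t. F p t \<partial>M) \<longlongrightarrow> (\<integral>t. G t \<partial>M)) (at a within S)"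
  unfolding tendsto_at_iff_sequentially
proof (intro allI impI)
  fix X assume X: "\<forall>i. X i \<in> S - {a}" "X \<longlonglongrightarrow> a"
  have "(\<lambda>i. \<integral>t. F (X i) t \<partial>M) \<longlonglongrightarrow> (\<integral>t. G t \<partial>M)"
  proof (rule integral_dominated_convergence[where w = w])
    show "AE t in M. (\<lambda>i. F (X i) t) \<longlonglongrightarrow> G t"
      using assms(5) by eventually_elim (use X in \<open>auto simp: tendsto_at_iff_sequentially comp_def\<close>)
  qed (use assms X in auto)
  then show "((\<lambda>p. \<integral>t. F p t \<partial>M) \<circ> X) \<longlonglongrightarrow> (\<integral>t. G t \<partial>M)" by (simp add: comp_def)
qed

lemma has_vector_derivativeI_quotient:
  fixes f :: "real \<Rightarrow> 'a::real_normed_vector"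
  assumes "((\<lambda>y. (f y - f x) /\<^sub>R (y - x)) \<longlongrightarrow> D) (at x)"
  shows "(f has_vector_derivative D) (at x)"
  unfolding has_vector_derivative_def has_derivative_iff_norm
proof
  show "bounded_linear (\<lambda>h. h *\<^sub>R D)" by (rule bounded_linear_scaleR_left)
  have "((\<lambda>y. norm ((f y - f x) /\<^sub>R (y - x) - D)) \<longlongrightarrow> 0) (at x)"
    using assms by (simp add: LIM_zero_iff tendsto_norm_zero_iff)
  moreover have "norm ((f y - f x) /\<^sub>R (y - x) - D) = norm (f y - f x - (y - x) *\<^sub>R D) / norm (y - x)"
    if "y \<noteq> x" for y
  proof -
    have "(f y - f x) /\<^sub>R (y - x) - D = (f y - f x - (y - x) *\<^sub>R D) /\<^sub>R (y - x)"
      using that by (simp add: scaleR_diff_right)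
    then show ?thesis by (simp add: divide_inverse_commute)
  qed
  ultimately show "((\<lambda>y. norm (f y - f x - (y - x) *\<^sub>R D) / norm (y - x)) \<longlongrightarrow> 0) (at x)"
    by (auto intro: Lim_transform_eventually simp: eventually_at_filter)
qed

section \<open>Schwartz functions\<close>

lemma vderiv_0 [simp]: "vderiv 0 \<phi> = \<phi>"
  by (simp add: vderiv_def)

lemma vderiv_Suc: "vderiv (Suc n) \<phi> t = vector_derivative (vderiv n \<phi>) (at t)"
  by (simp add: vderiv_def)

text \<open>Membership is proved by exhibiting a whole sequence of candidate derivatives; each is
  only checked against its successor.\<close>

lemma schwartzI:
  assumes "f 0 = \<phi>" and "\<And>n t. (f n has_vector_derivative f (Suc n) t) (at t)"
    and "\<And>m n. \<exists>B. \<forall>t. \<bar>t\<bar> ^ m * cmod (f n t) \<le> B"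
  shows "\<phi> \<in> schwartz" and "vderiv n \<phi> = f n"
proof -
  have eq: "vderiv n \<phi> = f n" for n
  proof (induction n)
    case (Suc n)
    show ?case by (rule ext) (simp add: vderiv_Suc Suc.IH vector_derivative_at[OF assms(2)])
  qed (simp add: assms)
  show "vderiv n \<phi> = f n" by (rule eq)
  have "bounded (range (\<lambda>t. \<bar>t\<bar> ^ m * cmod (f n t)))" for m n
    using assms(3)[of m n] unfolding bounded_iff by (auto simp: abs_mult)
  then show "\<phi> \<in> schwartz"
    using differentiableI_vector[OF assms(2)] unfolding schwartz_def mem_Collect_eq eq by blast
qed

lemma schwartz_bounded:
  assumes "\<phi> \<in> schwartz"
  obtains B where "B \<ge> 0" "\<And>t. \<bar>t\<bar> ^ m * cmod (vderiv n \<phi> t) \<le> B"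
proof -
  have "bounded (range (\<lambda>t. \<bar>t\<bar> ^ m * cmod (vderiv n \<phi> t)))"
    using assms by (auto simp: schwartz_def)
  then obtain B where B: "\<And>t. norm (\<bar>t\<bar> ^ m * cmod (vderiv n \<phi> t)) \<le> B"
    unfolding bounded_iff by blast
  then have le: "\<bar>t\<bar> ^ m * cmod (vderiv n \<phi> t) \<le> B" for t by (metis abs_le_D1 real_norm_def)
  have "0 \<le> \<bar>0::real\<bar> ^ m * cmod (vderiv n \<phi> 0)" by simp
  then show ?thesis using that[OF _ le] le[of 0] by (meson order_trans)
qed

lemma schwartz_has_vderiv:
  assumes "\<phi> \<in> schwartz"
  shows "(vderiv n \<phi> has_vector_derivative vderiv (Suc n) \<phi> t) (at t)"
  using assms by (auto simp: schwartz_def vderiv_Suc vector_derivative_works[symmetric])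

lemma schwartz_has_vector_derivative:
  assumes "\<phi> \<in> schwartz"
  shows "(\<phi> has_vector_derivative vector_derivative \<phi> (at t)) (at t)"
  using schwartz_has_vderiv[OF assms, of 0 t] by (simp add: vderiv_Suc)

lemma schwartz_isCont:
  assumes "\<phi> \<in> schwartz"
  shows "isCont \<phi> t"
  using schwartz_has_vector_derivative[OF assms] has_vector_derivative_continuous by blast

lemma schwartz_measurable:
  assumes "\<phi> \<in> schwartz"
  shows "\<phi> \<in> borel_measurable borel"
  using schwartz_isCont[OF assms] by (intro borel_measurable_continuous_onI continuous_at_imp_continuous_on) auto

lemma schwartz_vderiv:
  assumes "\<phi> \<in> schwartz"
  shows "(\<lambda>t. vector_derivative \<phi> (at t)) \<in> schwartz"
    and "vderiv n (\<lambda>t. vector_derivative \<phi> (at t)) = vderiv (Suc n) \<phi>"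
proof -
  have 0: "vderiv (Suc 0) \<phi> = (\<lambda>t. vector_derivative \<phi> (at t))" by (simp add: vderiv_Suc fun_eq_iff)
  have 1: "(vderiv (Suc n) \<phi> has_vector_derivative vderiv (Suc (Suc n)) \<phi> t) (at t)" for n t
    by (rule schwartz_has_vderiv[OF assms])
  have 2: "\<exists>B. \<forall>t. \<bar>t\<bar> ^ m * cmod (vderiv (Suc n) \<phi> t) \<le> B" for m n
    using schwartz_bounded[OF assms] by metis
  show "(\<lambda>t. vector_derivative \<phi> (at t)) \<in> schwartz" "vderiv n (\<lambda>t. vector_derivative \<phi> (at t)) = vderiv (Suc n) \<phi>"
    by (rule schwartzI[of "\<lambda>n. vderiv (Suc n) \<phi>", OF 0 1 2])+
qed

lemma schwartz_lincomb:
  assumes "\<phi> \<in> schwartz" "\<psi> \<in> schwartz"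
  shows "(\<lambda>t. a * \<phi> t + b * \<psi> t) \<in> schwartz"
proof (rule schwartzI(1)[of "\<lambda>n t. a * vderiv n \<phi> t + b * vderiv n \<psi> t"])
  show "((\<lambda>t. a * vderiv n \<phi> t + b * vderiv n \<psi> t) has_vector_derivative
      a * vderiv (Suc n) \<phi> t + b * vderiv (Suc n) \<psi> t) (at t)" for n t
    by (intro has_vector_derivative_add has_vector_derivative_mult_right schwartz_has_vderiv assms)
  show "\<exists>B. \<forall>t. \<bar>t\<bar> ^ m * cmod (a * vderiv n \<phi> t + b * vderiv n \<psi> t) \<le> B" for m n
  proof -
    obtain B1 where B1: "\<And>t. \<bar>t\<bar> ^ m * cmod (vderiv n \<phi> t) \<le> B1" using schwartz_bounded[OF assms(1)] by metis
    obtain B2 where B2: "\<And>t. \<bar>t\<bar> ^ m * cmod (vderiv n \<psi> t) \<le> B2" using schwartz_bounded[OF assms(2)] by metis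
    have "\<bar>t\<bar> ^ m * cmod (a * vderiv n \<phi> t + b * vderiv n \<psi> t) \<le> cmod a * B1 + cmod b * B2" for t
    proof -
      have "\<bar>t\<bar> ^ m * cmod (a * vderiv n \<phi> t + b * vderiv n \<psi> t)
         \<le> \<bar>t\<bar> ^ m * (cmod a * cmod (vderiv n \<phi> t) + cmod b * cmod (vderiv n \<psi> t))"
        by (intro mult_left_mono norm_triangle_le) (auto simp: norm_mult)
      also have "\<dots> = cmod a * (\<bar>t\<bar> ^ m * cmod (vderiv n \<phi> t)) + cmod b * (\<bar>t\<bar> ^ m * cmod (vderiv n \<psi> t))"
        by (simp add: algebra_simps)
      also have "\<dots> \<le> cmod a * B1 + cmod b * B2"
        using B1 B2 by (intro add_mono mult_left_mono) auto
      finally show ?thesis .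
    qed
    then show ?thesis by blast
  qed
qed simp

lemma schwartz_cmult: "\<phi> \<in> schwartz \<Longrightarrow> (\<lambda>t. a * \<phi> t) \<in> schwartz"
  using schwartz_lincomb[of \<phi> \<phi> a 0] by simp

lemma schwartz_mult_id:
  assumes "\<phi> \<in> schwartz"
  shows "(\<lambda>t. of_real t * \<phi> t) \<in> schwartz"
\<comment> \<open>Leibniz rule. The truncated \<open>n - 1\<close> at \<open>n = 0\<close> is
  harmless because its coefficient is 0.\<close>
proof (rule schwartzI(1)[of "\<lambda>n t. of_real t * vderiv n \<phi> t + of_nat n * vderiv (n - 1) \<phi> t"])
  show "((\<lambda>t. of_real t * vderiv n \<phi> t + of_nat n * vderiv (n - 1) \<phi> t) has_vector_derivative
      of_real t * vderiv (Suc n) \<phi> t + of_nat (Suc n) * vderiv (Suc n - 1) \<phi> t) (at t)" for n t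
  proof -
    have 1: "((\<lambda>t. of_real t * vderiv n \<phi> t) has_vector_derivative (of_real t * vderiv (Suc n) \<phi> t + 1 * vderiv n \<phi> t)) (at t)"
      using has_vector_derivative_real_field[OF DERIV_ident, of t UNIV]
      by (intro has_vector_derivative_mult schwartz_has_vderiv assms) auto
    have 2: "((\<lambda>t. of_nat n * vderiv (n - 1) \<phi> t) has_vector_derivative of_nat n * vderiv n \<phi> t) (at t)"
    proof (cases n)
      case (Suc k)
      then show ?thesis
        using has_vector_derivative_mult_right[OF schwartz_has_vderiv[OF assms, of k t], of "of_nat n"] by simp
    qed simp
    show ?thesis using has_vector_derivative_add[OF 1 2] by (simp add: algebra_simps)
  qed
  show "\<exists>B. \<forall>t. \<bar>t\<bar> ^ m * cmod (of_real t * vderiv n \<phi> t + of_nat n * vderiv (n - 1) \<phi> t) \<le> B" for m n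
  proof -
    obtain B1 where B1: "\<And>t. \<bar>t\<bar> ^ Suc m * cmod (vderiv n \<phi> t) \<le> B1" using schwartz_bounded[OF assms(1)] by metis
    obtain B2 where B2: "\<And>t. \<bar>t\<bar> ^ m * cmod (vderiv (n - 1) \<phi> t) \<le> B2" using schwartz_bounded[OF assms(1)] by metis
    have "\<bar>t\<bar> ^ m * cmod (of_real t * vderiv n \<phi> t + of_nat n * vderiv (n - 1) \<phi> t) \<le> B1 + n * B2" for t
    proof -
      have "\<bar>t\<bar> ^ m * cmod (of_real t * vderiv n \<phi> t + of_nat n * vderiv (n - 1) \<phi> t)
         \<le> \<bar>t\<bar> ^ m * (\<bar>t\<bar> * cmod (vderiv n \<phi> t) + n * cmod (vderiv (n - 1) \<phi> t))"
        by (intro mult_left_mono norm_triangle_le) (auto simp: norm_mult)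
      also have "\<dots> = (\<bar>t\<bar> ^ Suc m * cmod (vderiv n \<phi> t)) + n * (\<bar>t\<bar> ^ m * cmod (vderiv (n - 1) \<phi> t))"
        by (simp add: algebra_simps)
      also have "\<dots> \<le> B1 + n * B2"
        using B1 B2 by (intro add_mono mult_left_mono) auto
      finally show ?thesis .
    qed
    then show ?thesis by blast
  qed
qed simp

lemma integrable_lborel_inverse_1_plus_square: "integrable lborel (\<lambda>x::real. inverse (1 + x\<^sup>2))"
  using integrable_inverse_1_plus_square by (simp add: set_integrable_def einterval_def)

lemma schwartz_integrable:
  assumes "\<phi> \<in> schwartz"
  shows "integrable lborel \<phi>"
proof -
  obtain B0 where B0: "\<And>t. \<bar>t\<bar> ^ 0 * cmod (vderiv 0 \<phi> t) \<le> B0" using schwartz_bounded[OF assms] by metis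
  obtain B2 where B2: "\<And>t. \<bar>t\<bar> ^ 2 * cmod (vderiv 0 \<phi> t) \<le> B2" using schwartz_bounded[OF assms] by metis
  have "cmod (\<phi> t) \<le> (B0 + B2) * inverse (1 + t\<^sup>2)" for t
  proof -
    have "(1 + t\<^sup>2) * cmod (\<phi> t) \<le> B0 + B2" using B0[of t] B2[of t] by (simp add: algebra_simps)
    moreover have "1 + t\<^sup>2 > 0" by (simp add: add_pos_nonneg)
    ultimately show ?thesis by (simp add: field_simps)
  qed
  then show ?thesis
    using schwartz_measurable[OF assms]
    by (intro Bochner_Integration.integrable_bound[OF integrable_mult_right[OF integrable_lborel_inverse_1_plus_square, of "B0 + B2"]])
      (auto intro: order_trans[OF _ abs_ge_self])
qed

section \<open>The Fourier transform of integrable functions\<close>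

lemma cmod_exp_fourier [simp]: "cmod (exp (- \<i> * of_real t * of_real \<omega>)) = 1"
  by (simp add: norm_exp_eq_Re)

lemma fourier_measurable_integrand:
  assumes "f \<in> borel_measurable lborel"
  shows "(\<lambda>t. f t * exp (- \<i> * of_real t * of_real \<omega>)) \<in> borel_measurable lborel"
proof -
  have "(\<lambda>t::real. exp (- \<i> * of_real t * of_real \<omega>)) \<in> borel_measurable borel"
    by (intro borel_measurable_continuous_onI continuous_intros)
  then show ?thesis using assms by simp
qed

lemma fourier_integrable_integrand:
  assumes "integrable lborel f"
  shows "integrable lborel (\<lambda>t. f t * exp (- \<i> * of_real t * of_real \<omega>))"
  using fourier_measurable_integrand[OF borel_measurable_integrable[OF assms], of \<omega>]
  by (intro Bochner_Integration.integrable_bound[OF assms]) (auto simp: norm_mult)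

lemma fourier_bound:
  assumes "integrable lborel f"
  shows "cmod (fourier f \<omega>) \<le> (LINT t|lborel. cmod (f t))"
  unfolding fourier_def
  by (rule order_trans[OF integral_norm_bound]) (simp add: norm_mult)

lemma fourier_measurable:
  assumes [measurable]: "f \<in> borel_measurable borel"
  shows "fourier f \<in> borel_measurable borel"
proof -
  have [measurable]: "(\<lambda>p. exp (- \<i> * of_real (snd p) * of_real (fst p))) \<in> borel_measurable (borel \<Otimes>\<^sub>M lborel)"
  proof -
    have "(\<lambda>p::real\<times>real. exp (- \<i> * of_real (snd p) * of_real (fst p))) \<in> borel_measurable borel"
      by (intro borel_measurable_continuous_onI continuous_intros)
    moreover have "sets (borel \<Otimes>\<^sub>M (lborel::real measure)) = sets (borel::(real \<times> real) measure)"
      by (subst borel_prod[symmetric], rule sets_pair_measure_cong) auto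
    ultimately show ?thesis using measurable_cong_sets by blast
  qed
  show ?thesis
    unfolding fourier_def
    by (rule sigma_finite_measure.borel_measurable_lebesgue_integral[OF sigma_finite_lborel])
       (simp add: case_prod_beta')
qed

lemma fourier_lincomb:
  assumes "integrable lborel f" "integrable lborel g"
  shows "fourier (\<lambda>t. a * f t + b * g t) \<omega> = a * fourier f \<omega> + b * fourier g \<omega>"
proof -
  define e where "e t = exp (- \<i> * of_real t * of_real \<omega>)" for t :: real
  have int: "integrable lborel (\<lambda>t. f t * e t)" "integrable lborel (\<lambda>t. g t * e t)"
    using assms fourier_integrable_integrand unfolding e_def by auto
  have "fourier (\<lambda>t. a * f t + b * g t) \<omega> = (LINT t|lborel. a * (f t * e t) + b * (g t * e t))"
    unfolding fourier_def e_def by (rule Bochner_Integration.integral_cong) (auto simp: algebra_simps)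
  also have "\<dots> = a * fourier f \<omega> + b * fourier g \<omega>"
    unfolding fourier_def e_def[symmetric] using int
    by (subst Bochner_Integration.integral_add) (auto intro!: integrable_mult_right)
  finally show ?thesis .
qed

lemma norm_exp_diff_le: "cmod (exp (\<i> * of_real x) - exp (\<i> * of_real y)) \<le> \<bar>x - y\<bar>"
proof -
  have "norm (exp (\<i> * of_real x) - exp (\<i> * of_real y)) \<le> 1 * norm (x - y)"
  proof (rule differentiable_bound[of UNIV "\<lambda>x. exp (\<i> * complex_of_real x)" "\<lambda>x h. h *\<^sub>R (\<i> * exp (\<i> * complex_of_real x))"])
    show "((\<lambda>x. exp (\<i> * complex_of_real x)) has_derivative (\<lambda>h. h *\<^sub>R (\<i> * exp (\<i> * complex_of_real x)))) (at x within UNIV)" for x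
      using has_vector_derivative_iexp[of x UNIV] by (simp add: has_vector_derivative_def)
    show "onorm (\<lambda>h. h *\<^sub>R (\<i> * exp (\<i> * complex_of_real x))) \<le> 1" for x
      by (rule onorm_le) (auto simp: norm_mult norm_exp_eq_Re)
  qed auto
  then show ?thesis by simp
qed

text \<open>The difference quotients of the exponential in \<omega> are bounded by |t|, so |t f(t)|
  is an integrable majorant.\<close>

lemma fourier_has_vector_derivative:
  assumes f: "integrable lborel f" and tf: "integrable lborel (\<lambda>t. of_real t * f t)"
  shows "(fourier f has_vector_derivative fourier (\<lambda>t. - \<i> * (of_real t * f t)) \<omega>) (at \<omega>)"
proof (rule has_vector_derivativeI_quotient)
  define e where "e t w = exp (- \<i> * of_real t * of_real w)" for t w :: real
  define F where "F w t = (f t * e t w - f t * e t \<omega>) /\<^sub>R (w - \<omega>)" for w t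
  have int: "integrable lborel (\<lambda>t. f t * e t w)" for w
    using fourier_integrable_integrand[OF f] by (simp add: e_def)
  have "((\<lambda>w. LINT t|lborel. F w t) \<longlongrightarrow> (LINT t|lborel. - \<i> * (of_real t * f t) * e t \<omega>)) (at \<omega> within UNIV)"
  proof (rule integral_tendsto_dominated_at[where w = "\<lambda>t. cmod (of_real t * f t)"])
    show "F w \<in> borel_measurable lborel" for w
      unfolding F_def using int[of w] int[of \<omega>] by measurable
    show "(\<lambda>t. - \<i> * (of_real t * f t) * e t \<omega>) \<in> borel_measurable lborel"
      unfolding e_def by (rule fourier_measurable_integrand[OF borel_measurable_integrable[OF integrable_mult_right[OF tf]]])
    show "integrable lborel (\<lambda>t. cmod (of_real t * f t))" using tf by (rule integrable_norm)
    show "AE t in lborel. norm (F w t) \<le> cmod (of_real t * f t)" if "w \<in> UNIV - {\<omega>}" for w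
    proof (rule AE_I2)
      fix t
      have "F w t = f t * (e t w - e t \<omega>) /\<^sub>R (w - \<omega>)" by (simp add: F_def right_diff_distrib)
      then have "norm (F w t) = cmod (f t) * cmod (e t w - e t \<omega>) / \<bar>w - \<omega>\<bar>"
        by (simp add: norm_mult divide_inverse_commute)
      also have "\<dots> \<le> cmod (f t) * (\<bar>t\<bar> * \<bar>w - \<omega>\<bar>) / \<bar>w - \<omega>\<bar>"
      proof (intro divide_right_mono mult_left_mono)
        have "\<bar>- t * w - (- t * \<omega>)\<bar> = \<bar>- t * (w - \<omega>)\<bar>" by (simp only: right_diff_distrib)
        also have "\<dots> = \<bar>t\<bar> * \<bar>w - \<omega>\<bar>" by (simp add: abs_mult)
        finally show "cmod (e t w - e t \<omega>) \<le> \<bar>t\<bar> * \<bar>w - \<omega>\<bar>"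
          unfolding e_def using norm_exp_diff_le[of "- t * w" "- t * \<omega>"] by (simp add: mult.assoc)
      qed auto
      finally show "norm (F w t) \<le> cmod (of_real t * f t)"
        using that by (simp add: norm_mult mult.commute)
    qed
    show "AE t in lborel. ((\<lambda>w. F w t) \<longlongrightarrow> - \<i> * (of_real t * f t) * e t \<omega>) (at \<omega> within UNIV)"
    proof (rule AE_I2)
      fix t
      have "((\<lambda>w. f t * e t w) has_vector_derivative - \<i> * (of_real t * f t) * e t \<omega>) (at \<omega>)"
      proof -
        have "((\<lambda>w. exp (- \<i> * of_real t * w)) has_field_derivative - \<i> * of_real t * exp (- \<i> * of_real t * of_real \<omega>)) (at (of_real \<omega>))"
          by (auto intro!: derivative_eq_intros)
        from has_vector_derivative_mult_right[OF has_vector_derivative_real_field[OF this], of "f t"]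
        show ?thesis by (simp add: e_def mult_ac)
      qed
      then have "((\<lambda>w. (f t * e t w - f t * e t \<omega> - (w - \<omega>) *\<^sub>R (- \<i> * (of_real t * f t) * e t \<omega>)) /\<^sub>R norm (w - \<omega>)) \<longlongrightarrow> 0) (at \<omega>)"
        unfolding has_vector_derivative_def has_derivative_at_within by simp
      then have "((\<lambda>w. norm (F w t - (- \<i> * (of_real t * f t) * e t \<omega>))) \<longlongrightarrow> 0) (at \<omega>)"
      proof (rule Lim_transform_eventually[OF tendsto_norm_zero])
        show "\<forall>\<^sub>F w in at \<omega>. norm ((f t * e t w - f t * e t \<omega> - (w - \<omega>) *\<^sub>R (- \<i> * (of_real t * f t) * e t \<omega>)) /\<^sub>R norm (w - \<omega>))
          = norm (F w t - (- \<i> * (of_real t * f t) * e t \<omega>))"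
          unfolding eventually_at_filter
        proof (rule always_eventually, clarify)
          fix w assume "w \<noteq> \<omega>"
          then have "F w t - d = (f t * e t w - f t * e t \<omega> - (w - \<omega>) *\<^sub>R d) /\<^sub>R (w - \<omega>)" for d
            by (simp add: F_def scaleR_diff_right)
          note eq = this
          show "norm ((f t * e t w - f t * e t \<omega> - (w - \<omega>) *\<^sub>R (- \<i> * (of_real t * f t) * e t \<omega>)) /\<^sub>R norm (w - \<omega>))
          = norm (F w t - (- \<i> * (of_real t * f t) * e t \<omega>))"
            unfolding eq norm_scaleR by simp
        qed
      qed
      then show "((\<lambda>w. F w t) \<longlongrightarrow> - \<i> * (of_real t * f t) * e t \<omega>) (at \<omega> within UNIV)"
        unfolding tendsto_norm_zero_iff by (rule LIM_zero_cancel)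
    qed
  qed
  moreover have "(LINT t|lborel. F w t) = (fourier f w - fourier f \<omega>) /\<^sub>R (w - \<omega>)" for w
    unfolding F_def using int[of w] int[of \<omega>] by (simp add: fourier_def e_def)
  ultimately show "((\<lambda>w. (fourier f w - fourier f \<omega>) /\<^sub>R (w - \<omega>)) \<longlongrightarrow> fourier (\<lambda>t. - \<i> * (of_real t * f t)) \<omega>) (at \<omega>)"
    by (simp add: fourier_def e_def)
qed

lemma integral_derivative_eq_0:
  fixes F :: "real \<Rightarrow> complex"
  assumes "\<And>t. (F has_vector_derivative f t) (at t)" "\<And>t. isCont f t" "integrable lborel f"
    and "(F \<longlongrightarrow> 0) at_top" "(F \<longlongrightarrow> 0) at_bot"
  shows "(LINT t|lborel. f t) = 0"
proof -
  have "(LBINT x=-\<infinity>..\<infinity>. f x) = 0 - 0"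
  proof (rule interval_integral_FTC_integrable[where F = F])
    show "set_integrable lborel (einterval (-\<infinity>) \<infinity>) f" using assms by (simp add: set_integrable_def)
    show "((F \<circ> real_of_ereal) \<longlongrightarrow> 0) (at_right (- \<infinity>))" "((F \<circ> real_of_ereal) \<longlongrightarrow> 0) (at_left \<infinity>)"
      using assms by (auto simp: ereal_tendsto_simps)
  qed (use assms in auto)
  then show ?thesis
    by (simp add: interval_lebesgue_integral_def set_lebesgue_integral_def)
qed

lemma schwartz_tendsto_0:
  assumes "\<phi> \<in> schwartz"
  shows "(\<phi> \<longlongrightarrow> 0) at_top" "(\<phi> \<longlongrightarrow> 0) at_bot"
proof -
  obtain B where B: "\<And>t. \<bar>t\<bar> ^ 1 * cmod (vderiv 0 \<phi> t) \<le> B" using schwartz_bounded[OF assms] by metis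
  have le: "norm (\<phi> t) \<le> norm (B / t)" if "t \<noteq> 0" for t
  proof -
    have "cmod (\<phi> t) \<le> B / \<bar>t\<bar>" using B[of t] that by (simp add: field_simps)
    also have "\<dots> \<le> norm (B / t)" by (simp add: abs_divide divide_right_mono)
    finally show ?thesis .
  qed
  have top: "((\<lambda>t::real. norm (B / t)) \<longlongrightarrow> 0) at_top"
    by (intro tendsto_norm_zero tendsto_divide_0[OF tendsto_const] filterlim_at_top_imp_at_infinity filterlim_ident)
  have bot: "((\<lambda>t::real. norm (B / t)) \<longlongrightarrow> 0) at_bot"
    by (intro tendsto_norm_zero tendsto_divide_0[OF tendsto_const] filterlim_at_bot_imp_at_infinity filterlim_ident)
  show "(\<phi> \<longlongrightarrow> 0) at_top"
    by (rule Lim_null_comparison[OF eventually_mono[OF eventually_gt_at_top[of 0]] top]) (metis le less_irrefl)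
  show "(\<phi> \<longlongrightarrow> 0) at_bot"
    by (rule Lim_null_comparison[OF eventually_mono[OF eventually_gt_at_bot[of 0]] bot]) (metis le less_irrefl)
qed

text \<open>Integration by parts in the form that the derivative of \<phi> times the exponential
  integrates to 0, because the product vanishes at both ends.\<close>

lemma fourier_vector_derivative:
  assumes "\<phi> \<in> schwartz"
  shows "fourier (\<lambda>t. vector_derivative \<phi> (at t)) \<omega> = \<i> * of_real \<omega> * fourier \<phi> \<omega>"
proof -
  define e where "e t = exp (- \<i> * of_real t * of_real \<omega>)" for t :: real
  define \<phi>' where "\<phi>' t = vector_derivative \<phi> (at t)" for t
  have s': "\<phi>' \<in> schwartz" unfolding \<phi>'_def by (rule schwartz_vderiv[OF assms])
  have de: "(e has_vector_derivative - \<i> * of_real \<omega> * e t) (at t)" for t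
  proof -
    have "((\<lambda>w. exp (- \<i> * w * of_real \<omega>)) has_field_derivative - \<i> * of_real \<omega> * exp (- \<i> * of_real t * of_real \<omega>)) (at (of_real t))"
      by (auto intro!: derivative_eq_intros)
    from has_vector_derivative_real_field[OF this] show ?thesis by (simp add: e_def[abs_def])
  qed
  have isCont_e: "isCont e t" for t using de has_vector_derivative_continuous by blast
  have ne: "cmod (e t) = 1" for t by (simp add: e_def norm_exp_eq_Re)
  define g where "g t = \<phi> t * (- \<i> * of_real \<omega> * e t) + \<phi>' t * e t" for t
  have i1: "integrable lborel (\<lambda>t. \<phi> t * e t)" "integrable lborel (\<lambda>t. \<phi>' t * e t)"
    using fourier_integrable_integrand schwartz_integrable assms s' unfolding e_def by auto
  have g_eq: "g t = (- \<i> * of_real \<omega>) * (\<phi> t * e t) + \<phi>' t * e t" for t by (simp add: g_def)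
  have "(LINT t|lborel. g t) = 0"
  proof (rule integral_derivative_eq_0[where F = "\<lambda>t. \<phi> t * e t"])
    show "((\<lambda>t. \<phi> t * e t) has_vector_derivative g t) (at t)" for t
      unfolding g_def \<phi>'_def by (intro has_vector_derivative_mult de schwartz_has_vector_derivative assms)
    show "isCont g t" for t
      unfolding g_def by (intro continuous_intros isCont_e schwartz_isCont assms s')
    show "integrable lborel g" unfolding g_eq using i1 by (intro Bochner_Integration.integrable_add integrable_mult_right)
    show "((\<lambda>t. \<phi> t * e t) \<longlongrightarrow> 0) at_top" "((\<lambda>t. \<phi> t * e t) \<longlongrightarrow> 0) at_bot"
      by (rule Lim_null_comparison[OF _ tendsto_norm_zero[OF schwartz_tendsto_0(1)[OF assms]]]
          Lim_null_comparison[OF _ tendsto_norm_zero[OF schwartz_tendsto_0(2)[OF assms]]]; simp add: norm_mult ne)+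
  qed
  moreover have "(LINT t|lborel. g t) = (- \<i> * of_real \<omega>) * (LINT t|lborel. \<phi> t * e t) + (LINT t|lborel. \<phi>' t * e t)"
    unfolding g_eq using i1 by (subst Bochner_Integration.integral_add) (auto intro!: integrable_mult_right)
  ultimately show ?thesis by (simp add: fourier_def e_def \<phi>'_def algebra_simps)
qed

text \<open>\<open>dist_fourier\<close> evaluates a distribution at the transform of the test
  function, and distributions are set to 0 off the Schwartz space, so without this fact its values
  would be meaningless. Derivatives of the transform come from multiplying by - i t; powers of the
  frequency are traded for derivatives of the function, hence the induction over all \<psi>.\<close>

lemma schwartz_fourier:
  assumes "\<phi> \<in> schwartz"
  shows "fourier \<phi> \<in> schwartz"
proof -
  define \<mu> where "\<mu> = (\<lambda>\<psi> t. - \<i> * (complex_of_real t * \<psi> t))"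
  have \<mu>1: "\<mu> \<psi> \<in> schwartz" if "\<psi> \<in> schwartz" for \<psi>
    unfolding \<mu>_def by (intro schwartz_cmult schwartz_mult_id that)
  have \<mu>: "(\<mu> ^^ n) \<psi> \<in> schwartz" if "\<psi> \<in> schwartz" for n \<psi>
    using that \<mu>1 by (induction n) auto
  have bound: "\<exists>B. \<forall>t. \<bar>t\<bar> ^ m * cmod (fourier \<psi> t) \<le> B" if "\<psi> \<in> schwartz" for m \<psi>
    using that
  proof (induction m arbitrary: \<psi>)
    case 0
    then show ?case using fourier_bound[OF schwartz_integrable] by auto
  next
    case (Suc m)
    then obtain B where B: "\<And>t. \<bar>t\<bar> ^ m * cmod (fourier (\<lambda>t. vector_derivative \<psi> (at t)) t) \<le> B"
      using schwartz_vderiv(1) by blast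
    have "\<bar>t\<bar> ^ Suc m * cmod (fourier \<psi> t) \<le> B" for t
      using B[of t] fourier_vector_derivative[OF Suc.prems, of t] by (simp add: norm_mult mult_ac)
    then show ?case by blast
  qed
  show ?thesis
  proof (rule schwartzI(1)[of "\<lambda>n. fourier ((\<mu> ^^ n) \<phi>)"])
    show "(fourier ((\<mu> ^^ n) \<phi>) has_vector_derivative fourier ((\<mu> ^^ Suc n) \<phi>) t) (at t)" for n t
      using fourier_has_vector_derivative[OF schwartz_integrable[OF \<mu>[OF assms]] schwartz_integrable[OF schwartz_mult_id[OF \<mu>[OF assms]]], of n t]
      by (simp add: \<mu>_def)
  qed (use bound \<mu> assms in auto)
qed

lemma integrable_pair_mult:
  fixes f g :: "real \<Rightarrow> complex"
  assumes f: "integrable lborel f" and g: "integrable lborel g"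
    and h: "h \<in> borel_measurable (lborel \<Otimes>\<^sub>M lborel)" "\<And>p. cmod (h p) \<le> 1"
  shows "integrable (lborel \<Otimes>\<^sub>M lborel) (\<lambda>(x, y). f x * g y * h (x, y))"
proof -
  have [measurable]: "f \<in> borel_measurable lborel" "g \<in> borel_measurable lborel" using f g by auto
  note h(1)[measurable]
  have "integrable (lborel \<Otimes>\<^sub>M lborel) (\<lambda>(x, y). f x * g y)"
  proof (rule lborel_pair.Fubini_integrable)
    show "integrable lborel (\<lambda>x. LINT y|lborel. norm (case (x, y) of (x, y) \<Rightarrow> f x * g y))"
      using f by (simp add: norm_mult)
    show "AE x in lborel. integrable lborel (\<lambda>y. case (x, y) of (x, y) \<Rightarrow> f x * g y)"
      using g by simp
  qed measurable
  then show ?thesis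
    by (rule Bochner_Integration.integrable_bound)
      (auto simp: norm_mult intro!: AE_I2 mult_left_le h(2))
qed

lemma measurable_exp_pair:
  "(\<lambda>p. exp (- \<i> * of_real (fst p) * of_real (snd p))) \<in> borel_measurable (lborel \<Otimes>\<^sub>M lborel)"
proof -
  have "(\<lambda>p::real\<times>real. exp (- \<i> * of_real (fst p) * of_real (snd p))) \<in> borel_measurable borel"
    by (intro borel_measurable_continuous_onI continuous_intros)
  then show ?thesis by (simp add: lborel_prod)
qed

text \<open>Fubini. This identity makes the distributional transform of an integrable function agree
  with the classical one.\<close>

lemma fourier_multiplication_formula:
  assumes f: "integrable lborel f" and g: "integrable lborel g"
  shows "(LINT t|lborel. f t * fourier g t) = (LINT t|lborel. fourier f t * g t)"
proof -
  have int: "integrable (lborel \<Otimes>\<^sub>M lborel) (\<lambda>(x, y). f x * g y * exp (- \<i> * of_real x * of_real y))"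
    using integrable_pair_mult[OF f g measurable_exp_pair] by simp
  have "(LINT t|lborel. f t * fourier g t) = (LINT x|lborel. LINT y|lborel. f x * g y * exp (- \<i> * of_real x * of_real y))"
    unfolding fourier_def by (rule Bochner_Integration.integral_cong) (auto simp: mult_ac simp flip: integral_mult_right_zero)
  also have "\<dots> = (LINT y|lborel. LINT x|lborel. f x * g y * exp (- \<i> * of_real x * of_real y))"
    by (rule lborel_pair.Fubini_integral[symmetric]) (use int in simp)
  also have "\<dots> = (LINT t|lborel. fourier f t * g t)"
    unfolding fourier_def by (rule Bochner_Integration.integral_cong) (auto simp: mult_ac simp flip: integral_mult_right_zero)
  finally show ?thesis .
qed

lemma convolution_L1:
  assumes f: "integrable lborel f" and g: "integrable lborel g"
  shows "integrable lborel (conv f g)" and "fourier (conv f g) \<omega> = fourier f \<omega> * fourier g \<omega>"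
proof -
  have [measurable]: "f \<in> borel_measurable borel" "g \<in> borel_measurable borel" using f g by auto
  have shift: "integrable lborel (\<lambda>t. k (t - s))" "(LINT t|lborel. k (t - s)) = (LINT t|lborel. k t)"
    if "integrable lborel k" for k :: "real \<Rightarrow> 'b::{banach, second_countable_topology}" and s
    using lborel_integrable_real_affine[OF that, of 1 "- s"] lborel_integral_real_affine[of 1 k "- s"]
    by (auto simp: add.commute)
  have int: "integrable (lborel \<Otimes>\<^sub>M lborel) (\<lambda>(s, t). f (t - s) * g s)"
  proof (rule lborel_pair.Fubini_integrable)
    have "(LINT t|lborel. cmod (f (t - s) * g s)) = (LINT t|lborel. cmod (f t)) * cmod (g s)" for s
      using shift(2)[OF integrable_norm[OF f], of s] by (simp add: norm_mult)
    then show "integrable lborel (\<lambda>s. LINT t|lborel. norm (case (s, t) of (s, t) \<Rightarrow> f (t - s) * g s))"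
      using g by simp
    show "AE s in lborel. integrable lborel (\<lambda>t. case (s, t) of (s, t) \<Rightarrow> f (t - s) * g s)"
      using shift(1)[OF f] by simp
  qed measurable
  show "integrable lborel (conv f g)"
    using lborel_pair.integrable_snd[OF int] unfolding conv_def by simp
  define e where "e t = exp (- \<i> * of_real t * of_real \<omega>)" for t :: real
  have [measurable]: "e \<in> borel_measurable borel"
    unfolding e_def by (intro borel_measurable_continuous_onI continuous_intros)
  have ne: "cmod (e t) = 1" for t by (simp add: e_def norm_exp_eq_Re)
  have int2: "integrable (lborel \<Otimes>\<^sub>M lborel) (\<lambda>(s, t). f (t - s) * g s * e t)"
    by (rule Bochner_Integration.integrable_bound[OF int]) (auto simp: norm_mult ne)
  have "fourier (conv f g) \<omega> = (LINT t|lborel. LINT s|lborel. f (t - s) * g s * e t)"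
    unfolding fourier_def conv_def e_def by simp
  also have "\<dots> = (LINT s|lborel. LINT t|lborel. f (t - s) * g s * e t)"
    using int2 by (rule lborel_pair.Fubini_integral)
  also have "\<dots> = (LINT s|lborel. fourier f \<omega> * (g s * e s))"
  proof (rule Bochner_Integration.integral_cong)
    fix s
    have "(LINT t|lborel. f (t - s) * g s * e t) = (LINT t|lborel. (f (t - s) * e (t - s)) * (g s * e s))"
    proof (rule Bochner_Integration.integral_cong)
      show "f (t - s) * g s * e t = (f (t - s) * e (t - s)) * (g s * e s)" for t
        by (simp add: e_def algebra_simps flip: exp_add)
    qed simp
    also have "\<dots> = (LINT t|lborel. f (t - s) * e (t - s)) * (g s * e s)" by simp
    also have "(LINT t|lborel. f (t - s) * e (t - s)) = fourier f \<omega>"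
      using shift(2)[OF fourier_integrable_integrand[OF f, of \<omega>], of s] by (simp add: fourier_def e_def)
    finally show "(LINT t|lborel. f (t - s) * g s * e t) = fourier f \<omega> * (g s * e s)" .
  qed simp
  also have "\<dots> = fourier f \<omega> * fourier g \<omega>" by (simp add: fourier_def e_def)
  finally show "fourier (conv f g) \<omega> = fourier f \<omega> * fourier g \<omega>" .
qed

lemma fourier_refl_cnj:
  "fourier (refl_fun (\<lambda>s. cnj (\<psi> s))) \<omega> = cnj (fourier \<psi> \<omega>)"
proof -
  have "fourier (refl_fun (\<lambda>s. cnj (\<psi> s))) \<omega> = (LINT t|lborel. cnj (\<psi> (- t) * exp (\<i> * of_real t * of_real \<omega>)))"
    unfolding fourier_def refl_fun_def by (rule Bochner_Integration.integral_cong) (auto simp: exp_cnj)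
  also have "\<dots> = cnj (LINT t|lborel. \<psi> (- t) * exp (\<i> * of_real t * of_real \<omega>))"
    by (rule Bochner_Integration.integral_cnj)
  also have "(LINT t|lborel. \<psi> (- t) * exp (\<i> * of_real t * of_real \<omega>)) = fourier \<psi> \<omega>"
    unfolding fourier_def
    using lborel_integral_real_affine[of "-1" "\<lambda>t. \<psi> t * exp (- \<i> * of_real t * of_real \<omega>)" 0] by simp
  finally show ?thesis .
qed

lemma fourier_refl: "fourier (refl_fun f) \<omega> = fourier f (- \<omega>)"
  unfolding fourier_def refl_fun_def
  using lborel_integral_real_affine[of "-1" "\<lambda>t. f t * exp (- \<i> * of_real t * of_real (- \<omega>))" 0] by simp

section \<open>Gaussian test functions\<close>

definition gauss :: "real \<Rightarrow> real \<Rightarrow> complex" where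
  "gauss s t = of_real (exp (- (t - s)\<^sup>2 / 2))"

text \<open>Induction over the polynomial; a factor t split off from it is absorbed by raising the
  exponent of the weight, so that exponent stays arbitrary.\<close>

lemma gauss_decay: "\<exists>B. \<forall>t. \<bar>t\<bar> ^ m * cmod (poly p (of_real t) * gauss s t) \<le> B"
proof (induction p arbitrary: m)
  case (pCons a p)
  \<comment> \<open>Here |t|^m is at most e^(m |t|), and completing the square bounds m |t - s| by
    half of m^2 + (t - s)^2.\<close>
  have mono: "\<bar>t\<bar> ^ m * exp (- (t - s)\<^sup>2 / 2) \<le> exp (m * \<bar>s\<bar> + m\<^sup>2 / 2)" for t
  proof -
    have "\<bar>t\<bar> ^ m \<le> exp \<bar>t\<bar> ^ m" 
    proof (rule power_mono)
      show "\<bar>t\<bar> \<le> exp \<bar>t\<bar>" using exp_ge_add_one_self[of "\<bar>t\<bar>"] by linarith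
    qed simp
    then have "\<bar>t\<bar> ^ m \<le> exp (m * \<bar>t\<bar>)" by (simp add: exp_of_nat_mult)
    then have "\<bar>t\<bar> ^ m * exp (- (t - s)\<^sup>2 / 2) \<le> exp (m * \<bar>t\<bar>) * exp (- (t - s)\<^sup>2 / 2)"
      by (intro mult_right_mono) auto
    also have "\<dots> = exp (m * \<bar>t\<bar> - (t - s)\<^sup>2 / 2)" by (simp add: exp_add[symmetric])
    also have "\<dots> \<le> exp (m * \<bar>s\<bar> + m\<^sup>2 / 2)"
    proof -
      have "m * \<bar>t\<bar> \<le> m * (\<bar>s\<bar> + \<bar>t - s\<bar>)" by (intro mult_left_mono) auto
      moreover have "0 \<le> (real m - \<bar>t - s\<bar>)\<^sup>2" by simp
      then have "2 * (m * \<bar>t - s\<bar>) \<le> m\<^sup>2 + (t - s)\<^sup>2" by (simp add: power2_eq_square algebra_simps)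
      ultimately have "m * \<bar>t\<bar> - (t - s)\<^sup>2 / 2 \<le> m * \<bar>s\<bar> + m\<^sup>2 / 2" by (simp add: algebra_simps)
      then show ?thesis by simp
    qed
    finally show ?thesis .
  qed
  obtain B where B: "\<And>t. \<bar>t\<bar> ^ Suc m * cmod (poly p (of_real t) * gauss s t) \<le> B"
    using pCons.IH by blast
  have "\<bar>t\<bar> ^ m * cmod (poly (pCons a p) (of_real t) * gauss s t) \<le> cmod a * exp (m * \<bar>s\<bar> + m\<^sup>2 / 2) + B" for t
  proof -
    have "cmod (poly (pCons a p) (of_real t) * gauss s t)
       \<le> cmod a * exp (- (t - s)\<^sup>2 / 2) + \<bar>t\<bar> * cmod (poly p (of_real t) * gauss s t)"
      using norm_triangle_ineq[of "a * gauss s t" "of_real t * (poly p (of_real t) * gauss s t)"]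
      by (simp add: gauss_def norm_mult algebra_simps)
    then have "\<bar>t\<bar> ^ m * cmod (poly (pCons a p) (of_real t) * gauss s t)
       \<le> \<bar>t\<bar> ^ m * (cmod a * exp (- (t - s)\<^sup>2 / 2) + \<bar>t\<bar> * cmod (poly p (of_real t) * gauss s t))"
      by (intro mult_left_mono) auto
    also have "\<dots> = cmod a * (\<bar>t\<bar> ^ m * exp (- (t - s)\<^sup>2 / 2)) + \<bar>t\<bar> ^ Suc m * cmod (poly p (of_real t) * gauss s t)"
      by (simp add: algebra_simps)
    also have "\<dots> \<le> cmod a * exp (m * \<bar>s\<bar> + m\<^sup>2 / 2) + B"
      using mono[of t] B[of t] by (intro add_mono mult_left_mono) auto
    finally show ?thesis .
  qed
  then show ?case by blast
qed auto

lemma gauss_has_vector_derivative: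
  "(gauss s has_vector_derivative - of_real (t - s) * gauss s t) (at t)"
  unfolding gauss_def
  by (rule has_vector_derivative_eq_rhs[OF has_vector_derivative_of_real])
    (auto intro!: derivative_eq_intros simp flip: of_real_mult of_real_minus of_real_diff simp: field_simps)

text \<open>Polynomials times a fixed Gaussian are closed under differentiation: the factor q
  becomes q' - (x - s) q.\<close>

lemma poly_gauss_schwartz: "(\<lambda>t. poly p (of_real t) * gauss s t) \<in> schwartz"
proof -
  define nxt where "nxt q = pderiv q - [:- of_real s, 1:] * q" for q :: "complex poly"
  show ?thesis
  proof (rule schwartzI(1)[of "\<lambda>n t. poly ((nxt ^^ n) p) (of_real t) * gauss s t"])
    show "((\<lambda>t. poly ((nxt ^^ n) p) (of_real t) * gauss s t) has_vector_derivative
       poly ((nxt ^^ Suc n) p) (of_real t) * gauss s t) (at t)" for n t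
    proof -
      define q where "q = (nxt ^^ n) p"
      have 1: "((\<lambda>t. poly q (of_real t)) has_vector_derivative poly (pderiv q) (of_real t)) (at t)"
        using has_vector_derivative_real_field[OF poly_DERIV] .
      have "((\<lambda>t. poly q (of_real t) * gauss s t) has_vector_derivative
        poly q (of_real t) * (- of_real (t - s) * gauss s t) + poly (pderiv q) (of_real t) * gauss s t) (at t)"
        by (intro has_vector_derivative_mult 1 gauss_has_vector_derivative)
      then show ?thesis by (simp add: q_def[symmetric] nxt_def algebra_simps)
    qed
  qed (use gauss_decay in auto)
qed

lemma gauss_schwartz: "gauss s \<in> schwartz"
  using poly_gauss_schwartz[of 1 s] by simp

text \<open>After a shift this is the characteristic function of the standard normal law. The centre
  s enters only as a phase, so pairing the transforms of \<open>gauss s\<close> and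
  \<open>gauss 0\<close> produces, as s varies, all Fourier integrals against one fixed
  weight.\<close>

lemma fourier_gauss:
  "fourier (gauss s) \<omega> = of_real (sqrt (2 * pi)) * exp (- \<i> * of_real s * of_real \<omega>) * of_real (exp (- \<omega>\<^sup>2 / 2))"
proof -
  have "fourier (gauss s) \<omega> = (LINT t|lborel. gauss s (s + t) * exp (- \<i> * of_real (s + t) * of_real \<omega>))"
    unfolding fourier_def
    using lborel_integral_real_affine[of 1 "\<lambda>t. gauss s t * exp (- \<i> * of_real t * of_real \<omega>)" s] by simp
  also have "\<dots> = (LINT t|lborel. of_real (sqrt (2 * pi)) * exp (- \<i> * of_real s * of_real \<omega>) *
      (std_normal_density t *\<^sub>R iexp (- \<omega> * t)))"
  proof (rule Bochner_Integration.integral_cong)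
    fix t
    have "gauss s (s + t) = of_real (sqrt (2 * pi)) * of_real (std_normal_density t)"
      by (simp add: gauss_def std_normal_density_def del: of_real_mult of_real_divide flip: of_real_mult)
    moreover have "exp (- \<i> * of_real (s + t) * of_real \<omega>) = exp (- \<i> * of_real s * of_real \<omega>) * iexp (- \<omega> * t)"
      by (simp add: algebra_simps flip: exp_add)
    ultimately show "gauss s (s + t) * exp (- \<i> * of_real (s + t) * of_real \<omega>) =
      of_real (sqrt (2 * pi)) * exp (- \<i> * of_real s * of_real \<omega>) * (std_normal_density t *\<^sub>R iexp (- \<omega> * t))"
      by (simp add: scaleR_conv_of_real mult_ac)
  qed simp
  also have "\<dots> = of_real (sqrt (2 * pi)) * exp (- \<i> * of_real s * of_real \<omega>) * (LINT t|lborel. std_normal_density t *\<^sub>R iexp (- \<omega> * t))"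
    by (rule integral_mult_right_zero)
  also have "(LINT t|lborel. std_normal_density t *\<^sub>R iexp (- \<omega> * t)) = char std_normal_distribution (- \<omega>)"
    unfolding char_def by (subst integral_density) auto
  also have "\<dots> = of_real (exp (- \<omega>\<^sup>2 / 2))"
    by (simp add: char_std_normal_distribution)
  finally show ?thesis .
qed

section \<open>Functions and point masses as tempered distributions\<close>

lemma schwartz_seminorm_bound:
  assumes "\<phi> \<in> schwartz"
  shows "cmod (\<phi> t) \<le> schwartz_seminorm 0 0 \<phi>"
proof -
  have "bounded (range (\<lambda>t. \<bar>t\<bar> ^ 0 * cmod (vderiv 0 \<phi> t)))"
    using assms unfolding schwartz_def by blast
  then have "bdd_above (range (\<lambda>t. \<bar>t\<bar> ^ 0 * cmod (vderiv 0 \<phi> t)))"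
    by (rule bounded_imp_bdd_above)
  from cSUP_upper[OF UNIV_I this, of t] show ?thesis
    by (simp add: schwartz_seminorm_def)
qed

lemma integrable_mult_bounded:
  fixes f g :: "real \<Rightarrow> complex"
  assumes "integrable lborel f" "g \<in> borel_measurable borel" "\<And>t. cmod (g t) \<le> B"
  shows "integrable lborel (\<lambda>t. g t * f t)"
proof (rule Bochner_Integration.integrable_bound[OF integrable_mult_right[OF assms(1), of "of_real B"]])
  have "cmod (g t * f t) \<le> cmod (of_real B * f t)" for t
    using assms(3)[of t] by (auto simp: norm_mult intro!: mult_right_mono)
  then show "AE x in lborel. cmod (g x * f x) \<le> cmod (complex_of_real B * f x)" by simp
qed (use assms in auto)

text \<open>The pairing is bounded by the integral of |h| times the supremum of the test function,
  which is the seminorm with both indices 0.\<close>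

lemma dist_of_fun_tempered:
  assumes h: "integrable lborel h"
  shows "dist_of_fun h \<in> tempered_distributions"
  unfolding tempered_distributions_def
proof (intro CollectI conjI ballI allI impI)
  fix \<phi> :: "real \<Rightarrow> complex" assume "\<phi> \<notin> schwartz" then show "dist_of_fun h \<phi> = 0" by (simp add: dist_of_fun_def)
next
  have int: "integrable lborel (\<lambda>t. h t * \<phi> t)" if "\<phi> \<in> schwartz" for \<phi>
    using integrable_mult_bounded[OF h schwartz_measurable[OF that] schwartz_seminorm_bound[OF that]]
    by (simp add: mult.commute)
  {
    fix \<phi> \<psi> a b assume "\<phi> \<in> schwartz" "\<psi> \<in> schwartz"
    then show "dist_of_fun h (\<lambda>t. a * \<phi> t + b * \<psi> t) = a * dist_of_fun h \<phi> + b * dist_of_fun h \<psi>"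
      using int[of \<phi>] int[of \<psi>] by (simp add: dist_of_fun_def schwartz_lincomb algebra_simps)
  next
    fix X assume X: "\<forall>j. X j \<in> schwartz" and lim: "\<forall>m n. (\<lambda>j. schwartz_seminorm m n (X j)) \<longlonglongrightarrow> 0"
    show "(\<lambda>j. dist_of_fun h (X j)) \<longlonglongrightarrow> 0"
    proof (rule Lim_null_comparison)
      show "\<forall>\<^sub>F j in sequentially. norm (dist_of_fun h (X j)) \<le> (LINT t|lborel. cmod (h t)) * schwartz_seminorm 0 0 (X j)"
      proof (rule always_eventually, rule allI)
        fix j
        have Xj: "X j \<in> schwartz" using X by blast
        have "norm (dist_of_fun h (X j)) \<le> (LINT t|lborel. cmod (h t * X j t))"
          using Xj by (simp add: dist_of_fun_def integral_norm_bound del: norm_mult)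
        also have "\<dots> \<le> (LINT t|lborel. cmod (h t) * schwartz_seminorm 0 0 (X j))"
          using int[OF Xj] h by (intro integral_mono) (auto simp: norm_mult intro!: mult_left_mono schwartz_seminorm_bound Xj dest: integrable_norm)
        finally show "norm (dist_of_fun h (X j)) \<le> (LINT t|lborel. cmod (h t)) * schwartz_seminorm 0 0 (X j)"
          by simp
      qed
      show "(\<lambda>j. (LINT t|lborel. cmod (h t)) * schwartz_seminorm 0 0 (X j)) \<longlonglongrightarrow> 0"
        using lim by (intro tendsto_mult_right_zero) auto
    qed
  }
qed

lemma is_function_fourier:
  assumes h: "integrable lborel h"
  shows "is_function (dist_fourier (dist_of_fun h)) (fourier h)"
  unfolding is_function_def
proof (intro conjI ballI ext)
  show m: "fourier h \<in> borel_measurable borel"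
    using h by (intro fourier_measurable) auto
  show "integrable lborel (\<lambda>x. fourier h x * \<phi> x)" if "\<phi> \<in> schwartz" for \<phi>
    using integrable_mult_bounded[OF schwartz_integrable[OF that] m fourier_bound[OF h]] .
  show "dist_fourier (dist_of_fun h) \<phi> = dist_of_fun (fourier h) \<phi>" for \<phi>
    using fourier_multiplication_formula[OF h schwartz_integrable, of \<phi>]
    by (auto simp: dist_fourier_def dist_of_fun_def schwartz_fourier)
qed

lemma is_function_fourier_dirac:
  "is_function (dist_fourier (dirac t)) (\<lambda>y. exp (- \<i> * of_real t * of_real y))"
  unfolding is_function_def
proof (intro conjI ballI ext)
  show m: "(\<lambda>y. exp (- \<i> * of_real t * of_real y)) \<in> borel_measurable borel"
    by (intro borel_measurable_continuous_onI continuous_intros)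
  show "integrable lborel (\<lambda>y. exp (- \<i> * of_real t * of_real y) * \<phi> y)" if "\<phi> \<in> schwartz" for \<phi>
    by (rule integrable_mult_bounded[OF schwartz_integrable[OF that] m, of 1]) (simp only: cmod_exp_fourier)
  show "dist_fourier (dirac t) \<phi> = dist_of_fun (\<lambda>y. exp (- \<i> * of_real t * of_real y)) \<phi>" for \<phi>
    by (auto simp: dist_fourier_def dirac_def dist_of_fun_def schwartz_fourier fourier_def mult_ac)
qed

section \<open>Completely monotone kernels\<close>

locale cm_kernel =
  fixes K :: "real \<Rightarrow> real"
  assumes cont: "continuous_on UNIV K" and nonneg: "K t \<ge> 0" and nontrivial: "\<exists>t. K t \<noteq> 0"
    and sym: "K (- t) = K t" and lim: "(K \<longlongrightarrow> 0) at_top" and cm: "completely_monotone K"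
begin

text \<open>Extending by 0 to the left turns integrals over the half-line into integrals over
  \<open>lborel\<close>. Near 0 the values may be unbounded, since K is merely continuous
  there.\<close>

definition L :: "real \<Rightarrow> real" where "L v = (if v > 0 then - deriv K v else 0)"

definition N :: "real \<Rightarrow> real" where "N v = (if v > 0 then deriv (deriv K) v else 0)"

lemma K_abs: "K \<bar>t\<bar> = K t"
  using sym[of t] by (simp add: abs_if)

lemma deriv_facts:
  assumes "t > 0"
  shows "K field_differentiable (at t)" "deriv K field_differentiable (at t)"
    "deriv (deriv K) field_differentiable (at t)" "deriv K t \<le> 0" "deriv (deriv K) t \<ge> 0"
proof -
  have *: "((deriv ^^ n) K) field_differentiable (at t) \<and> (-1) ^ n * (deriv ^^ n) K t \<ge> 0" for n
    using cm assms unfolding completely_monotone_def by blast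
  show "K field_differentiable (at t)" "deriv K field_differentiable (at t)"
    "deriv (deriv K) field_differentiable (at t)" "deriv K t \<le> 0" "deriv (deriv K) t \<ge> 0"
    using *[of 0] *[of 1] *[of 2] by (auto simp: numeral_2_eq_2)
qed

lemma L_nonneg: "L v \<ge> 0" and N_nonneg: "N v \<ge> 0"
  using deriv_facts[of v] by (auto simp: L_def N_def)

lemma K_deriv: "t > 0 \<Longrightarrow> (K has_field_derivative - L t) (at t)"
  using deriv_facts[of t] by (simp add: L_def DERIV_deriv_iff_field_differentiable)

lemma L_deriv:
  assumes "t > 0"
  shows "(L has_field_derivative - N t) (at t)"
proof -
  have "((\<lambda>v. - deriv K v) has_field_derivative - N t) (at t)"
    using deriv_facts[OF assms] assms
    by (auto simp: N_def DERIV_deriv_iff_field_differentiable intro!: DERIV_minus)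
  then show ?thesis
    by (rule DERIV_cong_ev[OF refl _ refl, THEN iffD1, rotated])
      (use assms in \<open>auto simp: L_def intro: eventually_mono[OF eventually_nhds_in_open[of "{0<..}"]]\<close>)
qed

lemma L_measurable [measurable]: "L \<in> borel_measurable borel"
proof -
  have "(\<lambda>v. if v \<in> {0<..} then - deriv K v else 0) \<in> borel_measurable borel"
    using deriv_facts(2)
    by (intro borel_measurable_continuous_on_if continuous_intros continuous_at_imp_continuous_on ballI)
      (auto intro: field_differentiable_imp_continuous_at)
  then show ?thesis by (simp add: L_def[abs_def])
qed

lemma N_measurable [measurable]: "N \<in> borel_measurable borel"
proof -
  have "(\<lambda>v. if v \<in> {0<..} then deriv (deriv K) v else 0) \<in> borel_measurable borel"
    using deriv_facts(3)
    by (intro borel_measurable_continuous_on_if continuous_intros continuous_at_imp_continuous_on ballI)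
      (auto intro: field_differentiable_imp_continuous_at)
  then show ?thesis by (simp add: N_def[abs_def])
qed

lemma L_antimono:
  assumes "0 < s" "s \<le> t"
  shows "L t \<le> L s"
proof (rule DERIV_nonpos_imp_nonincreasing[OF assms(2)])
  show "\<exists>y. (L has_real_derivative y) (at x) \<and> y \<le> 0" if "s \<le> x" for x
    using L_deriv[of x] N_nonneg[of x] assms that by (intro exI[of _ "- N x"]) auto
qed

text \<open>By the mean value theorem on [t/2, t] and monotonicity of \<open>L\<close>, t/2 times
  L(t) is at most K(t/2).\<close>

lemma L_tendsto_0: "(L \<longlongrightarrow> 0) at_top"
proof (rule Lim_null_comparison)
  have "((\<lambda>t::real. K (t / 2)) \<longlongrightarrow> 0) at_top"
    by (rule filterlim_compose[OF lim]) real_asymp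
  moreover have "((\<lambda>t::real. 2 / t) \<longlongrightarrow> 0) at_top" by real_asymp
  ultimately show "((\<lambda>t. K (t / 2) * (2 / t)) \<longlongrightarrow> 0) at_top"
    by (rule tendsto_mult_zero)
  show "\<forall>\<^sub>F t in at_top. norm (L t) \<le> K (t / 2) * (2 / t)"
    using eventually_gt_at_top[of 0]
  proof eventually_elim
    fix t :: real assume t: "t > 0"
    obtain \<xi> where \<xi>: "t / 2 < \<xi>" "\<xi> < t" "K t - K (t / 2) = (t - t / 2) * - L \<xi>"
      using MVT2[of "t / 2" t K "\<lambda>t. - L t"] K_deriv t by auto
    then have "(t / 2) * L \<xi> \<le> K (t / 2)" using nonneg[of t] by simp
    moreover have "(t / 2) * L t \<le> (t / 2) * L \<xi>" using L_antimono[of \<xi> t] \<xi> t by (intro mult_left_mono) auto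
    ultimately have "(t / 2) * L t \<le> K (t / 2)" by linarith
    then show "norm (L t) \<le> K (t / 2) * (2 / t)" using t L_nonneg[of t] by (simp add: field_simps)
  qed
qed

lemma nn_integral_L_pos:
  assumes "t > 0"
  shows "(\<integral>\<^sup>+v. ennreal (L v) * indicator {t..} v \<partial>lborel) = ennreal (K t)"
proof -
  have "(\<integral>\<^sup>+v. ennreal (L v) * indicator {t..} v \<partial>lborel) = ennreal (0 - (- K t))"
  proof (rule nn_integral_FTC_atLeast)
    show "((\<lambda>x. - K x) \<longlongrightarrow> 0) at_top" using tendsto_minus[OF lim] by simp
    show "((\<lambda>x. - K x) has_real_derivative L x) (at x)" if "t \<le> x" for x
      using DERIV_minus[OF K_deriv[of x]] that assms by simp
  qed (use L_nonneg in auto)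
  then show ?thesis by simp
qed

text \<open>The fundamental theorem applies on half-lines starting to the right of t; letting the
  starting point decrease to t, by monotone convergence and continuity of K, also covers t = 0,
  where K need not be differentiable.\<close>

lemma nn_integral_L:
  assumes "t \<ge> 0"
  shows "(\<integral>\<^sup>+v. ennreal (L v) * indicator {t<..} v \<partial>lborel) = ennreal (K t)"
proof -
  define r where "r n = inverse (real (Suc n))" for n
  have r: "r n > 0" "r (Suc n) \<le> r n" for n
    by (auto simp: r_def intro!: le_imp_inverse_le simp del: of_nat_Suc)
  have r_lim: "r \<longlonglongrightarrow> 0" unfolding r_def[abs_def] by (rule LIMSEQ_inverse_real_of_nat)
  define f where "f n v = ennreal (L v) * indicator {t + r n..} v" for n :: nat and v
  have "(\<lambda>n. \<integral>\<^sup>+v. f n v \<partial>lborel) \<longlonglongrightarrow> (\<integral>\<^sup>+v. ennreal (L v) * indicator {t<..} v \<partial>lborel)"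
  proof (rule nn_integral_LIMSEQ)
    show "incseq f"
    proof (rule incseq_SucI)
      show "f n \<le> f (Suc n)" for n using r(2)[of n] by (auto simp: f_def le_fun_def indicator_def)
    qed
    show "(\<lambda>n. f n v) \<longlonglongrightarrow> ennreal (L v) * indicator {t<..} v" for v
    proof (cases "t < v")
      case True
      have "\<forall>\<^sub>F n in sequentially. r n < v - t" using r_lim True by (intro order_tendstoD) auto
      then have "\<forall>\<^sub>F n in sequentially. ennreal (L v) * indicator {t<..} v = f n v"
        by eventually_elim (use True in \<open>auto simp: f_def indicator_def\<close>)
      then show ?thesis by (rule Lim_transform_eventually[OF tendsto_const])
    next
      case False
      then have "f n v = 0" for n using r(1)[of n] by (auto simp: f_def indicator_def)
      then show ?thesis using False by simp
    qed
  qed (auto simp: f_def)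
  moreover have "(\<integral>\<^sup>+v. f n v \<partial>lborel) = ennreal (K (t + r n))" for n
    unfolding f_def using assms r(1) by (intro nn_integral_L_pos add_nonneg_pos) auto
  moreover have "(\<lambda>n. ennreal (K (t + r n))) \<longlonglongrightarrow> ennreal (K t)"
  proof (rule tendsto_ennrealI)
    have "isCont K (t + 0)" using cont by (simp add: continuous_on_eq_continuous_at)
    moreover have "(\<lambda>n. t + r n) \<longlonglongrightarrow> t + 0" by (intro tendsto_intros r_lim)
    ultimately have "(\<lambda>n. K (t + r n)) \<longlonglongrightarrow> K (t + 0)" by (rule isCont_tendsto_compose)
    then show "(\<lambda>n. K (t + r n)) \<longlonglongrightarrow> K t" by simp
  qed
  ultimately show ?thesis using LIMSEQ_unique by force
qed

lemma integrable_L: "integrable lborel L" and integral_L: "(LINT v|lborel. L v) = K 0"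
proof -
  have "(\<integral>\<^sup>+v. ennreal (L v) \<partial>lborel) = (\<integral>\<^sup>+v. ennreal (L v) * indicator {0<..} v \<partial>lborel)"
    by (rule nn_integral_cong) (auto simp: L_def indicator_def)
  then have *: "(\<integral>\<^sup>+v. ennreal (L v) \<partial>lborel) = ennreal (K 0)" using nn_integral_L[of 0] by simp
  show "integrable lborel L" using * L_nonneg by (intro integrableI_nonneg) auto
  then show "(LINT v|lborel. L v) = K 0"
    using * L_nonneg nonneg by (simp add: integral_eq_nn_integral)
qed

lemma K_eq_integral_L:
  assumes "t \<ge> 0"
  shows "K t = (LINT v|lborel. L v * indicator {t<..} v)"
proof -
  have "(\<integral>\<^sup>+v. ennreal (L v * indicator {t<..} v) \<partial>lborel) = ennreal (K t)"
    using nn_integral_L[OF assms] by (simp add: ennreal_mult' ennreal_indicator L_nonneg)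
  then show ?thesis
    using nonneg L_nonneg by (subst integral_eq_nn_integral) auto
qed

lemma K_le: "K t \<le> K 0"
proof -
  have "ennreal (K \<bar>t\<bar>) \<le> ennreal (K 0)"
    unfolding nn_integral_L[of "\<bar>t\<bar>", simplified, symmetric] nn_integral_L[of 0, simplified, symmetric]
    by (intro nn_integral_mono) (auto simp: indicator_def)
  then show ?thesis using nonneg by (simp add: K_abs)
qed

lemma K0_pos: "K 0 > 0"
  using K_le nonneg nontrivial by (metis less_eq_real_def order_antisym_conv)

lemma nn_integral_N:
  assumes "v > 0"
  shows "(\<integral>\<^sup>+s. ennreal (N s) * indicator {v..} s \<partial>lborel) = ennreal (L v)"
proof -
  have "(\<integral>\<^sup>+s. ennreal (N s) * indicator {v..} s \<partial>lborel) = ennreal (0 - (- L v))"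
  proof (rule nn_integral_FTC_atLeast)
    show "((\<lambda>x. - L x) \<longlongrightarrow> 0) at_top" using tendsto_minus[OF L_tendsto_0] by simp
    show "((\<lambda>x. - L x) has_real_derivative N x) (at x)" if "v \<le> x" for x
      using DERIV_minus[OF L_deriv[of x]] that assms by simp
  qed (use N_nonneg in auto)
  then show ?thesis by simp
qed

text \<open>Tonelli, after writing L(v) as the tail integral of \<open>N\<close>. It is used with an
  indicator for g, which produces tents, and with the modulus of a Laplace integrand.\<close>

lemma nn_integral_N_mult:
  assumes [measurable]: "g \<in> borel_measurable borel"
  shows "(\<integral>\<^sup>+v. ennreal (L v) * g v * indicator {0<..} v \<partial>lborel) =
    (\<integral>\<^sup>+s. ennreal (N s) * (\<integral>\<^sup>+v. g v * indicator {0<..s} v \<partial>lborel) \<partial>lborel)"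
proof -
  have [measurable]: "(\<lambda>x :: real \<times> real. indicator {fst x..} (snd x) :: ennreal) \<in> borel_measurable (lborel \<Otimes>\<^sub>M lborel)"
    unfolding indicator_def atLeast_iff by measurable
  have "(\<integral>\<^sup>+v. ennreal (L v) * g v * indicator {0<..} v \<partial>lborel) =
     (\<integral>\<^sup>+v. (\<integral>\<^sup>+s. ennreal (N s) * indicator {v..} s * (g v * indicator {0<..} v) \<partial>lborel) \<partial>lborel)"
  proof (rule nn_integral_cong)
    fix v
    show "ennreal (L v) * g v * indicator {0<..} v = (\<integral>\<^sup>+s. ennreal (N s) * indicator {v..} s * (g v * indicator {0<..} v) \<partial>lborel)"
    proof (cases "v > 0")
      case True
      then show ?thesis by (subst nn_integral_multc) (auto simp: nn_integral_N)
    qed auto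
  qed
  also have "\<dots> = (\<integral>\<^sup>+s. (\<integral>\<^sup>+v. ennreal (N s) * indicator {v..} s * (g v * indicator {0<..} v) \<partial>lborel) \<partial>lborel)"
    by (rule lborel_pair.Fubini'[symmetric]) (simp add: split_beta')
  also have "\<dots> = (\<integral>\<^sup>+s. (\<integral>\<^sup>+v. ennreal (N s) * (g v * indicator {0<..s} v) \<partial>lborel) \<partial>lborel)"
    by (intro nn_integral_cong) (auto simp: indicator_def)
  also have "\<dots> = (\<integral>\<^sup>+s. ennreal (N s) * (\<integral>\<^sup>+v. g v * indicator {0<..s} v \<partial>lborel) \<partial>lborel)"
    by (intro nn_integral_cong nn_integral_cmult) auto
  finally show ?thesis .
qed

text \<open>Convexity written out as in Polya's criterion: K is a mixture of tents with nonnegative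
  weight, so positivity of its transforms needs to be checked for a single tent only.\<close>

lemma nn_integral_N_tent:
  assumes "t \<ge> 0"
  shows "(\<integral>\<^sup>+s. ennreal (N s * max 0 (s - t)) \<partial>lborel) = ennreal (K t)"
proof -
  have "ennreal (K t) = (\<integral>\<^sup>+v. ennreal (L v) * indicator {t<..} v * indicator {0<..} v \<partial>lborel)"
    unfolding nn_integral_L[OF assms, symmetric] using assms by (intro nn_integral_cong) (auto simp: indicator_def)
  also have "\<dots> = (\<integral>\<^sup>+s. ennreal (N s) * (\<integral>\<^sup>+v. indicator {t<..} v * indicator {0<..s} v \<partial>lborel) \<partial>lborel)"
    by (rule nn_integral_N_mult) auto
  also have "\<dots> = (\<integral>\<^sup>+s. ennreal (N s * max 0 (s - t)) \<partial>lborel)"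
  proof (rule nn_integral_cong)
    fix s
    have "(\<integral>\<^sup>+v. indicator {t<..} v * indicator {0<..s} v \<partial>lborel) = (\<integral>\<^sup>+v. indicator {t<..s} v \<partial>lborel)"
      using assms by (intro nn_integral_cong) (auto simp: indicator_def)
    also have "\<dots> = ennreal (max 0 (s - t))" by (cases "t \<le> s") (auto simp: max_def)
    finally show "ennreal (N s) * (\<integral>\<^sup>+v. indicator {t<..} v * indicator {0<..s} v \<partial>lborel) = ennreal (N s * max 0 (s - t))"
      using N_nonneg by (simp add: ennreal_mult')
  qed
  finally show ?thesis by simp
qed

lemma integrable_N_tent: "t \<ge> 0 \<Longrightarrow> integrable lborel (\<lambda>s. N s * max 0 (s - t))"
  and integral_N_tent: "t \<ge> 0 \<Longrightarrow> (LINT s|lborel. N s * max 0 (s - t)) = K t"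
proof -
  assume t: "t \<ge> 0"
  show "integrable lborel (\<lambda>s. N s * max 0 (s - t))"
    using nn_integral_N_tent[OF t] N_nonneg by (intro integrableI_nonneg) auto
  show "(LINT s|lborel. N s * max 0 (s - t)) = K t"
    using nn_integral_N_tent[OF t] N_nonneg nonneg by (subst integral_eq_nn_integral) auto
qed

lemma integrable_N_id: "integrable lborel (\<lambda>s. N s * s)" and integral_N_id: "(LINT s|lborel. N s * s) = K 0"
proof -
  have eq: "N s * s = N s * max 0 (s - 0)" for s by (auto simp: N_def)
  show "integrable lborel (\<lambda>s. N s * s)" "(LINT s|lborel. N s * s) = K 0"
    unfolding eq by (rule integrable_N_tent integral_N_tent; simp)+
qed

end

section \<open>Fejer kernels\<close>

lemma one_minus_cos_le_square: "1 - cos x \<le> x\<^sup>2 / (2::real)"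
proof -
  have "1 - cos x = 2 * (sin (x / 2))\<^sup>2" using cos_double_sin[of "x / 2"] by simp
  also have "\<dots> \<le> 2 * (x / 2)\<^sup>2"
  proof (rule mult_left_mono)
    show "(sin (x / 2))\<^sup>2 \<le> (x / 2)\<^sup>2" by (simp only: abs_le_square_iff[symmetric] abs_sin_x_le_abs_x)
  qed simp
  finally show ?thesis by (simp add: power2_eq_square)
qed

text \<open>The value is pi. It is never evaluated and enters only as a positive normalising
  factor.\<close>

definition fejer_const :: real where
  "fejer_const = (LINT x|lborel. (1 - cos x) / x\<^sup>2)"

lemma integrable_fejer: "integrable lborel (\<lambda>x::real. (1 - cos (u * x)) / x\<^sup>2)"
proof (rule Bochner_Integration.integrable_bound[OF integrable_mult_right[OF integrable_lborel_inverse_1_plus_square, of "u\<^sup>2 + 2"]])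
  have "\<bar>(1 - cos (u * x)) / x\<^sup>2\<bar> \<le> (u\<^sup>2 + 2) * inverse (1 + x\<^sup>2)" for x :: real
  proof (cases "x = 0")
    case False
    have "1 - cos (u * x) \<le> (u * x)\<^sup>2" "1 - cos (u * x) \<le> 2"
      using one_minus_cos_le_square[of "u * x"] cos_ge_minus_one[of "u * x"] zero_le_power2[of "u * x"] by linarith+
    then have "(1 - cos (u * x)) + x\<^sup>2 * (1 - cos (u * x)) \<le> u\<^sup>2 * x\<^sup>2 + x\<^sup>2 * 2"
      by (intro add_mono mult_left_mono) (auto simp: power_mult_distrib)
    then have "(1 + x\<^sup>2) * (1 - cos (u * x)) \<le> (u\<^sup>2 + 2) * x\<^sup>2" by (simp add: algebra_simps)
    moreover have "1 + x\<^sup>2 > 0" "x\<^sup>2 > 0" using False by (auto simp: add_pos_nonneg)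
    ultimately have "(1 - cos (u * x)) / x\<^sup>2 \<le> (u\<^sup>2 + 2) / (1 + x\<^sup>2)"
      by (simp only: pos_divide_le_eq times_divide_eq_left pos_le_divide_eq) (simp only: mult.commute)
    then show ?thesis by (simp add: divide_inverse)
  qed simp
  then show "AE x in lborel. norm ((1 - cos (u * x)) / x\<^sup>2) \<le> norm ((u\<^sup>2 + 2) * inverse (1 + x\<^sup>2))"
    by (intro AE_I2) (simp add: order_trans[OF _ abs_ge_self])
qed measurable

lemma integral_fejer: "(LINT x|lborel. (1 - cos (u * x)) / x\<^sup>2) = fejer_const * \<bar>u\<bar>"
proof (cases "u = 0")
  case False
  have "(LINT x|lborel. (1 - cos (u * x)) / x\<^sup>2) = \<bar>1 / u\<bar> *\<^sub>R (LINT x|lborel. (1 - cos (u * (0 + (1 / u) * x))) / (0 + (1 / u) * x)\<^sup>2)"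
    using False by (intro lborel_integral_real_affine) auto
  also have "\<dots> = \<bar>1 / u\<bar> * (LINT x|lborel. u\<^sup>2 * ((1 - cos x) / x\<^sup>2))"
    using False by (simp add: power_divide mult.commute)
  also have "\<dots> = \<bar>1 / u\<bar> * u\<^sup>2 * fejer_const"
    unfolding fejer_const_def by (subst integral_mult_right_zero) simp
  also have "\<bar>1 / u\<bar> * u\<^sup>2 = \<bar>u\<bar>" using False by (simp add: power2_eq_square abs_if)
  finally show ?thesis by simp
qed simp

lemma AE_cos_neq_1:
  assumes "w \<noteq> 0"
  shows "AE s in lborel. cos (w * s) \<noteq> (1::real)"
proof -
  have "{s. cos (w * s) = 1} \<subseteq> range (\<lambda>n::int. of_int n * 2 * pi / w)"
    using assms by (auto simp: cos_one_2pi_int field_simps image_iff)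
  then have "countable {s. cos (w * s) = 1}" by (rule countable_subset) auto
  then have "{s. cos (w * s) = 1} \<in> null_sets lborel" by (rule countable_imp_null_set_lborel)
  then show ?thesis by (rule AE_I') auto
qed

lemma AE_neq_0: "AE x in lborel. x \<noteq> (0::real)"
  by (rule AE_I'[of "{0}"]) (auto intro: countable_imp_null_set_lborel)

lemma fejer_const_pos: "fejer_const > 0"
proof -
  have "fejer_const \<ge> 0" unfolding fejer_const_def by (intro integral_nonneg_AE AE_I2) auto
  moreover have "fejer_const \<noteq> 0"
  proof
    assume "fejer_const = 0"
    then have "AE x in lborel. cos x = 1 \<or> x = (0::real)"
      using integral_nonneg_eq_0_iff_AE[OF integrable_fejer[of 1]] by (simp add: fejer_const_def)
    moreover have "AE x in lborel. cos (1 * x) \<noteq> (1::real)" by (rule AE_cos_neq_1) simp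
    ultimately have "AE x in (lborel :: real measure). False" using AE_neq_0 by eventually_elim auto
    then show False by (simp add: eventually_False ae_filter_eq_bot_iff)
  qed
  ultimately show ?thesis by simp
qed

text \<open>Product-to-sum formulas split the integrand into three integrals of the previous kind,
  and (|t + s| + |t - s|) / 2 - |t| is the tent. Thus tents and Fejer kernels are Fourier transforms
  of each other up to constants.\<close>

lemma integral_fejer_cos:
  "(LINT x|lborel. cos (t * x) * ((1 - cos (s * x)) / x\<^sup>2)) = fejer_const * max 0 (\<bar>s\<bar> - \<bar>t\<bar>)"
proof -
  have "cos (t * x) * ((1 - cos (s * x)) / x\<^sup>2) =
     ((1 - cos ((t + s) * x)) / x\<^sup>2 + (1 - cos ((t - s) * x)) / x\<^sup>2) / 2 - (1 - cos (t * x)) / x\<^sup>2" for x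
  proof -
    have "cos (t * x) * cos (s * x) = (cos ((t - s) * x) + cos ((t + s) * x)) / 2"
      by (simp add: cos_times_cos left_diff_distrib distrib_right)
    then have eq: "cos (t * x) * (1 - cos (s * x)) =
      ((1 - cos ((t + s) * x)) + (1 - cos ((t - s) * x))) / 2 - (1 - cos (t * x))"
      by (simp add: right_diff_distrib field_simps)
    have "cos (t * x) * ((1 - cos (s * x)) / x\<^sup>2) = (cos (t * x) * (1 - cos (s * x))) / x\<^sup>2" by simp
    also have "\<dots> = ((1 - cos ((t + s) * x)) / x\<^sup>2 + (1 - cos ((t - s) * x)) / x\<^sup>2) / 2 - (1 - cos (t * x)) / x\<^sup>2"
      unfolding eq by (simp add: diff_divide_distrib add_divide_distrib)
    finally show ?thesis .
  qed
  then have "(LINT x|lborel. cos (t * x) * ((1 - cos (s * x)) / x\<^sup>2)) =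
     (fejer_const * \<bar>t + s\<bar> + fejer_const * \<bar>t - s\<bar>) / 2 - fejer_const * \<bar>t\<bar>"
    using integrable_fejer[of "t + s"] integrable_fejer[of "t - s"] integrable_fejer[of t]
    by (simp add: integral_fejer)
  also have "\<dots> = fejer_const * ((\<bar>t + s\<bar> + \<bar>t - s\<bar>) / 2 - \<bar>t\<bar>)" by (simp add: field_simps)
  also have "(\<bar>t + s\<bar> + \<bar>t - s\<bar>) / 2 - \<bar>t\<bar> = max 0 (\<bar>s\<bar> - \<bar>t\<bar>)" by (auto simp: max_def abs_if)
  finally show ?thesis .
qed

section \<open>The spectral density of the kernel\<close>

context cm_kernel
begin

text \<open>The cosine transform of K over the half-line as a mixture of Fejer kernels; written with
  \<open>N\<close> because that transform converges only as an improper integral in general. At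
  \<open>w = 0\<close> division by zero makes the value 0, on a null set.\<close>

definition spec :: "real \<Rightarrow> real" where
  "spec w = (LINT s|lborel. N s * ((1 - cos (w * s)) / w\<^sup>2))"

lemma integrable_spec_integrand: "integrable lborel (\<lambda>s. N s * ((1 - cos (w * s)) / w\<^sup>2))"
proof (cases "w = 0")
  case False
  show ?thesis
  proof (rule Bochner_Integration.integrable_bound[OF integrable_mult_right[OF integrable_N_id, of "2 / \<bar>w\<bar>"]])
    have "(1 - cos (w * s)) / w\<^sup>2 \<le> 2 / \<bar>w\<bar> * s" if "s > 0" for s
    proof -
      \<comment> \<open>The bound must be linear in s: \<open>N s * s\<close> is integrable, whereas
        \<open>N s * s^2\<close> need not be.\<close>
      have "1 - cos (w * s) \<le> 2 * \<bar>w * s\<bar>"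
      proof (cases "\<bar>w * s\<bar> \<le> 1")
        case True
        have "(w * s)\<^sup>2 \<le> \<bar>w * s\<bar>"
          using True by (metis abs_ge_zero mult_left_le power2_abs power2_eq_square)
        then show ?thesis using one_minus_cos_le_square[of "w * s"] by simp
      next
        case False
        then show ?thesis using cos_ge_minus_one[of "w * s"] by linarith
      qed
      then have "(1 - cos (w * s)) / w\<^sup>2 \<le> 2 * \<bar>w * s\<bar> / w\<^sup>2" by (intro divide_right_mono) auto
      also have "\<dots> = 2 / \<bar>w\<bar> * s"
      proof -
        consider "w > 0" | "w < 0" using False by linarith
        then show ?thesis using that by cases (simp_all add: abs_mult power2_eq_square field_simps)
      qed
      finally show ?thesis .
    qed
    then have le: "N s * ((1 - cos (w * s)) / w\<^sup>2) \<le> N s * (2 / \<bar>w\<bar> * s)" for s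
      using N_nonneg[of s] by (cases "s > 0") (simp_all only: mult_left_mono, simp add: N_def)
    show "AE s in lborel. norm (N s * ((1 - cos (w * s)) / w\<^sup>2)) \<le> norm (2 / \<bar>w\<bar> * (N s * s))"
    proof (rule AE_I2)
      fix s
      have "norm (N s * ((1 - cos (w * s)) / w\<^sup>2)) = N s * ((1 - cos (w * s)) / w\<^sup>2)"
        using N_nonneg[of s] by simp
      also have "\<dots> \<le> N s * (2 / \<bar>w\<bar> * s)" by (rule le)
      also have "\<dots> = 2 / \<bar>w\<bar> * (N s * s)" by simp
      finally show "norm (N s * ((1 - cos (w * s)) / w\<^sup>2)) \<le> norm (2 / \<bar>w\<bar> * (N s * s))"
        unfolding real_norm_def by linarith
    qed
  qed measurable
qed simp

lemma spec_measurable [measurable]: "spec \<in> borel_measurable borel"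
  unfolding spec_def by measurable

lemma spec_nonneg: "spec w \<ge> 0"
  unfolding spec_def using N_nonneg by (intro integral_nonneg_AE AE_I2) auto

lemma spec_even: "spec (- w) = spec w"
  by (simp add: spec_def)

text \<open>For fixed w the cosine equals 1 only on a countable set, so a zero would force
  \<open>N s * s\<close> to vanish almost everywhere, although its integral is K(0) > 0. This strict
  positivity keeps the denominators away from 0 on the imaginary axis.\<close>

lemma spec_pos:
  assumes "w \<noteq> 0"
  shows "spec w > 0"
proof -
  have "spec w \<noteq> 0"
  proof
    assume "spec w = 0"
    then have "AE s in lborel. N s * ((1 - cos (w * s)) / w\<^sup>2) = 0"
      using integral_nonneg_eq_0_iff_AE[OF integrable_spec_integrand[of w]] N_nonneg by (simp add: spec_def)
    then have "AE s in lborel. N s * s = 0"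
      using AE_cos_neq_1[OF assms] by eventually_elim (use assms in auto)
    then have "(LINT s|lborel. N s * s) = (LINT s::real|lborel. 0)"
      by (rule integral_cong_AE[rotated 2]) auto
    then show False using integral_N_id K0_pos by simp
  qed
  then show ?thesis using spec_nonneg[of w] by simp
qed

text \<open>Integrating the modulus without the cosine over w first leaves
  \<open>fejer_const * (N s * s)\<close>, which is integrable; this licenses the exchange of the
  integrals over s and w.\<close>

lemma integrable_spec_pair:
  "integrable (lborel \<Otimes>\<^sub>M lborel) (\<lambda>(s, w). cos (t * w) * (N s * ((1 - cos (w * s)) / w\<^sup>2)))"
proof (rule Bochner_Integration.integrable_bound)
  show "integrable (lborel \<Otimes>\<^sub>M lborel) (\<lambda>(s, w). N s * ((1 - cos (w * s)) / w\<^sup>2))"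
  proof (rule lborel_pair.Fubini_integrable)
    have "(LINT w|lborel. norm (N s * ((1 - cos (w * s)) / w\<^sup>2))) = fejer_const * (N s * s)" for s
    proof -
      have "(LINT w|lborel. norm (N s * ((1 - cos (w * s)) / w\<^sup>2))) = (LINT w|lborel. N s * ((1 - cos (s * w)) / w\<^sup>2))"
        using N_nonneg[of s] by (intro Bochner_Integration.integral_cong) (auto simp: abs_mult mult.commute)
      also have "\<dots> = N s * (fejer_const * \<bar>s\<bar>)" by (simp only: integral_mult_right_zero integral_fejer)
      finally show ?thesis by (simp add: N_def)
    qed
    then show "integrable lborel (\<lambda>s. LINT w|lborel. norm (case (s, w) of (s, w) \<Rightarrow> N s * ((1 - cos (w * s)) / w\<^sup>2)))"
      using integrable_N_id by simp
    have "integrable lborel (\<lambda>w. (1 - cos (w * s)) / w\<^sup>2)" for s :: real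
      using integrable_fejer[of s] by (simp add: mult.commute)
    then show "AE s in lborel. integrable lborel (\<lambda>w. case (s, w) of (s, w) \<Rightarrow> N s * ((1 - cos (w * s)) / w\<^sup>2))"
      unfolding prod.case by (intro AE_I2 integrable_mult_right)
  qed measurable
  have "\<bar>cos (t * w) * b\<bar> \<le> \<bar>b\<bar>" for w b :: real
    using abs_cos_le_one[of "t * w"] by (simp add: abs_mult mult_left_le_one_le)
  then show "AE x in lborel \<Otimes>\<^sub>M lborel. norm (case x of (s, w) \<Rightarrow> cos (t * w) * (N s * ((1 - cos (w * s)) / w\<^sup>2)))
         \<le> norm (case x of (s, w) \<Rightarrow> N s * ((1 - cos (w * s)) / w\<^sup>2))"
    unfolding case_prod_beta real_norm_def by (intro AE_I2)
qed measurable

lemma integrable_spec: "integrable lborel spec"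
  using lborel_pair.integrable_snd[OF integrable_spec_pair[of 0]] by (simp add: spec_def[abs_def])

lemma integral_spec_cos: "(LINT w|lborel. cos (t * w) * spec w) = fejer_const * K t"
proof -
  have "(LINT w|lborel. cos (t * w) * spec w) =
    (LINT w|lborel. LINT s|lborel. cos (t * w) * (N s * ((1 - cos (w * s)) / w\<^sup>2)))"
    by (simp add: spec_def)
  also have "\<dots> = (LINT s|lborel. LINT w|lborel. cos (t * w) * (N s * ((1 - cos (w * s)) / w\<^sup>2)))"
    using integrable_spec_pair by (rule lborel_pair.Fubini_integral)
  also have "\<dots> = (LINT s|lborel. fejer_const * (N s * max 0 (s - \<bar>t\<bar>)))"
  proof (rule Bochner_Integration.integral_cong)
    fix s
    have "(LINT w|lborel. cos (t * w) * (N s * ((1 - cos (w * s)) / w\<^sup>2))) =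
       (LINT w|lborel. N s * (cos (t * w) * ((1 - cos (s * w)) / w\<^sup>2)))"
      by (rule Bochner_Integration.integral_cong) (auto simp: mult_ac)
    also have "\<dots> = N s * (fejer_const * max 0 (\<bar>s\<bar> - \<bar>t\<bar>))"
      by (simp only: integral_mult_right_zero integral_fejer_cos)
    finally show "(LINT w|lborel. cos (t * w) * (N s * ((1 - cos (w * s)) / w\<^sup>2))) = fejer_const * (N s * max 0 (s - \<bar>t\<bar>))"
      by (simp add: N_def)
  qed simp
  also have "\<dots> = fejer_const * K t" using integral_N_tent[of "\<bar>t\<bar>"] by (simp add: K_abs)
  finally show ?thesis .
qed

lemma integral_spec_exp:
  "(LINT w|lborel. of_real (spec w) * exp (- \<i> * of_real t * of_real w)) = of_real (fejer_const * K t)"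
proof -
  have ic: "integrable lborel (\<lambda>w. f (t * w) * spec w)" if "f \<in> borel_measurable borel" "\<And>x. \<bar>f x\<bar> \<le> 1" for f :: "real \<Rightarrow> real"
    by (rule Bochner_Integration.integrable_bound[OF integrable_spec])
      (use that in \<open>auto simp: abs_mult intro!: mult_left_le_one_le\<close>)
  \<comment> \<open>The density is even, so the imaginary part of the Fourier integral
    vanishes.\<close>
  have odd: "(LINT w|lborel. sin (t * w) * spec w) = 0"
    using lborel_integral_real_affine[of "-1" "\<lambda>w. sin (t * w) * spec w" 0] by (simp add: spec_even)
  have "of_real (spec w) * exp (- \<i> * of_real t * of_real w) =
     complex_of_real (cos (t * w) * spec w) - \<i> * complex_of_real (sin (t * w) * spec w)" for w
  proof -
    have "exp (- \<i> * of_real t * of_real w) = cis (- (t * w))" by (simp add: cis_conv_exp mult.assoc)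
    then show ?thesis by (simp add: complex_eq_iff mult.commute)
  qed
  then have "(LINT w|lborel. of_real (spec w) * exp (- \<i> * of_real t * of_real w)) =
    (LINT w|lborel. complex_of_real (cos (t * w) * spec w)) - (LINT w|lborel. \<i> * complex_of_real (sin (t * w) * spec w))"
    by (simp only:, intro Bochner_Integration.integral_diff integrable_mult_right integrable_of_real ic) auto
  then show ?thesis
    by (simp only: integral_mult_right_zero integral_complex_of_real odd integral_spec_cos) simp
qed

end

section \<open>Laplace transform of the kernel\<close>

text \<open>Integrating \<open>(1 - u) cos (yu) e\<^sup>-\<^sup>x\<^sup>u\<close> by parts twice against \<open>(1 - cos (yu)) / y\<^sup>2\<close> leaves only
  nonnegative terms.\<close>

lemma Re_tent_laplace_nonneg:
  fixes w :: complex
  assumes "Re w \<ge> 0" "w \<noteq> 0"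
  shows "Re ((exp (- w) - 1 + w) / w\<^sup>2) \<ge> 0"
proof (cases "Im w = 0")
  case True
  then have w: "w = of_real (Re w)" by (simp add: complex_eq_iff)
  have "(exp (- w) - 1 + w) / w\<^sup>2 = of_real ((exp (- Re w) - 1 + Re w) / (Re w)\<^sup>2)"
    by (subst (1 2 3) w) (simp add: exp_of_real flip: of_real_minus)
  moreover have "exp (- Re w) - 1 + Re w \<ge> 0" using exp_ge_add_one_self[of "- Re w"] by linarith
  ultimately show ?thesis by simp
next
  case False
  define x y where "x = Re w" and "y = Im w"
  have x: "x \<ge> 0" and y: "y \<noteq> 0" using assms False by (auto simp: x_def y_def)
  \<comment> \<open>A primitive of (1 - u) e^(-w u): \<open>G 1 - G 0\<close> is the Laplace
    transform of the unit tent, which is the fraction in the claim.\<close>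
  define G where "G u = exp (- w * of_real u) / w\<^sup>2 - (1 - of_real u) * exp (- w * of_real u) / w" for u :: real
  \<comment> \<open>The boundary terms of both integrations by parts. They vanish at 0 and leave
    e^-x (1 - cos y) / y^2 at 1, and the derivative of Re G exceeds that of \<psi>.\<close>
  define \<psi> where "\<psi> u = (1 - u) * exp (- x * u) * (sin (y * u) / y) +
     (1 + x * (1 - u)) * exp (- x * u) * ((1 - cos (y * u)) / y\<^sup>2)" for u
  have dG: "(G has_vector_derivative (1 - of_real u) * exp (- w * of_real u)) (at u)" for u
  proof -
    have "((\<lambda>u. exp (- w * u) / w\<^sup>2 - (1 - u) * exp (- w * u) / w) has_field_derivative (1 - of_real u) * exp (- w * of_real u)) (at (of_real u))"
      using assms(2) by (auto intro!: derivative_eq_intros simp: field_simps power2_eq_square)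
    from has_vector_derivative_real_field[OF this] show ?thesis by (simp add: G_def[abs_def])
  qed
  have Re_exp: "Re ((1 - of_real u) * exp (- w * of_real u)) = (1 - u) * exp (- x * u) * cos (y * u)" for u :: real
    by (simp add: x_def y_def Re_exp Im_exp)
  have d1: "((\<lambda>u. Re (G u)) has_real_derivative (1 - u) * exp (- x * u) * cos (y * u)) (at u)" for u
    using bounded_linear.has_vector_derivative[OF bounded_linear_Re dG[of u]]
    unfolding Re_exp has_real_derivative_iff_has_vector_derivative .
  have d2: "(\<psi> has_real_derivative ((1 - u) * exp (- x * u) * cos (y * u) -
     (2 * x + x\<^sup>2 * (1 - u)) * exp (- x * u) * ((1 - cos (y * u)) / y\<^sup>2))) (at u)" for u
  proof -
    have s: "((\<lambda>u. sin (y * u) / y) has_real_derivative cos (y * u)) (at u)"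
      using y by (auto intro!: derivative_eq_intros)
    have c: "((\<lambda>u. (1 - cos (y * u)) / y\<^sup>2) has_real_derivative sin (y * u) / y) (at u)"
      using y by (auto intro!: derivative_eq_intros simp: power2_eq_square)
    have 1: "((\<lambda>u. (1 - u) * exp (- x * u)) has_real_derivative - (1 + x * (1 - u)) * exp (- x * u)) (at u)"
      by (auto intro!: derivative_eq_intros simp: algebra_simps)
    have 2: "((\<lambda>u. (1 + x * (1 - u)) * exp (- x * u)) has_real_derivative - (2 * x + x\<^sup>2 * (1 - u)) * exp (- x * u)) (at u)"
      by (auto intro!: derivative_eq_intros simp: algebra_simps power2_eq_square)
    show ?thesis
      using DERIV_add[OF DERIV_mult[OF 1 s] DERIV_mult[OF 2 c]]
      unfolding \<psi>_def by (rule DERIV_cong) (simp only: mult_minus_left, simp add: algebra_simps)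
  qed
  have "Re (G 0) - \<psi> 0 \<le> Re (G 1) - \<psi> 1"
  proof (rule DERIV_nonneg_imp_nondecreasing[of 0 1 "\<lambda>u. Re (G u) - \<psi> u"])
    fix u :: real assume u: "0 \<le> u" "u \<le> 1"
    have "((\<lambda>u. Re (G u) - \<psi> u) has_real_derivative
       (2 * x + x\<^sup>2 * (1 - u)) * exp (- x * u) * ((1 - cos (y * u)) / y\<^sup>2)) (at u)"
      using DERIV_diff[OF d1 d2, of u] by simp
    moreover have "(2 * x + x\<^sup>2 * (1 - u)) * exp (- x * u) * ((1 - cos (y * u)) / y\<^sup>2) \<ge> 0"
      using u x by (intro mult_nonneg_nonneg add_nonneg_nonneg divide_nonneg_nonneg) auto
    ultimately show "\<exists>D. ((\<lambda>u. Re (G u) - \<psi> u) has_real_derivative D) (at u) \<and> 0 \<le> D" by blast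
  qed simp
  moreover have "\<psi> 0 = 0" "\<psi> 1 \<ge> 0" by (simp_all add: \<psi>_def)
  ultimately have "Re (G 1 - G 0) \<ge> 0" by simp
  moreover have "G 1 - G 0 = (exp (- w) - 1 + w) / w\<^sup>2"
    using assms(2) by (simp add: G_def field_simps power2_eq_square)
  ultimately show ?thesis by simp
qed

section \<open>The memory term on the closed right half-plane\<close>

context cm_kernel
begin

definition DD :: "complex \<Rightarrow> complex" where
  "DD z = (LINT v|lborel. of_real (L v) * (1 - exp (- z * of_real v)))"

lemma cmod_exp_le_1: "Re z \<ge> 0 \<Longrightarrow> v \<ge> 0 \<Longrightarrow> cmod (exp (- z * of_real v)) \<le> 1"
  by (simp add: norm_exp_eq_Re)

lemma DD_integrand_bound: "Re z \<ge> 0 \<Longrightarrow> cmod (of_real (L v) * (1 - exp (- z * of_real v))) \<le> 2 * L v"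
proof (cases "v > 0")
  case True
  assume "Re z \<ge> 0"
  then have "cmod (1 - exp (- z * of_real v)) \<le> 1 + 1"
    using cmod_exp_le_1[of z v] True by (intro norm_triangle_le_diff) auto
  then have "L v * cmod (1 - exp (- z * of_real v)) \<le> L v * 2" using L_nonneg[of v] by (intro mult_left_mono) auto
  then show ?thesis using L_nonneg[of v] by (simp add: norm_mult)
qed (simp add: L_def)

lemma measurable_exp_mult: "(\<lambda>v. exp (- z * complex_of_real v)) \<in> borel_measurable borel"
  by (intro borel_measurable_continuous_onI continuous_intros)

lemma DD_integrand_measurable [measurable]:
  "(\<lambda>v. of_real (L v) * (1 - exp (- z * complex_of_real v))) \<in> borel_measurable borel"
  using measurable_exp_mult[of z] by measurable

lemma DD_integrable:
  assumes "Re z \<ge> 0"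
  shows "integrable lborel (\<lambda>v. of_real (L v) * (1 - exp (- z * of_real v)))"
proof (rule Bochner_Integration.integrable_bound[OF integrable_mult_right[OF integrable_L, of 2]])
  show "AE v in lborel. norm (of_real (L v) * (1 - exp (- z * of_real v))) \<le> norm (2 * L v)"
    using DD_integrand_bound[OF assms] L_nonneg by (intro AE_I2) (simp del: norm_mult)
qed measurable

lemma DD_bound:
  assumes "Re z \<ge> 0"
  shows "cmod (DD z) \<le> 2 * K 0"
proof -
  have "cmod (DD z) \<le> (LINT v|lborel. 2 * L v)"
    unfolding DD_def using DD_integrable[OF assms] integrable_L DD_integrand_bound[OF assms]
    by (intro order_trans[OF integral_norm_bound] integral_mono) auto
  then show ?thesis by (simp add: integral_L)
qed

text \<open>The fraction with \<open>exp (- z * of_real s)\<close> is the Laplace transform of the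
  tent \<open>max 0 (s - t)\<close>. Exchanging the integrals over v and s is allowed up to the
  imaginary axis, except at 0, because |1 - e^(-z v)| is at most 2 and \<open>L\<close> is
  integrable.\<close>

lemma DD_div_eq:
  assumes "Re z \<ge> 0" "z \<noteq> 0"
  shows "DD z / z = (LINT s|lborel. of_real (N s) * ((exp (- z * of_real s) - 1 + z * of_real s) / z\<^sup>2))"
    and "integrable lborel (\<lambda>s. of_real (N s) * ((exp (- z * of_real s) - 1 + z * of_real s) / z\<^sup>2))"
proof -
  define b where "b v = (1 - exp (- z * of_real v)) / z" for v :: real
  have [measurable]: "b \<in> borel_measurable borel"
    unfolding b_def using measurable_exp_mult[of z] by measurable
  define H where "H v s = of_real (N s) * (if 0 < v \<and> v \<le> s then b v else 0)" for v s :: real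
  have H_meas [measurable]: "(\<lambda>(v, s). H v s) \<in> borel_measurable (lborel \<Otimes>\<^sub>M lborel)"
    unfolding H_def by measurable
  have int: "integrable (lborel \<Otimes>\<^sub>M lborel) (\<lambda>(v, s). H v s)"
  proof (rule integrableI_bounded)
    show "(\<lambda>(v, s). H v s) \<in> borel_measurable (lborel \<Otimes>\<^sub>M lborel)" by (rule H_meas)
    have "(\<integral>\<^sup>+p. ennreal (norm (case p of (v, s) \<Rightarrow> H v s)) \<partial>(lborel \<Otimes>\<^sub>M lborel)) =
      (\<integral>\<^sup>+s. \<integral>\<^sup>+v. ennreal (norm (H v s)) \<partial>lborel \<partial>lborel)"
      by (subst lborel_pair.nn_integral_snd[symmetric]) simp_all
    also have "\<dots> = (\<integral>\<^sup>+s. ennreal (N s) * (\<integral>\<^sup>+v. ennreal (cmod (b v)) * indicator {0<..s} v \<partial>lborel) \<partial>lborel)"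
      by (intro nn_integral_cong, subst nn_integral_cmult[symmetric])
        (auto simp: H_def norm_mult N_nonneg indicator_def ennreal_mult' intro!: nn_integral_cong)
    also have "\<dots> = (\<integral>\<^sup>+v. ennreal (L v) * ennreal (cmod (b v)) * indicator {0<..} v \<partial>lborel)"
      by (rule nn_integral_N_mult[symmetric]) measurable
    also have "\<dots> \<le> (\<integral>\<^sup>+v. ennreal (2 / cmod z) * ennreal (L v) \<partial>lborel)"
    proof (rule nn_integral_mono)
      fix v
      have "L v * cmod (b v) \<le> 2 / cmod z * L v"
      proof -
        have "cmod (of_real (L v) * (1 - exp (- z * of_real v))) / cmod z \<le> 2 * L v / cmod z"
          using DD_integrand_bound[OF assms(1), of v] by (intro divide_right_mono) auto
        then show ?thesis using L_nonneg[of v] by (simp add: b_def norm_mult norm_divide)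
      qed
      then show "ennreal (L v) * ennreal (cmod (b v)) * indicator {0<..} v \<le> ennreal (2 / cmod z) * ennreal (L v)"
        using L_nonneg[of v] by (auto simp: indicator_def simp flip: ennreal_mult')
    qed
    also have "\<dots> < \<infinity>"
      using integrable_L L_nonneg by (auto simp: nn_integral_cmult nn_integral_eq_integral ennreal_mult_less_top)
    finally show "(\<integral>\<^sup>+p. ennreal (norm (case p of (v, s) \<Rightarrow> H v s)) \<partial>(lborel \<Otimes>\<^sub>M lborel)) < \<infinity>" .
  qed
  have inner_s: "(LINT s|lborel. H v s) = of_real (L v) * b v" for v
  proof (cases "v > 0")
    case True
    have "(LINT s|lborel. N s * indicator {v..} s) = L v"
    proof -
      have "(\<integral>\<^sup>+s. ennreal (N s * indicator {v..} s) \<partial>lborel) = ennreal (L v)"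
        using nn_integral_N[OF True] by (simp add: ennreal_mult' ennreal_indicator N_nonneg)
      then show ?thesis using N_nonneg L_nonneg by (subst integral_eq_nn_integral) auto
    qed
    moreover have "H v s = b v * of_real (N s * indicator {v..} s)" for s
      using True by (simp add: H_def indicator_def)
    ultimately show ?thesis by (simp only: integral_mult_right_zero integral_complex_of_real) simp
  next
    case False
    then show ?thesis by (simp add: H_def L_def)
  qed
  have inner_v: "(LINT v|lborel. H v s) = of_real (N s) * ((exp (- z * of_real s) - 1 + z * of_real s) / z\<^sup>2)" for s
  proof (cases "s > 0")
    case True
    define B where "B v = (of_real v + exp (- z * of_real v) / z) / z" for v :: real
    have "(LINT v|lborel. indicator {0..s} v *\<^sub>R b v) = B s - B 0"
    proof (rule integral_FTC_Icc)
      show "(B has_vector_derivative b x) (at x within {0..s})" for x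
      proof -
        have "((\<lambda>v. (v + exp (- z * v) / z) / z) has_field_derivative (1 - exp (- z * of_real x)) / z) (at (of_real x))"
          using assms(2) by (auto intro!: derivative_eq_intros simp: field_simps)
        from has_vector_derivative_real_field[OF this, of "{0..s}"] show ?thesis by (simp add: B_def[abs_def] b_def)
      qed
      show "continuous_on {0..s} b" unfolding b_def using assms(2) by (intro continuous_intros) auto
    qed (use True in auto)
    also have "(LINT v|lborel. indicator {0..s} v *\<^sub>R b v) = (LINT v|lborel. (if 0 < v \<and> v \<le> s then b v else 0))"
      by (rule Bochner_Integration.integral_cong) (auto simp: indicator_def b_def)
    also have "B s - B 0 = (exp (- z * of_real s) - 1 + z * of_real s) / z\<^sup>2"
      using assms(2) by (simp add: B_def field_simps power2_eq_square)
    finally show ?thesis by (simp add: H_def)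
  next
    case False
    then show ?thesis by (simp add: H_def N_def)
  qed
  have "DD z / z = (LINT v|lborel. of_real (L v) * b v)"
    unfolding DD_def b_def using assms(2) by (simp flip: integral_divide_zero)
  also have "\<dots> = (LINT v|lborel. LINT s|lborel. H v s)" by (simp add: inner_s)
  also have "\<dots> = (LINT s|lborel. LINT v|lborel. H v s)"
    using int by (rule lborel_pair.Fubini_integral[symmetric])
  finally show "DD z / z = (LINT s|lborel. of_real (N s) * ((exp (- z * of_real s) - 1 + z * of_real s) / z\<^sup>2))"
    by (simp add: inner_v)
  show "integrable lborel (\<lambda>s. of_real (N s) * ((exp (- z * of_real s) - 1 + z * of_real s) / z\<^sup>2))"
    using lborel_pair.integrable_snd[OF int] by (simp add: inner_v)
qed

lemma Re_of_real_mult: "Re (of_real a * q) = a * Re q"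
  by simp

text \<open>The scaling w = z s reduces every tent in the mixture to the unit tent.\<close>

lemma Re_DD_div_nonneg:
  assumes "Re z \<ge> 0"
  shows "Re (DD z / z) \<ge> 0"
proof (cases "z = 0")
  case False
  have "Re (DD z / z) = (LINT s|lborel. Re (of_real (N s) * ((exp (- z * of_real s) - 1 + z * of_real s) / z\<^sup>2)))"
    unfolding DD_div_eq[OF assms False] using DD_div_eq(2)[OF assms False] by (rule integral_Re[symmetric])
  moreover have "Re (of_real (N s) * ((exp (- z * of_real s) - 1 + z * of_real s) / z\<^sup>2)) \<ge> 0" for s
  proof (cases "s > 0")
    case True
    have "(exp (- z * of_real s) - 1 + z * of_real s) / z\<^sup>2 =
      of_real (s\<^sup>2) * ((exp (- (z * of_real s)) - 1 + z * of_real s) / (z * of_real s)\<^sup>2)"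
      using True by (simp add: power_mult_distrib)
    moreover have "Re ((exp (- (z * of_real s)) - 1 + z * of_real s) / (z * of_real s)\<^sup>2) \<ge> 0"
      using assms False True by (intro Re_tent_laplace_nonneg) auto
    ultimately have "Re ((exp (- z * of_real s) - 1 + z * of_real s) / z\<^sup>2) \<ge> 0"
      by (simp only: Re_complex_of_real times_complex.sel Im_complex_of_real) simp
    then show ?thesis using N_nonneg[of s] unfolding Re_of_real_mult by (rule mult_nonneg_nonneg[rotated])
  qed (simp add: N_def)
  ultimately show ?thesis by (metis (no_types, lifting) Bochner_Integration.integral_nonneg)
qed simp

text \<open>The fluctuation-dissipation relation: on the imaginary axis the real part of a tent
  transform is a Fejer kernel, so the spectral density of the forcing is the real part of the memory
  term.\<close>

lemma spec_eq:
  assumes "w \<noteq> 0"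
  shows "spec w = Re (DD (\<i> * of_real w) / (\<i> * of_real w))"
proof -
  define z where "z = \<i> * complex_of_real w"
  have z: "Re z \<ge> 0" "z \<noteq> 0" using assms by (auto simp: z_def)
  have "Re (DD z / z) = (LINT s|lborel. Re (of_real (N s) * ((exp (- z * of_real s) - 1 + z * of_real s) / z\<^sup>2)))"
    unfolding DD_div_eq[OF z] using DD_div_eq(2)[OF z] by (rule integral_Re[symmetric])
  also have "\<dots> = spec w"
    unfolding spec_def
  proof (rule Bochner_Integration.integral_cong)
    fix s
    have "(exp (- z * of_real s) - 1 + z * of_real s) / z\<^sup>2 =
      (1 - exp (- z * of_real s) - z * of_real s) / of_real (w\<^sup>2)"
      using assms by (simp add: z_def power_mult_distrib field_simps)
    then have "Re ((exp (- z * of_real s) - 1 + z * of_real s) / z\<^sup>2) = (1 - cos (w * s)) / w\<^sup>2"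
      by (simp only: Re_divide_of_real) (simp add: z_def Re_exp)
    then show "Re (of_real (N s) * ((exp (- z * of_real s) - 1 + z * of_real s) / z\<^sup>2)) = N s * ((1 - cos (w * s)) / w\<^sup>2)"
      unfolding Re_of_real_mult by (rule arg_cong)
  qed simp
  finally show ?thesis by (simp add: z_def)
qed

text \<open>On the half-plane of real parts at least \<delta> = Re z / 2 the factor v e^(-v Re x) is
  at most 1 / \<delta>, so a multiple of \<open>L\<close> dominates the difference quotients. This
  half-plane is convex, as the mean value bound requires, and is a neighbourhood of z.\<close>

lemma DD_field_derivative:
  assumes z: "Re z > 0"
  shows "\<exists>D. (DD has_field_derivative D) (at z)"
proof -
  define \<delta> where "\<delta> = Re z / 2"
  have \<delta>: "\<delta> > 0" "\<delta> < Re z" using z by (auto simp: \<delta>_def)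
  define S where "S = {w. Re w \<ge> \<delta>}"
  have cS: "convex S" unfolding S_def by (rule convex_halfspace_Re_ge)
  define F where "F w v = (of_real (L v) * (1 - exp (- w * of_real v)) - of_real (L v) * (1 - exp (- z * of_real v))) / (w - z)"
    for w :: complex and v :: real
  define G where "G v = of_real (L v) * (of_real v * exp (- z * of_real v))" for v :: real
  have deriv: "((\<lambda>w. of_real (L v) * (1 - exp (- w * of_real v))) has_field_derivative
      of_real (L v) * (of_real v * exp (- w * of_real v))) (at w within T)" for v :: real and w T
    by (auto intro!: derivative_eq_intros)
  have "((\<lambda>w. LINT v|lborel. F w v) \<longlongrightarrow> (LINT v|lborel. G v)) (at z within S)"
  proof (rule integral_tendsto_dominated_at[where w = "\<lambda>v. L v / \<delta>"])
    show "F w \<in> borel_measurable lborel" for w unfolding F_def by measurable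
    show "G \<in> borel_measurable lborel"
      unfolding G_def using measurable_exp_mult[of z] by measurable
    show "integrable lborel (\<lambda>v. L v / \<delta>)" using integrable_L by simp
    show "AE v in lborel. norm (F w v) \<le> L v / \<delta>" if w: "w \<in> S - {z}" for w
    proof (rule AE_I2)
      fix v
      show "norm (F w v) \<le> L v / \<delta>"
      proof (cases "v > 0")
        case True
        have "cmod (of_real (L v) * (1 - exp (- w * of_real v)) - of_real (L v) * (1 - exp (- z * of_real v)))
           \<le> (L v / \<delta>) * cmod (w - z)"
        proof (rule field_differentiable_bound[OF cS deriv])
          fix x assume x: "x \<in> S"
          have "v * exp (- (Re x * v)) \<le> 1 / \<delta>"
          proof -
            have "Re x * v \<ge> \<delta> * v" using x True by (intro mult_right_mono) (auto simp: S_def)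
            then have "exp (- (Re x * v)) \<le> exp (- (\<delta> * v))" by simp
            then have "v * exp (- (Re x * v)) \<le> v * exp (- (\<delta> * v))" using True by (intro mult_left_mono) auto
            also have "\<dots> \<le> 1 / \<delta>"
            proof -
              have "\<delta> * v \<le> exp (\<delta> * v)" using exp_ge_add_one_self[of "\<delta> * v"] by linarith
              then have "\<delta> * v * exp (- (\<delta> * v)) \<le> exp (\<delta> * v) * exp (- (\<delta> * v))" by (intro mult_right_mono) auto
              then show ?thesis using \<delta> by (simp add: field_simps flip: exp_add)
            qed
            finally show ?thesis .
          qed
          then have "L v * (v * exp (- (Re x * v))) \<le> L v * (1 / \<delta>)" using L_nonneg by (intro mult_left_mono) auto
          then show "cmod (of_real (L v) * (of_real v * exp (- x * of_real v))) \<le> L v / \<delta>"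
            using True L_nonneg[of v] by (simp add: norm_mult norm_exp_eq_Re)
        qed (use w \<delta> in \<open>auto simp: S_def\<close>)
        then show ?thesis using w by (simp add: F_def norm_divide pos_divide_le_eq)
      next
        case False
        then show ?thesis by (simp add: F_def L_def)
      qed
    qed
    show "AE v in lborel. ((\<lambda>w. F w v) \<longlongrightarrow> G v) (at z within S)"
      using deriv unfolding has_field_derivative_iff F_def G_def by (intro AE_I2) auto
  qed
  moreover have "\<forall>\<^sub>F w in at z within S. (LINT v|lborel. F w v) = (DD w - DD z) / (w - z)"
    unfolding eventually_at_filter
  proof (rule always_eventually, clarify)
    fix w assume "w \<in> S"
    then have "Re w \<ge> 0" using \<delta> by (auto simp: S_def)
    then show "(LINT v|lborel. F w v) = (DD w - DD z) / (w - z)"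
      unfolding F_def DD_def using DD_integrable[of w] DD_integrable[of z] z by simp
  qed
  ultimately have "((\<lambda>w. (DD w - DD z) / (w - z)) \<longlongrightarrow> (LINT v|lborel. G v)) (at z within S)"
    by (rule Lim_transform_eventually)
  \<comment> \<open>Restricting the limit to the half-plane loses nothing, as z is an interior
    point.\<close>
  moreover have "at z within S = at z"
  proof (rule at_within_interior)
    have "open {w. \<delta> < Re w}" by (rule open_halfspace_Re_gt)
    then have "{w. \<delta> < Re w} \<subseteq> interior S" by (intro interior_maximal) (auto simp: S_def)
    then show "z \<in> interior S" using \<delta> by blast
  qed
  ultimately show ?thesis by (auto simp: has_field_derivative_iff)
qed

lemma DD_tendsto_boundary:
  "((\<lambda>x. DD (of_real x + \<i> * of_real w)) \<longlongrightarrow> DD (\<i> * of_real w)) (at 0 within {0..})"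
  unfolding DD_def
proof (rule integral_tendsto_dominated_at[where w = "\<lambda>v. 2 * L v"])
  show "integrable lborel (\<lambda>v. 2 * L v)" using integrable_L by simp
  show "AE v in lborel. norm (of_real (L v) * (1 - exp (- (of_real x + \<i> * of_real w) * of_real v))) \<le> 2 * L v"
    if "x \<in> {0..} - {0}" for x
    using that by (intro AE_I2 DD_integrand_bound) auto
  show "AE v in lborel. ((\<lambda>x. of_real (L v) * (1 - exp (- (of_real x + \<i> * of_real w) * of_real v))) \<longlongrightarrow>
      of_real (L v) * (1 - exp (- (\<i> * of_real w) * of_real v))) (at 0 within {0..})"
    by (intro AE_I2 tendsto_eq_intros) (auto intro!: tendsto_eq_intros)
qed measurable


lemma DD_measurable [measurable]: "DD \<in> borel_measurable borel"
proof -
  have "(\<lambda>p::complex \<times> real. exp (- fst p * of_real (snd p))) \<in> borel_measurable borel"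
    by (intro borel_measurable_continuous_onI continuous_intros)
  moreover have "sets (borel \<Otimes>\<^sub>M (lborel::real measure)) = sets (borel::(complex \<times> real) measure)"
    by (subst borel_prod[symmetric], rule sets_pair_measure_cong) auto
  ultimately have [measurable]: "(\<lambda>p::complex \<times> real. exp (- fst p * of_real (snd p))) \<in> borel_measurable (borel \<Otimes>\<^sub>M lborel)"
    using measurable_cong_sets by blast
  show ?thesis
    unfolding DD_def
    by (rule sigma_finite_measure.borel_measurable_lebesgue_integral[OF sigma_finite_lborel])
       (simp add: case_prod_beta')
qed

section \<open>Integrals of the real part over vertical lines\<close>

lemma quotient_eq_inverse:
  assumes "z \<noteq> 0"
  shows "z / (z\<^sup>2 + of_real \<alpha> * DD z) = inverse (z + of_real \<alpha> * (DD z / z))"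
    and "z\<^sup>2 + of_real \<alpha> * DD z = z * (z + of_real \<alpha> * (DD z / z))"
proof -
  show eq: "z\<^sup>2 + of_real \<alpha> * DD z = z * (z + of_real \<alpha> * (DD z / z))"
    using assms by (simp add: power2_eq_square field_simps)
  show "z / (z\<^sup>2 + of_real \<alpha> * DD z) = inverse (z + of_real \<alpha> * (DD z / z))"
    unfolding eq using assms by (simp add: inverse_eq_divide)
qed

lemma Re_denominator:
  assumes "\<alpha> > 0" "Re z \<ge> 0"
  shows "Re (z + of_real \<alpha> * (DD z / z)) \<ge> Re z"
proof -
  have "\<alpha> * Re (DD z / z) \<ge> 0" using Re_DD_div_nonneg[OF assms(2)] assms(1) by (intro mult_nonneg_nonneg) auto
  then show ?thesis unfolding plus_complex.sel Re_of_real_mult by linarith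
qed

lemma Re_quotient_nonneg:
  assumes "\<alpha> > 0" "Re z \<ge> 0"
  shows "Re (z / (z\<^sup>2 + of_real \<alpha> * DD z)) \<ge> 0"
proof (cases "z = 0")
  case False
  have "Re (z + of_real \<alpha> * (DD z / z)) \<ge> 0" using Re_denominator[OF assms] assms(2) by linarith
  then show ?thesis unfolding quotient_eq_inverse(1)[OF False] by (simp only: inverse_complex.sel) simp
qed simp

text \<open>With h = 1/z + q, the first term contributes at most pi through an arctangent. The
  integral of q over the vertical segment is moved to the other three sides of a rectangle of width
  R and height 2 R, on which |q| is at most 1/R; their total length 4 R gives the 4. The bound
  depends on neither \<alpha> nor x nor R.\<close>

lemma nn_integral_Re_quotient:
  assumes \<alpha>: "\<alpha> > 0" and x: "x > 0" and R: "R > 0" "R\<^sup>2 \<ge> 4 * \<alpha> * K 0"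
  defines "h \<equiv> \<lambda>z. z / (z\<^sup>2 + of_real \<alpha> * DD z)"
  shows "(\<integral>\<^sup>+w. ennreal (Re (h (Complex x w))) * indicator {-R..R} w \<partial>lborel) \<le> ennreal (pi + 4)"
proof -
  define S where "S = {z. Re z > 0}"
  have S: "open S" "convex S"
    by (auto simp: S_def open_halfspace_Re_gt convex_halfspace_Re_gt)
  have nz: "z\<^sup>2 + of_real \<alpha> * DD z \<noteq> 0" "z \<noteq> 0" if "z \<in> S" for z
  proof -
    show z0: "z \<noteq> 0" using that by (auto simp: S_def)
    have "Re (z + of_real \<alpha> * (DD z / z)) > 0" using Re_denominator[OF \<alpha>, of z] that by (simp add: S_def)
    then have "z + of_real \<alpha> * (DD z / z) \<noteq> 0" by (metis less_irrefl zero_complex.sel(1))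
    then show "z\<^sup>2 + of_real \<alpha> * DD z \<noteq> 0" unfolding quotient_eq_inverse(2)[OF z0] using z0 by simp
  qed
  define q where "q z = h z - 1 / z" for z
  have "DD holomorphic_on S"
    unfolding holomorphic_on_def field_differentiable_def S_def
    using DD_field_derivative has_field_derivative_at_within by blast
  then have "q holomorphic_on S"
    unfolding q_def[abs_def] h_def by (intro holomorphic_intros) (simp_all only: nz not_False_eq_True)
  then obtain Q where Q: "\<And>z. z \<in> S \<Longrightarrow> (Q has_field_derivative q z) (at z)"
    using holomorphic_convex_primitive'[of S q] S by (metis at_within_open)
  \<comment> \<open>Since |DD| is at most 2 K(0), the choice of R makes \<alpha> |DD| at most R^2 /
    2, so the denominator z^2 + \<alpha> DD has modulus at least R^2 / 2.\<close>
  have q_bound: "cmod (q z) \<le> 1 / R" if z: "z \<in> S" "cmod z \<ge> R" for z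
  proof -
    have "q z = - of_real \<alpha> * DD z / (z * (z\<^sup>2 + of_real \<alpha> * DD z))"
      using nz[OF z(1)] by (simp add: q_def h_def field_simps power2_eq_square)
    then have q: "cmod (q z) = \<alpha> * cmod (DD z) / (cmod z * cmod (z\<^sup>2 + of_real \<alpha> * DD z))"
      using \<alpha> by (simp add: norm_mult norm_divide)
    have D: "\<alpha> * cmod (DD z) \<le> R\<^sup>2 / 2"
    proof -
      have "\<alpha> * cmod (DD z) \<le> \<alpha> * (2 * K 0)" using DD_bound[of z] z \<alpha> by (intro mult_left_mono) (auto simp: S_def)
      then show ?thesis using R by simp
    qed
    have zR: "R\<^sup>2 \<le> (cmod z)\<^sup>2" using z R by (intro power_mono) auto
    have "cmod (z\<^sup>2 + of_real \<alpha> * DD z) \<ge> cmod (z\<^sup>2) - cmod (of_real \<alpha> * DD z)" by norm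
    then have "cmod (z\<^sup>2 + of_real \<alpha> * DD z) \<ge> R\<^sup>2 / 2" using D zR \<alpha> by (simp add: norm_mult norm_power)
    then have "R * (R\<^sup>2 / 2) \<le> cmod z * cmod (z\<^sup>2 + of_real \<alpha> * DD z)" using z R by (intro mult_mono) auto
    then have "cmod (q z) \<le> (R\<^sup>2 / 2) / (R * (R\<^sup>2 / 2))"
      unfolding q using D R by (intro frac_le) auto
    also have "\<dots> = 1 / R" using R by simp
    finally show ?thesis .
  qed
  have Qdiff: "cmod (Q a - Q b) \<le> 1 / R * cmod (a - b)"
    if "closed_segment a b \<subseteq> S \<inter> {z. cmod z \<ge> R}" for a b
    by (rule field_differentiable_bound[of "closed_segment a b" Q q])
      (use that q_bound Q in \<open>auto intro: has_field_derivative_at_within\<close>)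
  define X where "X = x + R"
  \<comment> \<open>Each of the three remaining sides has one coordinate of modulus at least R, so
    it lies outside the disc where \<open>q_bound\<close> fails to apply.\<close>
  have norm_ge: "R \<le> cmod z" if "R \<le> \<bar>Im z\<bar> \<or> R \<le> \<bar>Re z\<bar>" for z
    using that abs_Im_le_cmod[of z] abs_Re_le_cmod[of z] by linarith
  have seg: "z \<in> S \<inter> {z. cmod z \<ge> R}" if z: "z \<in> closed_segment (Complex a b) (Complex c d)"
    and ab: "a > 0" "c > 0" "(b = d \<and> \<bar>b\<bar> = R) \<or> (a = c \<and> a \<ge> R)" for a b c d z
  proof -
    obtain u where u: "0 \<le> u" "u \<le> 1" "z = (1 - u) *\<^sub>R Complex a b + u *\<^sub>R Complex c d"
      using z by (auto simp: in_segment)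
    then have re: "Re z = (1 - u) * a + u * c" and im: "Im z = (1 - u) * b + u * d" by auto
    have "Re z > 0"
    proof (cases "u = 0")
      case False
      then show ?thesis unfolding re using u ab by (intro add_nonneg_pos mult_nonneg_nonneg mult_pos_pos) auto
    qed (use re ab in simp)
    moreover have "R \<le> \<bar>Im z\<bar> \<or> R \<le> \<bar>Re z\<bar>"
      using ab(3) unfolding re im by (auto simp: algebra_simps)
    ultimately show ?thesis using norm_ge by (simp add: S_def)
  qed
  have c1: "cmod (Complex a b - Complex c b) = \<bar>a - c\<bar>" "cmod (Complex b a - Complex b c) = \<bar>a - c\<bar>" for a b c
    by (simp_all add: cmod_def)
  have segs: "closed_segment (Complex a b) (Complex c d) \<subseteq> S \<inter> {z. cmod z \<ge> R}"
    if "a > 0" "c > 0" "(b = d \<and> \<bar>b\<bar> = R) \<or> (a = c \<and> a \<ge> R)" for a b c d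
    using seg that by blast
  have "cmod (Q (Complex x R) - Q (Complex X R)) \<le> 1 / R * cmod (Complex x R - Complex X R)"
    by (intro Qdiff segs) (use x R in \<open>auto simp: X_def\<close>)
  moreover have "cmod (Q (Complex X R) - Q (Complex X (-R))) \<le> 1 / R * cmod (Complex X R - Complex X (-R))"
    by (intro Qdiff segs) (use x R in \<open>auto simp: X_def\<close>)
  moreover have "cmod (Q (Complex X (-R)) - Q (Complex x (-R))) \<le> 1 / R * cmod (Complex X (-R) - Complex x (-R))"
    by (intro Qdiff segs) (use x R in \<open>auto simp: X_def\<close>)
  ultimately have Qs: "cmod (Q (Complex x R) - Q (Complex X R)) \<le> 1"
    "cmod (Q (Complex X R) - Q (Complex X (-R))) \<le> 2"
    "cmod (Q (Complex X (-R)) - Q (Complex x (-R))) \<le> 1"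
    using R x unfolding c1 by (simp_all add: X_def)
  have "cmod (Q (Complex x R) - Q (Complex x (-R))) \<le> cmod (Q (Complex x R) - Q (Complex X R)) +
     cmod (Q (Complex X R) - Q (Complex X (-R))) + cmod (Q (Complex X (-R)) - Q (Complex x (-R)))"
    by norm
  then have "cmod (Q (Complex x R) - Q (Complex x (-R))) \<le> 4" using Qs by linarith
  then have Q4: "Im (Q (Complex x R)) - Im (Q (Complex x (-R))) \<le> 4"
    using abs_Im_le_cmod[of "Q (Complex x R) - Q (Complex x (-R))"] by simp
  \<comment> \<open>Along the line dz = i dw, so the derivative of Im Q is Re q; the arctangent is
    the primitive of Re (1/z).\<close>
  define F where "F w = Im (Q (Complex x w)) + arctan (w / x)" for w
  have "(\<integral>\<^sup>+w. ennreal (Re (h (Complex x w))) * indicator {-R..R} w \<partial>lborel) = F R - F (-R)"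
  proof (rule nn_integral_FTC_Icc)
    have [measurable]: "Complex x \<in> borel_measurable borel"
      by (rule borel_measurable_continuous_onI) (auto simp: Complex_eq intro!: continuous_intros)
    show "(\<lambda>w. Re (h (Complex x w))) \<in> borel_measurable borel"
      unfolding h_def by measurable
    show "0 \<le> Re (h (Complex x w))" for w
      unfolding h_def using x \<alpha> by (intro Re_quotient_nonneg) auto
    show "-R \<le> R" using R by simp
    show "(F has_real_derivative Re (h (Complex x w))) (at w)" for w
    proof -
      have inS: "Complex x w \<in> S" using x by (simp add: S_def)
      have "((\<lambda>u. Complex x u) has_vector_derivative \<i>) (at w)"
        unfolding has_vector_derivative_def
        by (auto simp: Complex_eq[abs_def] intro!: derivative_eq_intros) (simp add: scaleR_conv_of_real mult.commute)
      then have "((Q \<circ> Complex x) has_vector_derivative \<i> * q (Complex x w)) (at w)"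
        using Q[OF inS] by (rule field_vector_diff_chain_at)
      from bounded_linear.has_vector_derivative[OF bounded_linear_Im this]
      have 1: "((\<lambda>u. Im (Q (Complex x u))) has_real_derivative Re (q (Complex x w))) (at w)"
        by (simp add: has_real_derivative_iff_has_vector_derivative comp_def)
      have 2: "((\<lambda>u. arctan (u / x)) has_real_derivative x / (x\<^sup>2 + w\<^sup>2)) (at w)"
        using x by (auto intro!: derivative_eq_intros simp: field_simps power2_eq_square)
      have "Re (1 / Complex x w) = x / (x\<^sup>2 + w\<^sup>2)" by (simp add: Re_divide power2_eq_square)
      then have "Re (h (Complex x w)) = Re (q (Complex x w)) + x / (x\<^sup>2 + w\<^sup>2)" by (simp add: q_def)
      then show ?thesis unfolding F_def using DERIV_add[OF 1 2] by simp
    qed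
  qed
  also have "\<dots> \<le> ennreal (pi + 4)"
  proof (rule ennreal_leI)
    have "arctan (R / x) - arctan (- R / x) \<le> pi"
      using arctan_ubound[of "R / x"] arctan_lbound[of "- R / x"] by linarith
    then show "F R - F (-R) \<le> pi + 4" using Q4 by (simp add: F_def)
  qed
  finally show ?thesis .
qed

text \<open>Nonnegativity of Re h allows Fatou's lemma as the line tends to the imaginary axis and
  the height R to infinity. The integrand converges at every w other than 0, since there the
  denominator z + \<alpha> DD(z)/z has the positive real part \<alpha>
  \<open>spec w\<close>.\<close>

lemma nn_integral_Re_quotient_boundary:
  assumes \<alpha>: "\<alpha> > 0"
  shows "(\<integral>\<^sup>+w. ennreal (Re (\<i> * of_real w / ((\<i> * of_real w)\<^sup>2 + of_real \<alpha> * DD (\<i> * of_real w)))) \<partial>lborel) \<le> ennreal (pi + 4)"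
proof -
  define h where "h z = z / (z\<^sup>2 + of_real \<alpha> * DD z)" for z
  define R where "R n = sqrt (4 * \<alpha> * K 0) + real n + 1" for n :: nat
  define x where "x n = inverse (real (Suc n))" for n
  have R: "R n > 0" "(R n)\<^sup>2 \<ge> 4 * \<alpha> * K 0" for n
  proof -
    have "sqrt (4 * \<alpha> * K 0) \<ge> 0" using \<alpha> K0_pos by simp
    then show "R n > 0" unfolding R_def by linarith
    have "(sqrt (4 * \<alpha> * K 0))\<^sup>2 \<le> (R n)\<^sup>2" unfolding R_def using \<open>sqrt (4 * \<alpha> * K 0) \<ge> 0\<close> by (intro power_mono) auto
    then show "(R n)\<^sup>2 \<ge> 4 * \<alpha> * K 0" using \<alpha> K0_pos by simp
  qed
  have x: "x n > 0" for n by (simp add: x_def)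
  have x_lim: "x \<longlonglongrightarrow> 0" unfolding x_def[abs_def] by (rule LIMSEQ_inverse_real_of_nat)
  have [measurable]: "(\<lambda>w. Complex a w) \<in> borel_measurable borel" for a
    by (rule borel_measurable_continuous_onI) (auto simp: Complex_eq intro!: continuous_intros)
  define g where "g n w = ennreal (Re (h (Complex (x n) w))) * indicator {- R n..R n} w" for n w
  have [measurable]: "g n \<in> borel_measurable borel" for n unfolding g_def h_def by measurable
  have "(\<integral>\<^sup>+w. ennreal (Re (h (\<i> * of_real w))) \<partial>lborel) \<le> (\<integral>\<^sup>+w. liminf (\<lambda>n. g n w) \<partial>lborel)"
  proof (rule nn_integral_mono_AE)
    show "AE w in lborel. ennreal (Re (h (\<i> * of_real w))) \<le> liminf (\<lambda>n. g n w)"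
      using AE_neq_0
    proof eventually_elim
      fix w :: real assume w: "w \<noteq> 0"
      define z where "z = \<i> * complex_of_real w"
      have z: "z \<noteq> 0" "Re z \<ge> 0" using w by (auto simp: z_def)
      have "Re (z + of_real \<alpha> * (DD z / z)) = \<alpha> * spec w"
        unfolding spec_eq[OF w] z_def[symmetric] plus_complex.sel Re_of_real_mult by (simp add: z_def)
      then have "Re (z + of_real \<alpha> * (DD z / z)) > 0" using spec_pos[OF w] \<alpha> by simp
      then have "z + of_real \<alpha> * (DD z / z) \<noteq> 0" by (metis less_irrefl zero_complex.sel(1))
      then have nz: "z\<^sup>2 + of_real \<alpha> * DD z \<noteq> 0" unfolding quotient_eq_inverse(2)[OF z(1)] using z by simp
      have cx: "Complex a w = of_real a + z" for a by (simp add: z_def Complex_eq)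
      have "(\<lambda>n. DD (of_real (x n) + z)) \<longlonglongrightarrow> DD z"
        using DD_tendsto_boundary[of w] x x_lim less_imp_le[OF x] less_imp_neq[OF x]
        unfolding tendsto_at_iff_sequentially z_def[symmetric] comp_def
        by (metis (no_types, lifting) DiffI atLeast_iff singletonD)
      then have "(\<lambda>n. h (of_real (x n) + z)) \<longlonglongrightarrow> (of_real 0 + z) / ((of_real 0 + z)\<^sup>2 + of_real \<alpha> * DD z)"
        unfolding h_def using x_lim nz by (intro tendsto_intros) auto
      then have lim1: "(\<lambda>n. ennreal (Re (h (of_real (x n) + z)))) \<longlonglongrightarrow> ennreal (Re (h z))"
        by (intro tendsto_ennrealI tendsto_Re) (simp add: h_def)
      have "(\<lambda>n. g n w) \<longlonglongrightarrow> ennreal (Re (h z))"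
      proof (rule Lim_transform_eventually[OF lim1])
        obtain m :: nat where m: "\<bar>w\<bar> \<le> m" using real_arch_simple by blast
        show "\<forall>\<^sub>F n in sequentially. ennreal (Re (h (of_real (x n) + z))) = g n w"
          using eventually_ge_at_top[of m]
        proof eventually_elim
          fix n assume "m \<le> n"
          then have "real m \<le> real n" by simp
          moreover have "sqrt (4 * \<alpha> * K 0) \<ge> 0" using \<alpha> K0_pos by simp
          ultimately have "\<bar>w\<bar> \<le> R n" using m unfolding R_def by linarith
          then have "w \<in> {- R n..R n}" by (simp add: abs_le_iff)
          then show "ennreal (Re (h (of_real (x n) + z))) = g n w" by (simp add: g_def cx)
        qed
      qed
      then show "ennreal (Re (h (\<i> * of_real w))) \<le> liminf (\<lambda>n. g n w)"
        by (simp add: z_def lim_imp_Liminf)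
    qed
  qed
  also have "\<dots> \<le> liminf (\<lambda>n. \<integral>\<^sup>+w. g n w \<partial>lborel)"
    by (rule nn_integral_liminf) simp
  also have "\<dots> \<le> liminf (\<lambda>n. ennreal (pi + 4))"
    unfolding g_def h_def using nn_integral_Re_quotient[OF \<alpha> x R]
    by (intro Liminf_mono always_eventually allI) auto
  also have "\<dots> = ennreal (pi + 4)" by (intro lim_imp_Liminf) auto
  finally show ?thesis by (simp add: h_def)
qed

section \<open>The density of a mode and its moments\<close>

definition dens :: "real \<Rightarrow> real \<Rightarrow> real" where
  "dens \<alpha> w = spec w * w\<^sup>2 / (cmod (of_real (w\<^sup>2) - of_real \<alpha> * DD (\<i> * of_real w)))\<^sup>2"

lemma dens_nonneg: "dens \<alpha> w \<ge> 0"
  by (simp add: dens_def spec_nonneg)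

lemma dens_measurable [measurable]: "dens \<alpha> \<in> borel_measurable borel"
proof -
  have [measurable]: "(\<lambda>w. \<i> * complex_of_real w) \<in> borel_measurable borel" by measurable
  show ?thesis unfolding dens_def by measurable
qed

text \<open>With k = z + \<alpha> DD(z)/z one has Re (1/k) = Re k / |k|^2 and Re k = \<alpha>
  \<open>spec w\<close>, so the density \<open>spec w\<close> / |k|^2 is Re (1/k) / \<alpha>. The
  factor w^2 in \<open>dens\<close> is |z|^2, from clearing the division by z.\<close>

lemma dens_denominator:
  assumes "\<alpha> > 0" "w \<noteq> 0"
  shows "of_real (w\<^sup>2) - of_real \<alpha> * DD (\<i> * of_real w) \<noteq> 0"
    and "\<alpha> * dens \<alpha> w = Re (\<i> * of_real w / ((\<i> * of_real w)\<^sup>2 + of_real \<alpha> * DD (\<i> * of_real w)))"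
proof -
  define z where "z = \<i> * complex_of_real w"
  have z: "z \<noteq> 0" using assms by (auto simp: z_def)
  define k where "k = z + of_real \<alpha> * (DD z / z)"
  have Rk: "Re k = \<alpha> * spec w"
    unfolding k_def spec_eq[OF assms(2)] z_def[symmetric] plus_complex.sel Re_of_real_mult by (simp add: z_def)
  then have "Re k > 0" using spec_pos[OF assms(2)] assms by simp
  then have k0: "k \<noteq> 0" by auto
  have P: "of_real (w\<^sup>2) - of_real \<alpha> * DD z = - (z * k)"
    using quotient_eq_inverse(2)[OF z, of \<alpha>] by (simp add: k_def z_def power_mult_distrib algebra_simps)
  then show "of_real (w\<^sup>2) - of_real \<alpha> * DD (\<i> * of_real w) \<noteq> 0"
    using z k0 by (simp add: z_def)
  have "cmod z = \<bar>w\<bar>" by (simp add: z_def norm_mult)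
  then have c: "(cmod (of_real (w\<^sup>2) - of_real \<alpha> * DD z))\<^sup>2 = w\<^sup>2 * (cmod k)\<^sup>2"
    unfolding P by (simp add: norm_mult power_mult_distrib)
  have "Re (z / (z\<^sup>2 + of_real \<alpha> * DD z)) = Re (inverse k)"
    unfolding quotient_eq_inverse(1)[OF z] k_def ..
  also have "\<dots> = \<alpha> * spec w / (cmod k)\<^sup>2"
    by (simp add: Rk cmod_power2)
  also have "\<dots> = \<alpha> * dens \<alpha> w"
    unfolding dens_def z_def[symmetric] c using assms(2) by simp
  finally show "\<alpha> * dens \<alpha> w = Re (\<i> * of_real w / ((\<i> * of_real w)\<^sup>2 + of_real \<alpha> * DD (\<i> * of_real w)))"
    by (simp add: z_def)
qed

lemma nn_integral_dens:
  assumes "\<alpha> > 0"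
  shows "(\<integral>\<^sup>+w. ennreal (dens \<alpha> w) \<partial>lborel) \<le> ennreal ((pi + 4) / \<alpha>)"
proof -
  have "(\<integral>\<^sup>+w. ennreal (dens \<alpha> w) \<partial>lborel) =
    (\<integral>\<^sup>+w. ennreal (1 / \<alpha>) * ennreal (Re (\<i> * of_real w / ((\<i> * of_real w)\<^sup>2 + of_real \<alpha> * DD (\<i> * of_real w)))) \<partial>lborel)"
    using AE_neq_0
  proof (intro nn_integral_cong_AE, eventually_elim)
    fix w :: real assume "w \<noteq> 0"
    from dens_denominator(2)[OF assms this, symmetric] show "ennreal (dens \<alpha> w) = ennreal (1 / \<alpha>) *
       ennreal (Re (\<i> * of_real w / ((\<i> * of_real w)\<^sup>2 + of_real \<alpha> * DD (\<i> * of_real w))))"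
      using assms dens_nonneg by (simp flip: ennreal_mult')
  qed
  also have "\<dots> = ennreal (1 / \<alpha>) * (\<integral>\<^sup>+w. ennreal (Re (\<i> * of_real w / ((\<i> * of_real w)\<^sup>2 + of_real \<alpha> * DD (\<i> * of_real w)))) \<partial>lborel)"
    by (rule nn_integral_cmult) measurable
  also have "\<dots> \<le> ennreal (1 / \<alpha>) * ennreal (pi + 4)"
    using nn_integral_Re_quotient_boundary[OF assms] by (rule mult_left_mono) simp
  also have "\<dots> = ennreal (1 / \<alpha> * (pi + 4))" using assms by (intro ennreal_mult'[symmetric]) simp
  also have "1 / \<alpha> * (pi + 4) = (pi + 4) / \<alpha>" by simp
  finally show ?thesis .
qed

text \<open>Below frequency \<open>2 (\<alpha> K(0))\<^sup>1\<^sup>/\<^sup>2\<close> the bound on the total mass is enough; above it the memory term is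
  dominated by the frequency.\<close>

lemma nn_integral_dens_square:
  assumes \<alpha>: "\<alpha> > 0"
  shows "(\<integral>\<^sup>+w. ennreal (w\<^sup>2 * dens \<alpha> w) \<partial>lborel) \<le> ennreal (4 * K 0 * (pi + 4) + 4 * fejer_const * K 0)"
proof -
  have pw: "w\<^sup>2 * dens \<alpha> w \<le> 4 * \<alpha> * K 0 * dens \<alpha> w + 4 * spec w" for w
  proof (cases "w\<^sup>2 \<le> 4 * \<alpha> * K 0")
    case True
    then have "w\<^sup>2 * dens \<alpha> w \<le> 4 * \<alpha> * K 0 * dens \<alpha> w" using dens_nonneg by (intro mult_right_mono)
    then show ?thesis using spec_nonneg[of w] by simp
  next
    case False
    define P where "P = cmod (of_real (w\<^sup>2) - of_real \<alpha> * DD (\<i> * of_real w))"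
    have "0 < 4 * \<alpha> * K 0" using \<alpha> K0_pos by simp
    then have w: "w\<^sup>2 > 0" using False by linarith
    have "cmod (of_real (w\<^sup>2)) - cmod (of_real \<alpha> * DD (\<i> * of_real w)) \<le> P" unfolding P_def by norm
    moreover have "cmod (of_real \<alpha> * DD (\<i> * of_real w)) \<le> \<alpha> * (2 * K 0)"
      using DD_bound[of "\<i> * of_real w"] \<alpha> by (simp add: norm_mult)
    moreover have "cmod (of_real (w\<^sup>2)) = w\<^sup>2" by (simp add: norm_power)
    \<comment> \<open>The memory term is at most 2 \<alpha> K(0), which in this case is less than
      half of w^2.\<close>
    ultimately have P: "w\<^sup>2 / 2 \<le> P" using False by linarith
    have "(w\<^sup>2)\<^sup>2 \<le> 4 * P\<^sup>2"
      using power_mono[OF P, of 2] w by (simp add: power_divide)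
    then have "(w\<^sup>2)\<^sup>2 / P\<^sup>2 \<le> 4" using P w by (simp add: divide_le_eq)
    then have "spec w * ((w\<^sup>2)\<^sup>2 / P\<^sup>2) \<le> spec w * 4" using spec_nonneg by (intro mult_left_mono)
    moreover have "w\<^sup>2 * dens \<alpha> w = spec w * ((w\<^sup>2)\<^sup>2 / P\<^sup>2)"
      unfolding dens_def P_def by (simp add: power2_eq_square)
    moreover have "4 * \<alpha> * K 0 * dens \<alpha> w \<ge> 0" using dens_nonneg \<open>0 < 4 * \<alpha> * K 0\<close> by simp
    ultimately show ?thesis by linarith
  qed
  have nK: "4 * \<alpha> * K 0 \<ge> 0" using \<alpha> K0_pos by simp
  have "(\<integral>\<^sup>+w. ennreal (w\<^sup>2 * dens \<alpha> w) \<partial>lborel) \<le> (\<integral>\<^sup>+w. ennreal (4 * \<alpha> * K 0) * ennreal (dens \<alpha> w) + ennreal (4 * spec w) \<partial>lborel)"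
    using pw nK dens_nonneg spec_nonneg
    by (intro nn_integral_mono) (simp add: ennreal_leI flip: ennreal_mult' ennreal_plus)
  also have "\<dots> = ennreal (4 * \<alpha> * K 0) * (\<integral>\<^sup>+w. ennreal (dens \<alpha> w) \<partial>lborel) + (\<integral>\<^sup>+w. ennreal (4 * spec w) \<partial>lborel)"
    by (simp add: nn_integral_add nn_integral_cmult)
  also have "(\<integral>\<^sup>+w. ennreal (4 * spec w) \<partial>lborel) = ennreal (4 * (fejer_const * K 0))"
    using integral_spec_cos[of 0] integrable_spec spec_nonneg by (subst nn_integral_eq_integral) auto
  also have "ennreal (4 * \<alpha> * K 0) * (\<integral>\<^sup>+w. ennreal (dens \<alpha> w) \<partial>lborel) \<le> ennreal (4 * \<alpha> * K 0) * ennreal ((pi + 4) / \<alpha>)"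
    using nn_integral_dens[OF \<alpha>] by (rule mult_left_mono) simp
  also have "\<dots> = ennreal (4 * \<alpha> * K 0 * ((pi + 4) / \<alpha>))" using nK by (intro ennreal_mult'[symmetric])
  also have "4 * \<alpha> * K 0 * ((pi + 4) / \<alpha>) = 4 * K 0 * (pi + 4)" using \<alpha> by simp
  finally show ?thesis
    using K0_pos fejer_const_pos by (simp add: mult.assoc flip: ennreal_plus)
qed

end

section \<open>Spectral measure of a mode\<close>

text \<open>Levy's uniqueness theorem is about probability laws, so both weighted measures are
  divided by their total mass, which is common to them by the hypothesis at s = 0, and rescaled
  afterwards.\<close>

lemma density_eqI_fourier:
  fixes M1 M2 :: "real measure" and f1 f2 :: "real \<Rightarrow> real"
  assumes sets: "sets M1 = sets borel" "sets M2 = sets borel"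
    and f1: "f1 \<in> borel_measurable borel" "\<And>x. f1 x \<ge> 0" "integrable M1 f1"
    and f2: "f2 \<in> borel_measurable borel" "\<And>x. f2 x \<ge> 0" "integrable M2 f2"
    and pos: "(LINT x|M2. f2 x) > 0"
    and eq: "\<And>s. (LINT x|M1. of_real (f1 x) * iexp (s * x)) = (LINT x|M2. of_real (f2 x) * iexp (s * x))"
  shows "density M1 (\<lambda>x. ennreal (f1 x)) = density M2 (\<lambda>x. ennreal (f2 x))"
proof -
  define m where "m = (LINT x|M2. f2 x)"
  have m: "m > 0" using pos by (simp add: m_def)
  have "complex_of_real (LINT x|M1. f1 x) = complex_of_real (LINT x|M2. f2 x)"
    using eq[of 0] by simp
  then have m1: "m = (LINT x|M1. f1 x)" unfolding m_def of_real_eq_iff by simp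
  have rd: "real_distribution (density M (\<lambda>x. ennreal (f x / m)))"
    if M: "sets M = sets borel" and f: "f \<in> borel_measurable borel" "\<And>x. f x \<ge> 0" "integrable M f" and mf: "m = (LINT x|M. f x)"
    for M :: "real measure" and f :: "real \<Rightarrow> real"
  proof -
    have meas: "f \<in> borel_measurable M" using f(1) measurable_cong_sets[OF M refl] by blast
    have "prob_space (density M (\<lambda>x. ennreal (f x / m)))"
    proof (rule prob_spaceI)
      have "emeasure (density M (\<lambda>x. ennreal (f x / m))) (space (density M (\<lambda>x. ennreal (f x / m)))) = (\<integral>\<^sup>+x. ennreal (f x / m) \<partial>M)"
        using meas by (subst emeasure_density) (auto intro!: nn_integral_cong)
      also have "\<dots> = ennreal (LINT x|M. f x / m)"
        using f m by (intro nn_integral_eq_integral) auto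
      also have "(LINT x|M. f x / m) = 1" using mf m by simp
      finally show "emeasure (density M (\<lambda>x. ennreal (f x / m))) (space (density M (\<lambda>x. ennreal (f x / m)))) = 1" by simp
    qed
    then show ?thesis
      using M by (simp add: real_distribution_def real_distribution_axioms_def)
  qed
  have ch: "char (density M (\<lambda>x. ennreal (f x / m))) t = (LINT x|M. of_real (f x) * iexp (t * x)) / of_real m"
    if M: "sets M = sets borel" and f: "f \<in> borel_measurable borel" "\<And>x. f x \<ge> 0"
    for M :: "real measure" and f :: "real \<Rightarrow> real" and t
  proof -
    have meas: "f \<in> borel_measurable M" using f(1) measurable_cong_sets[OF M refl] by blast
    have "iexp \<in> borel_measurable borel" by (intro borel_measurable_continuous_onI continuous_intros)
    then have "(\<lambda>x. iexp (t * x)) \<in> borel_measurable borel" by measurable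
    then have meas2: "(\<lambda>x. iexp (t * x)) \<in> borel_measurable M" using measurable_cong_sets[OF M refl] by blast
    have "char (density M (\<lambda>x. ennreal (f x / m))) t = (LINT x|M. (f x / m) *\<^sub>R iexp (t * x))"
      unfolding char_def using meas meas2 f m by (intro integral_density) auto
    also have "\<dots> = (LINT x|M. of_real (f x) * iexp (t * x) / of_real m)"
      by (simp add: scaleR_conv_of_real)
    finally show ?thesis by simp
  qed
  have "density M1 (\<lambda>x. ennreal (f1 x / m)) = density M2 (\<lambda>x. ennreal (f2 x / m))"
  proof (rule Levy_uniqueness)
    show "real_distribution (density M1 (\<lambda>x. ennreal (f1 x / m)))" using rd[OF sets(1) f1 m1] .
    show "real_distribution (density M2 (\<lambda>x. ennreal (f2 x / m)))" using rd[OF sets(2) f2 m_def] .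
    show "char (density M1 (\<lambda>x. ennreal (f1 x / m))) = char (density M2 (\<lambda>x. ennreal (f2 x / m)))"
      using ch[OF sets(1) f1(1,2)] ch[OF sets(2) f2(1,2)] eq by (simp add: fun_eq_iff)
  qed
  then have "density (density M1 (\<lambda>x. ennreal (f1 x / m))) (\<lambda>_. ennreal m) = density (density M2 (\<lambda>x. ennreal (f2 x / m))) (\<lambda>_. ennreal m)"
    by simp
  moreover have "density (density M (\<lambda>x. ennreal (f x / m))) (\<lambda>_. ennreal m) = density M (\<lambda>x. ennreal (f x))"
    if M: "sets M = sets borel" and f: "f \<in> borel_measurable borel" "\<And>x. f x \<ge> 0"
    for M :: "real measure" and f :: "real \<Rightarrow> real"
  proof -
    have meas: "f \<in> borel_measurable M" using f(1) measurable_cong_sets[OF M refl] by blast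
    have "density (density M (\<lambda>x. ennreal (f x / m))) (\<lambda>_. ennreal m) = density M (\<lambda>x. ennreal (f x / m) * ennreal m)"
      using meas by (intro density_density_eq) auto
    also have "(\<lambda>x. ennreal (f x / m) * ennreal m) = (\<lambda>x. ennreal (f x))"
      using m f by (simp add: fun_eq_iff flip: ennreal_mult')
    finally show ?thesis .
  qed
  ultimately show ?thesis using sets f1 f2 by simp
qed

lemma power_le_exp:
  fixes y :: real
  assumes "y \<ge> 0"
  shows "y ^ k \<le> real k ^ k * exp y"
proof (cases "k = 0")
  case False
  then have k: "real k > 0" by simp
  have "y / k \<le> exp (y / k)" using exp_ge_add_one_self[of "y / k"] by linarith
  then have "(y / k) ^ k \<le> exp (y / k) ^ k" using assms k by (intro power_mono) auto
  also have "\<dots> = exp y" using k by (simp flip: exp_of_nat_mult)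
  finally show ?thesis using k by (simp add: power_divide divide_le_eq mult.commute)
qed (use assms in simp)

text \<open>A spectral measure grows at most polynomially, and e^(x^2) exceeds any power of 1 + x^2
  up to a constant.\<close>

lemma spectral_measure_gauss_integrable:
  assumes \<nu>: "spectral_measure \<nu>" and c: "c \<ge> 0"
  shows "(\<integral>\<^sup>+x. ennreal ((x\<^sup>2 + c)\<^sup>2 * exp (- x\<^sup>2)) \<partial>\<nu>) < \<infinity>"
proof -
  obtain m :: int where m: "(\<integral>\<^sup>+x. ennreal ((1 + x\<^sup>2) powi (- m)) \<partial>\<nu>) < \<infinity>"
    using \<nu> unfolding spectral_measure_def by blast
  \<comment> \<open>The exponent m may be negative; then n = 0, and the weight it bounds is at least
    1.\<close>
  define n where "n = nat m"
  define C where "C = (1 + c)\<^sup>2 * (real (n + 2) ^ (n + 2) * exp 1)"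
  have C: "C \<ge> 0" by (simp add: C_def)
  have "(x\<^sup>2 + c)\<^sup>2 * exp (- x\<^sup>2) \<le> C * (1 + x\<^sup>2) powi (- m)" for x :: real
  proof -
    have y: "1 + x\<^sup>2 \<ge> 1" by simp
    have "(1 + x\<^sup>2) powi (- m) \<ge> inverse ((1 + x\<^sup>2) ^ n)"
    proof (cases "m \<ge> 0")
      case True
      then show ?thesis by (cases "m = 0") (simp_all add: power_int_def n_def power_inverse)
    next
      case False
      then have "(1 + x\<^sup>2) powi (- m) = (1 + x\<^sup>2) ^ nat (- m)" by (simp add: power_int_def)
      also have "\<dots> \<ge> 1" using y by (rule one_le_power)
      finally show ?thesis using False by (simp add: n_def)
    qed
    then have 1: "C * (1 + x\<^sup>2) powi (- m) \<ge> C * inverse ((1 + x\<^sup>2) ^ n)" using C by (intro mult_left_mono)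
    have "x\<^sup>2 + c \<le> (1 + c) * (1 + x\<^sup>2)" using c by (simp add: algebra_simps)
    then have "(x\<^sup>2 + c)\<^sup>2 \<le> ((1 + c) * (1 + x\<^sup>2))\<^sup>2" using c by (intro power_mono) auto
    then have "(x\<^sup>2 + c)\<^sup>2 * (1 + x\<^sup>2) ^ n \<le> ((1 + c) * (1 + x\<^sup>2))\<^sup>2 * (1 + x\<^sup>2) ^ n"
      using y by (intro mult_right_mono) auto
    also have "\<dots> = (1 + c)\<^sup>2 * (1 + x\<^sup>2) ^ (n + 2)" by (simp only: power_mult_distrib power_add mult_ac)
    also have "\<dots> \<le> (1 + c)\<^sup>2 * (real (n + 2) ^ (n + 2) * exp (1 + x\<^sup>2))"
      using y by (intro mult_left_mono power_le_exp) auto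
    also have "\<dots> = C * exp (x\<^sup>2)" by (simp add: C_def exp_add)
    finally have "(x\<^sup>2 + c)\<^sup>2 * (1 + x\<^sup>2) ^ n \<le> C * exp (x\<^sup>2)" .
    moreover have "(1 + x\<^sup>2) ^ n > 0" using y by (intro zero_less_power) linarith
    ultimately have "(x\<^sup>2 + c)\<^sup>2 * exp (- x\<^sup>2) \<le> C * inverse ((1 + x\<^sup>2) ^ n)"
      by (simp add: exp_minus field_simps)
    then show ?thesis using 1 by linarith
  qed
  then have "(\<integral>\<^sup>+x. ennreal ((x\<^sup>2 + c)\<^sup>2 * exp (- x\<^sup>2)) \<partial>\<nu>) \<le> (\<integral>\<^sup>+x. ennreal C * ennreal ((1 + x\<^sup>2) powi (- m)) \<partial>\<nu>)"
    using C by (intro nn_integral_mono) (simp add: ennreal_leI flip: ennreal_mult')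
  also have "\<dots> = ennreal C * (\<integral>\<^sup>+x. ennreal ((1 + x\<^sup>2) powi (- m)) \<partial>\<nu>)"
  proof (rule nn_integral_cmult)
    have "(\<lambda>x::real. (1 + x\<^sup>2) powi (- m)) \<in> borel_measurable borel"
      by (cases "- m \<ge> 0") (auto simp: power_int_def)
    then show "(\<lambda>x. ennreal ((1 + x\<^sup>2) powi (- m))) \<in> borel_measurable \<nu>"
      using \<nu> measurable_cong_sets[of \<nu> borel borel borel] by (auto simp: spectral_measure_def)
  qed
  also have "\<dots> < \<infinity>" using m by (simp add: ennreal_mult_less_top)
  finally show ?thesis .
qed

section \<open>The weak equation in Fourier variables\<close>

context cm_kernel
begin

text \<open>\<open>Kplus K\<close> need not be integrable, but on a derivative one integration by
  parts turns it into convolution with the integrable \<open>L\<close> minus a multiple of \<gamma>.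
  It is carried out as Fubini, with K(v) written as the integral of \<open>L\<close> over r >
  v.\<close>

lemma memory_term_eq:
  assumes \<gamma>: "\<gamma> \<in> schwartz"
  shows "refl_fun (conv (Kplus K) (refl_fun (\<lambda>t. vector_derivative \<gamma> (at t)))) t =
    conv (refl_fun (\<lambda>v. of_real (L v))) \<gamma> t - of_real (K 0) * \<gamma> t"
proof -
  define \<gamma>' where "\<gamma>' t = vector_derivative \<gamma> (at t)" for t
  have s': "\<gamma>' \<in> schwartz" unfolding \<gamma>'_def by (rule schwartz_vderiv[OF \<gamma>])
  have shift: "integrable lborel (\<lambda>v. f (t + v))" if "integrable lborel f" for f :: "real \<Rightarrow> complex"
    using lborel_integrable_real_affine[OF that, of 1 t] by simp
  have i': "integrable lborel (\<lambda>v. \<gamma>' (t + v))" using shift[OF schwartz_integrable[OF s']] .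
  have [measurable]: "\<gamma>' \<in> borel_measurable borel" "\<gamma> \<in> borel_measurable borel"
    using schwartz_measurable s' \<gamma> by auto
  define H where "H v r = (if 0 < v \<and> v < r then of_real (L r) * \<gamma>' (t + v) else 0)" for v r
  have H_meas [measurable]: "(\<lambda>(v, r). H v r) \<in> borel_measurable (lborel \<Otimes>\<^sub>M lborel)" unfolding H_def by measurable
  have int: "integrable (lborel \<Otimes>\<^sub>M lborel) (\<lambda>(v, r). H v r)"
  proof (rule Bochner_Integration.integrable_bound)
    show "integrable (lborel \<Otimes>\<^sub>M lborel) (\<lambda>(v, r). \<gamma>' (t + v) * complex_of_real (L r) * (\<lambda>_. 1) (v, r))"
      using integrable_L by (intro integrable_pair_mult i') auto
    show "AE p in lborel \<Otimes>\<^sub>M lborel. norm (case p of (v, r) \<Rightarrow> H v r) \<le> norm (case p of (v, r) \<Rightarrow> \<gamma>' (t + v) * complex_of_real (L r) * (\<lambda>_. 1) (v, r))"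
      by (intro AE_I2) (auto simp: H_def norm_mult)
  qed measurable
  \<comment> \<open>At v = 0 the left side is 0 while \<open>Kplus K 0\<close> is K(0); the point is
    excluded as a null set.\<close>
  have inner_r: "(LINT r|lborel. H v r) = Kplus K v * \<gamma>' (t + v)" if "v \<noteq> 0" for v
  proof (cases "v > 0")
    case True
    have "H v r = of_real (L r * indicator {v<..} r) * \<gamma>' (t + v)" for r
      using True by (simp add: H_def indicator_def)
    then have "(LINT r|lborel. H v r) = of_real (LINT r|lborel. L r * indicator {v<..} r) * \<gamma>' (t + v)"
      by (simp only: integral_mult_left_zero integral_complex_of_real)
    then show ?thesis using K_eq_integral_L[of v] True by (simp add: Kplus_def)
  next
    case False
    then show ?thesis using that by (simp add: H_def Kplus_def)
  qed
  have inner_v: "(LINT v|lborel. H v r) = of_real (L r) * (\<gamma> (t + r) - \<gamma> t)" for r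
  proof (cases "r > 0")
    case True
    have "(LINT v|lborel. indicator {0..r} v *\<^sub>R \<gamma>' (t + v)) = \<gamma> (t + r) - \<gamma> (t + 0)"
    proof (rule integral_FTC_Icc)
      show "((\<lambda>v. \<gamma> (t + v)) has_vector_derivative \<gamma>' (t + x)) (at x within {0..r})" for x
      proof -
        have "((\<lambda>v. t + v) has_vector_derivative 1) (at x)"
          by (auto intro!: derivative_eq_intros simp: has_real_derivative_iff_has_vector_derivative[symmetric])
        from vector_diff_chain_at[OF this schwartz_has_vector_derivative[OF \<gamma>]]
        show ?thesis by (simp add: comp_def \<gamma>'_def has_vector_derivative_at_within)
      qed
      show "continuous_on {0..r} (\<lambda>v. \<gamma>' (t + v))"
      proof (intro continuous_at_imp_continuous_on ballI)
        fix v
        have "isCont (\<lambda>v. t + v) v" by (intro continuous_intros)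
        then show "isCont (\<lambda>v. \<gamma>' (t + v)) v" using schwartz_isCont[OF s'] by (rule isCont_o2)
      qed
    qed (use True in auto)
    moreover have "(LINT v|lborel. indicator {0..r} v *\<^sub>R \<gamma>' (t + v)) = (LINT v|lborel. (if 0 < v \<and> v < r then \<gamma>' (t + v) else 0))"
    proof (rule integral_cong_AE)
      have "AE v in lborel. v \<notin> {0, r}"
        by (rule AE_not_in) (auto intro!: countable_imp_null_set_lborel)
      then show "AE v in lborel. indicator {0..r} v *\<^sub>R \<gamma>' (t + v) = (if 0 < v \<and> v < r then \<gamma>' (t + v) else 0)"
        by eventually_elim (auto simp: indicator_def)
    qed measurable
    moreover have "H v r = of_real (L r) * (if 0 < v \<and> v < r then \<gamma>' (t + v) else 0)" for v
      by (simp add: H_def)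
    ultimately show ?thesis by (simp only: integral_mult_right_zero) simp
  next
    case False
    then have "H v r = 0" for v by (auto simp: H_def)
    then show ?thesis using False by (simp add: L_def)
  qed
  have "refl_fun (conv (Kplus K) (refl_fun \<gamma>')) t = (LINT s|lborel. Kplus K (- t - s) * \<gamma>' (- s))"
    by (simp add: refl_fun_def conv_def)
  also have "\<dots> = (LINT v|lborel. Kplus K v * \<gamma>' (t + v))"
    using lborel_integral_real_affine[of "-1" "\<lambda>s. Kplus K (- t - s) * \<gamma>' (- s)" "- t"] by (simp add: add.commute)
  also have "\<dots> = (LINT v|lborel. LINT r|lborel. H v r)"
  proof (rule integral_cong_AE)
    have [measurable]: "K \<in> borel_measurable borel" using cont by (rule borel_measurable_continuous_onI)
    show "(\<lambda>v. Kplus K v * \<gamma>' (t + v)) \<in> borel_measurable lborel" unfolding Kplus_def by measurable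
    show "(\<lambda>v. LINT r|lborel. H v r) \<in> borel_measurable lborel"
      by (rule sigma_finite_measure.borel_measurable_lebesgue_integral[OF sigma_finite_lborel H_meas])
    show "AE v in lborel. Kplus K v * \<gamma>' (t + v) = (LINT r|lborel. H v r)"
      using AE_neq_0 by eventually_elim (simp add: inner_r)
  qed
  also have "\<dots> = (LINT r|lborel. LINT v|lborel. H v r)"
    using int by (rule lborel_pair.Fubini_integral[symmetric])
  also have "\<dots> = (LINT r|lborel. of_real (L r) * \<gamma> (t + r) - of_real (L r) * \<gamma> t)"
    by (simp add: inner_v right_diff_distrib)
  also have "\<dots> = (LINT r|lborel. of_real (L r) * \<gamma> (t + r)) - (LINT r|lborel. of_real (L r) * \<gamma> t)"
  proof (rule Bochner_Integration.integral_diff)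
    obtain B where "\<And>t. \<bar>t\<bar> ^ 0 * cmod (vderiv 0 \<gamma> t) \<le> B" using schwartz_bounded[OF \<gamma>] by metis
    then have B: "\<And>t. cmod (\<gamma> t) \<le> B" by simp
    have iL: "integrable lborel (\<lambda>r. complex_of_real (L r))" using integrable_L by (rule integrable_of_real)
    have "integrable lborel (\<lambda>r. \<gamma> (t + r) * of_real (L r))"
      by (rule integrable_mult_bounded[OF iL]) (auto intro: B)
    then show "integrable lborel (\<lambda>r. of_real (L r) * \<gamma> (t + r))" by (simp add: mult.commute)
    show "integrable lborel (\<lambda>r. of_real (L r) * \<gamma> t)" using iL by simp
  qed
  also have "(LINT r|lborel. of_real (L r) * \<gamma> t) = of_real (K 0) * \<gamma> t"
    by (simp add: integral_L)
  also have "(LINT r|lborel. of_real (L r) * \<gamma> (t + r)) = conv (refl_fun (\<lambda>v. of_real (L v))) \<gamma> t"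
    unfolding conv_def refl_fun_def
    using lborel_integral_real_affine[of 1 "\<lambda>s. of_real (L (s - t)) * \<gamma> s" t] by (simp add: algebra_simps)
  finally show ?thesis by (simp add: \<gamma>'_def[abs_def])
qed

text \<open>This is - i w times the symbol i w + a kappa(i w) of the mode equation. The extra factor
  comes from testing with derivatives and removes the possible singularity of kappa at 0.\<close>

definition symb :: "real \<Rightarrow> real \<Rightarrow> complex" where
  "symb a w = of_real (w\<^sup>2) - of_real a * DD (\<i> * of_real w)"

lemma symb_measurable [measurable]: "symb a \<in> borel_measurable borel"
proof -
  have [measurable]: "(\<lambda>w. \<i> * complex_of_real w) \<in> borel_measurable borel" by measurable
  show ?thesis unfolding symb_def by measurable
qed

lemma symb_bound:
  assumes "a > 0"
  shows "cmod (symb a w) \<le> w\<^sup>2 + 2 * a * K 0"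
proof -
  have "cmod (symb a w) \<le> cmod (of_real (w\<^sup>2)) + cmod (of_real a * DD (\<i> * of_real w))"
    unfolding symb_def by (rule norm_triangle_ineq4)
  also have "cmod (of_real a * DD (\<i> * of_real w)) \<le> a * (2 * K 0)"
    using DD_bound[of "\<i> * of_real w"] assms by (simp add: norm_mult)
  finally show ?thesis by (simp add: norm_power)
qed

text \<open>The adjoint memory runs forward in time, which reflects the kernel and conjugates the
  symbol. Since \<open>h\<close> is integrable, its distributional transform is the classical
  one.\<close>

lemma mode_adjoint_fourier:
  assumes \<gamma>: "\<gamma> \<in> schwartz"
  obtains h where "mode_adjoint K a (\<lambda>t. vector_derivative \<gamma> (at t)) = dist_of_fun h" "integrable lborel h"
    "\<And>w. fourier h w = cnj (symb a w) * fourier \<gamma> w"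
proof -
  define \<gamma>' where "\<gamma>' t = vector_derivative \<gamma> (at t)" for t
  have s': "\<gamma>' \<in> schwartz" unfolding \<gamma>'_def by (rule schwartz_vderiv[OF \<gamma>])
  define \<gamma>'' where "\<gamma>'' t = vector_derivative \<gamma>' (at t)" for t
  have s'': "\<gamma>'' \<in> schwartz" unfolding \<gamma>''_def by (rule schwartz_vderiv[OF s'])
  define A where "A t = conv (refl_fun (\<lambda>v. of_real (L v))) \<gamma> t - of_real (K 0) * \<gamma> t" for t
  define h where "h t = - 1 * \<gamma>'' t + of_real a * A t" for t
  have iL: "integrable lborel (\<lambda>r. complex_of_real (L r))" using integrable_L by (rule integrable_of_real)
  have iRL: "integrable lborel (refl_fun (\<lambda>r. complex_of_real (L r)))"
    using lborel_integrable_real_affine[OF iL, of "-1" 0] by (simp add: refl_fun_def[abs_def])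
  note i\<gamma> = schwartz_integrable[OF \<gamma>]
  have iA: "integrable lborel A"
    unfolding A_def using convolution_L1(1)[OF iRL i\<gamma>] i\<gamma> by simp
  have ih: "integrable lborel h" unfolding h_def using iA schwartz_integrable[OF s''] by simp
  have "mode_adjoint K a \<gamma>' = dist_of_fun h"
    unfolding mode_adjoint_def h_def A_def \<gamma>''_def
    using memory_term_eq[OF \<gamma>] by (simp add: \<gamma>'_def[abs_def])
  moreover have "fourier h w = cnj (symb a w) * fourier \<gamma> w" for w
  proof -
    have "fourier A w = fourier (\<lambda>t. 1 * conv (refl_fun (\<lambda>v. of_real (L v))) \<gamma> t + (- of_real (K 0)) * \<gamma> t) w"
      by (simp add: A_def[abs_def])
    also have "\<dots> = 1 * fourier (conv (refl_fun (\<lambda>v. of_real (L v))) \<gamma>) w + (- of_real (K 0)) * fourier \<gamma> w"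
      by (rule fourier_lincomb[OF convolution_L1(1)[OF iRL i\<gamma>] i\<gamma>])
    also have "fourier (conv (refl_fun (\<lambda>v. of_real (L v))) \<gamma>) w = fourier (\<lambda>v. of_real (L v)) (- w) * fourier \<gamma> w"
      by (simp add: convolution_L1(2)[OF iRL i\<gamma>] fourier_refl)
    finally have A: "fourier A w = (fourier (\<lambda>v. of_real (L v)) (- w) - of_real (K 0)) * fourier \<gamma> w"
      by (simp add: algebra_simps)
    have "cnj (DD (\<i> * of_real w)) = (LINT v|lborel. cnj (of_real (L v) * (1 - exp (- (\<i> * of_real w) * of_real v))))"
      unfolding DD_def by (rule Bochner_Integration.integral_cnj[symmetric])
    also have "\<dots> = (LINT v|lborel. of_real (L v) - of_real (L v) * exp (- \<i> * of_real v * of_real (- w)))"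
      by (rule Bochner_Integration.integral_cong) (auto simp: exp_cnj algebra_simps)
    also have "\<dots> = (LINT v|lborel. of_real (L v)) - (LINT v|lborel. of_real (L v) * exp (- \<i> * of_real v * of_real (- w)))"
      by (rule Bochner_Integration.integral_diff[OF iL fourier_integrable_integrand[OF iL]])
    also have "\<dots> = of_real (K 0) - fourier (\<lambda>v. of_real (L v)) (- w)"
      by (simp add: fourier_def integral_L)
    finally have D: "cnj (DD (\<i> * of_real w)) = of_real (K 0) - fourier (\<lambda>v. of_real (L v)) (- w)" .
    have "fourier h w = - 1 * fourier \<gamma>'' w + of_real a * fourier A w"
      unfolding h_def[abs_def] by (rule fourier_lincomb[OF schwartz_integrable[OF s''] iA])
    also have "fourier \<gamma>'' w = \<i> * of_real w * (\<i> * of_real w * fourier \<gamma> w)"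
      using fourier_vector_derivative[OF s'] fourier_vector_derivative[OF \<gamma>]
      by (simp add: \<gamma>''_def[abs_def] \<gamma>'_def[abs_def])
    finally show ?thesis unfolding A symb_def
      by (simp add: D algebra_simps power2_eq_square)
  qed
  ultimately show ?thesis using that ih by (simp add: \<gamma>'_def[abs_def])
qed

text \<open>The multiplication formula for \<open>spec\<close> and the convolution: the transform of
  \<open>spec\<close> is a multiple of K, and that of the convolution is the product of one
  transform with the conjugate of the other.\<close>

lemma forcing_cov_fourier:
  assumes \<phi>: "\<phi> \<in> schwartz" and \<psi>: "\<psi> \<in> schwartz"
  shows "of_real fejer_const * forcing_cov K \<phi> \<psi> = (LINT w|lborel. of_real (spec w) * (fourier \<phi> w * cnj (fourier \<psi> w)))"
proof -
  define \<psi>' where "\<psi>' = refl_fun (\<lambda>s. cnj (\<psi> s))"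
  have i\<psi>: "integrable lborel \<psi>'"
    using lborel_integrable_real_affine[OF schwartz_integrable[OF \<psi>], of "-1" 0]
    by (simp add: \<psi>'_def refl_fun_def[abs_def])
  note i = convolution_L1[OF schwartz_integrable[OF \<phi>] i\<psi>]
  have f_spec: "fourier (\<lambda>w. of_real (spec w)) t = of_real (fejer_const * K t)" for t
  proof -
    have "fourier (\<lambda>w. of_real (spec w)) t = (LINT w|lborel. of_real (spec w) * exp (- \<i> * of_real t * of_real w))"
      unfolding fourier_def by (rule Bochner_Integration.integral_cong) (auto simp: mult_ac)
    then show ?thesis using integral_spec_exp[of t] by simp
  qed
  have "of_real fejer_const * forcing_cov K \<phi> \<psi> = (LINT t|lborel. of_real fejer_const * (of_real (K t) * conv \<phi> \<psi>' t))"
    unfolding forcing_cov_def \<psi>'_def by (rule integral_mult_right_zero[symmetric])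
  also have "\<dots> = (LINT t|lborel. fourier (\<lambda>w. of_real (spec w)) t * conv \<phi> \<psi>' t)"
    by (simp add: f_spec mult.assoc)
  also have "\<dots> = (LINT w|lborel. of_real (spec w) * fourier (conv \<phi> \<psi>') w)"
    using fourier_multiplication_formula[OF integrable_of_real[OF integrable_spec] i(1)] by simp
  also have "\<dots> = (LINT w|lborel. of_real (spec w) * (fourier \<phi> w * cnj (fourier \<psi> w)))"
    by (simp add: i(2)) (simp add: \<psi>'_def fourier_refl_cnj)
  finally show ?thesis .
qed

end

lemma operator_assoc_facts:
  assumes "operator_assoc M \<nu> V"
  shows operator_assoc_spectral: "spectral_measure \<nu>"
    and operator_assoc_L2: "\<And>f. f \<in> op_dom \<nu> \<Longrightarrow> V f \<in> borel_measurable M \<and> integrable M (\<lambda>w. (cmod (V f w))\<^sup>2)"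
    and operator_assoc_isometry: "\<And>f1 f2 g1 g2. f1 \<in> op_dom \<nu> \<Longrightarrow> f2 \<in> op_dom \<nu> \<Longrightarrow>
      fourier_in_L2 \<nu> f1 g1 \<Longrightarrow> fourier_in_L2 \<nu> f2 g2 \<Longrightarrow>
      (LINT w|M. V f1 w * cnj (V f2 w)) = (LINT y|\<nu>. g1 y * cnj (g2 y))"
    and operator_assoc_gaussian: "\<And>I c. finite I \<Longrightarrow> I \<subseteq> op_dom \<nu> \<Longrightarrow>
      centered_gaussian M (\<lambda>w. Re (\<Sum>f\<in>I. c f * V f w))"
    and operator_assoc_real: "\<And>t. dirac t \<in> op_dom \<nu> \<Longrightarrow> AE w in M. Im (V (dirac t) w) = 0"
proof -
  note * = assms[unfolded operator_assoc_def]
  show "spectral_measure \<nu>" using * by (elim conjE)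
  show "V f \<in> borel_measurable M \<and> integrable M (\<lambda>w. (cmod (V f w))\<^sup>2)" if "f \<in> op_dom \<nu>" for f
    using *[THEN conjunct2, THEN conjunct1] that by (rule bspec)
  show "(LINT w|M. V f1 w * cnj (V f2 w)) = (LINT y|\<nu>. g1 y * cnj (g2 y))"
    if "f1 \<in> op_dom \<nu>" "f2 \<in> op_dom \<nu>" "fourier_in_L2 \<nu> f1 g1" "fourier_in_L2 \<nu> f2 g2" for f1 f2 g1 g2
    using *[THEN conjunct2, THEN conjunct2, THEN conjunct2, THEN conjunct1, rule_format, OF that] .
  show "centered_gaussian M (\<lambda>w. Re (\<Sum>f\<in>I. c f * V f w))" if "finite I" "I \<subseteq> op_dom \<nu>" for I c
    using *[THEN conjunct2, THEN conjunct2, THEN conjunct2, THEN conjunct2, THEN conjunct1, rule_format, OF that] .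
  show "AE w in M. Im (V (dirac t) w) = 0" if "dirac t \<in> op_dom \<nu>" for t
    using *[THEN conjunct2, THEN conjunct2, THEN conjunct2, THEN conjunct2, THEN conjunct2, rule_format, OF that] .
qed

context cm_kernel
begin

lemma fourier_test_function:
  "fourier (\<lambda>t. vector_derivative (gauss s) (at t)) w = \<i> * of_real w * fourier (gauss s) w"
  by (rule fourier_vector_derivative[OF gauss_schwartz])

lemma gauss_product:
  "fourier (gauss s) w * cnj (fourier (gauss 0) w) = of_real (2 * pi * exp (- w\<^sup>2)) * iexp (- s * w)"
proof -
  have e: "exp (- w\<^sup>2) = exp (- w\<^sup>2 / 2) * exp (- w\<^sup>2 / 2)" by (simp flip: exp_add)
  have p: "complex_of_real (sqrt (2 * pi)) * complex_of_real (sqrt (2 * pi)) = of_real (2 * pi)"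
    by (simp flip: of_real_mult)
  have "fourier (gauss s) w * cnj (fourier (gauss 0) w) =
    (complex_of_real (sqrt (2 * pi)) * complex_of_real (sqrt (2 * pi))) *
    (of_real (exp (- w\<^sup>2 / 2)) * of_real (exp (- w\<^sup>2 / 2))) * exp (- \<i> * of_real s * of_real w)"
    by (simp only: fourier_gauss complex_cnj_mult complex_cnj_complex_of_real) simp
  also have "\<dots> = of_real (2 * pi * exp (- w\<^sup>2)) * iexp (- s * w)"
    unfolding p e by (simp add: mult.assoc)
  finally show ?thesis .
qed

text \<open>The Gaussian factor beats both the quadratic growth of the symbol and the polynomial
  growth of the measure.\<close>

lemma mode_adjoint_fourier_in_L2:
  assumes \<nu>: "spectral_measure \<nu>" and a: "a > 0"
  shows "fourier_in_L2 \<nu> (mode_adjoint K a (\<lambda>t. vector_derivative (gauss s) (at t)))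
      (\<lambda>w. cnj (symb a w) * fourier (gauss s) w)"
    and "mode_adjoint K a (\<lambda>t. vector_derivative (gauss s) (at t)) \<in> op_dom \<nu>"
proof -
  obtain h where h: "mode_adjoint K a (\<lambda>t. vector_derivative (gauss s) (at t)) = dist_of_fun h" "integrable lborel h"
    "\<And>w. fourier h w = cnj (symb a w) * fourier (gauss s) w"
    using mode_adjoint_fourier[OF gauss_schwartz] by blast
  have aK: "2 * a * K 0 \<ge> 0" using a K0_pos by simp
  have "(\<integral>\<^sup>+w. ennreal ((cmod (cnj (symb a w) * fourier (gauss s) w))\<^sup>2) \<partial>\<nu>)
      \<le> (\<integral>\<^sup>+w. ennreal (2 * pi) * ennreal ((w\<^sup>2 + 2 * a * K 0)\<^sup>2 * exp (- w\<^sup>2)) \<partial>\<nu>)"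
  proof (rule nn_integral_mono)
    fix w
    have "(cmod (fourier (gauss s) w))\<^sup>2 = 2 * pi * exp (- w\<^sup>2)"
    proof -
      have "exp (- w\<^sup>2) = (exp (- w\<^sup>2 / 2))\<^sup>2" by (simp flip: exp_double)
      then show ?thesis by (simp add: fourier_gauss norm_mult power_mult_distrib del: of_real_exp)
    qed
    moreover have "(cmod (symb a w))\<^sup>2 \<le> (w\<^sup>2 + 2 * a * K 0)\<^sup>2"
      using symb_bound[OF a, of w] by (intro power_mono) auto
    ultimately have "(cmod (cnj (symb a w) * fourier (gauss s) w))\<^sup>2 \<le> (w\<^sup>2 + 2 * a * K 0)\<^sup>2 * (2 * pi * exp (- w\<^sup>2))"
      by (simp add: norm_mult power_mult_distrib mult_right_mono)
    also have "\<dots> = 2 * pi * ((w\<^sup>2 + 2 * a * K 0)\<^sup>2 * exp (- w\<^sup>2))" by simp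
    finally show "ennreal ((cmod (cnj (symb a w) * fourier (gauss s) w))\<^sup>2) \<le> ennreal (2 * pi) * ennreal ((w\<^sup>2 + 2 * a * K 0)\<^sup>2 * exp (- w\<^sup>2))"
      by (simp only: ennreal_mult'[symmetric] ennreal_leI pi_ge_zero mult_nonneg_nonneg zero_le_numeral)
  qed
  also have "\<dots> = ennreal (2 * pi) * (\<integral>\<^sup>+w. ennreal ((w\<^sup>2 + 2 * a * K 0)\<^sup>2 * exp (- w\<^sup>2)) \<partial>\<nu>)"
  proof (rule nn_integral_cmult)
    have "(\<lambda>w. (w\<^sup>2 + 2 * a * K 0)\<^sup>2 * exp (- w\<^sup>2)) \<in> borel_measurable borel" by measurable
    then show "(\<lambda>w. ennreal ((w\<^sup>2 + 2 * a * K 0)\<^sup>2 * exp (- w\<^sup>2))) \<in> borel_measurable \<nu>"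
      using \<nu> measurable_cong_sets[of \<nu> borel borel borel] by (auto simp: spectral_measure_def)
  qed
  also have "\<dots> < \<infinity>" using spectral_measure_gauss_integrable[OF \<nu> aK] by (simp add: ennreal_mult_less_top)
  finally have fin: "(\<integral>\<^sup>+w. ennreal ((cmod (cnj (symb a w) * fourier (gauss s) w))\<^sup>2) \<partial>\<nu>) < \<infinity>" .
  have "fourier h = (\<lambda>w. cnj (symb a w) * fourier (gauss s) w)" using h(3) by auto
  then show *: "fourier_in_L2 \<nu> (mode_adjoint K a (\<lambda>t. vector_derivative (gauss s) (at t)))
      (\<lambda>w. cnj (symb a w) * fourier (gauss s) w)"
    unfolding fourier_in_L2_def using is_function_fourier[OF h(2)] fin h(1) by simp
  then show "mode_adjoint K a (\<lambda>t. vector_derivative (gauss s) (at t)) \<in> op_dom \<nu>"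
    unfolding op_dom_def using dist_of_fun_tempered[OF h(2)] h(1) by auto
qed

text \<open>Testing the weak equation against derivatives of translated Gaussians determines the Fourier
  transform of the measure, with weight \<open>\<omega>\<^sup>2 e\<^sup>-\<^sup>\<omega>\<^sup>2\<close>; the factor \<open>\<omega>\<^sup>2\<close> removes the possible singularity of
  the Laplace transform of \<open>K\<close> at \<open>0\<close>.\<close>

lemma spectral_measure_identity:
  assumes sol: "weak_stationary_solution M K a l \<nu> V" and a: "a > 0" and l: "l > 0"
  shows "density \<nu> (\<lambda>w. ennreal ((cmod (symb a w))\<^sup>2 * (2 * pi * exp (- w\<^sup>2)))) =
    density lborel (\<lambda>w. ennreal (l\<^sup>2 / fejer_const * spec w * w\<^sup>2 * (2 * pi * exp (- w\<^sup>2))))"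
proof -
  have op: "operator_assoc M \<nu> V" using sol by (simp add: weak_stationary_solution_def)
  then have \<nu>: "spectral_measure \<nu>" by (rule operator_assoc_spectral)
  then have s\<nu>: "sets \<nu> = sets borel" by (simp add: spectral_measure_def)
  define \<phi> where "\<phi> s t = vector_derivative (gauss s) (at t)" for s t
  have \<phi>: "\<phi> s \<in> schwartz" for s unfolding \<phi>_def by (rule schwartz_vderiv[OF gauss_schwartz])
  have iso: "(LINT w|M. V f1 w * cnj (V f2 w)) = (LINT y|\<nu>. g1 y * cnj (g2 y))"
    if "f1 \<in> op_dom \<nu>" "f2 \<in> op_dom \<nu>" "fourier_in_L2 \<nu> f1 g1" "fourier_in_L2 \<nu> f2 g2" for f1 f2 g1 g2
    using operator_assoc_isometry[OF op that] .
  define f1 where "f1 w = (cmod (symb a w))\<^sup>2 * (2 * pi * exp (- w\<^sup>2))" for w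
  define f2 where "f2 w = l\<^sup>2 / fejer_const * spec w * w\<^sup>2 * (2 * pi * exp (- w\<^sup>2))" for w
  have [measurable]: "f1 \<in> borel_measurable borel" "f2 \<in> borel_measurable borel"
    unfolding f1_def f2_def by measurable
  have f12: "f1 w \<ge> 0" "f2 w \<ge> 0" for w
    using fejer_const_pos spec_nonneg[of w] by (auto simp: f1_def f2_def)
  have mf1: "f1 \<in> borel_measurable \<nu>" unfolding measurable_cong_sets[OF s\<nu> refl] by measurable
  have eq: "(LINT w|\<nu>. of_real (f1 w) * iexp (s * w)) = (LINT w|lborel. of_real (f2 w) * iexp (s * w))" for s
  proof -
    \<comment> \<open>The shift by - s makes the phase of \<open>gauss_product\<close> the one of a
      characteristic function at s.\<close>
    have "(LINT y|\<nu>. (cnj (symb a y) * fourier (gauss (- s)) y) * cnj (cnj (symb a y) * fourier (gauss 0) y)) =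
       of_real (l\<^sup>2) * forcing_cov K (\<phi> (- s)) (\<phi> 0)"
      using sol[unfolded weak_stationary_solution_def, THEN conjunct2, THEN conjunct2, rule_format, OF \<phi> \<phi>, of "- s" 0] iso[OF mode_adjoint_fourier_in_L2(2)[OF \<nu> a] mode_adjoint_fourier_in_L2(2)[OF \<nu> a]
          mode_adjoint_fourier_in_L2(1)[OF \<nu> a] mode_adjoint_fourier_in_L2(1)[OF \<nu> a], of "- s" 0]
      unfolding \<phi>_def[abs_def] by simp
    moreover have "(cnj (symb a y) * fourier (gauss (- s)) y) * cnj (cnj (symb a y) * fourier (gauss 0) y) = of_real (f1 y) * iexp (s * y)" for y
    proof -
      have "(cnj (symb a y) * fourier (gauss (- s)) y) * cnj (cnj (symb a y) * fourier (gauss 0) y) =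
        (symb a y * cnj (symb a y)) * (fourier (gauss (- s)) y * cnj (fourier (gauss 0) y))" by simp
      then show ?thesis
        unfolding gauss_product complex_norm_square[symmetric] by (simp add: f1_def)
    qed
    ultimately have L: "(LINT w|\<nu>. of_real (f1 w) * iexp (s * w)) = of_real (l\<^sup>2) * forcing_cov K (\<phi> (- s)) (\<phi> 0)"
      by simp
    have "of_real (l\<^sup>2) * forcing_cov K (\<phi> (- s)) (\<phi> 0) = of_real (l\<^sup>2 / fejer_const) * (of_real fejer_const * forcing_cov K (\<phi> (- s)) (\<phi> 0))"
      using fejer_const_pos by simp
    also have "\<dots> = (LINT w|lborel. of_real (l\<^sup>2 / fejer_const) * (of_real (spec w) * (fourier (\<phi> (- s)) w * cnj (fourier (\<phi> 0) w))))"
      unfolding forcing_cov_fourier[OF \<phi> \<phi>] by (rule integral_mult_right_zero[symmetric])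
    also have "\<dots> = (LINT w|lborel. of_real (f2 w) * iexp (s * w))"
    proof (rule Bochner_Integration.integral_cong)
      fix w
      have "fourier (\<phi> (- s)) w * cnj (fourier (\<phi> 0) w) =
        of_real (w\<^sup>2) * (fourier (gauss (- s)) w * cnj (fourier (gauss 0) w))"
        unfolding \<phi>_def fourier_test_function by (simp add: power2_eq_square) (simp add: algebra_simps)
      then show "of_real (l\<^sup>2 / fejer_const) * (of_real (spec w) * (fourier (\<phi> (- s)) w * cnj (fourier (\<phi> 0) w))) = of_real (f2 w) * iexp (s * w)"
        unfolding gauss_product f2_def by (simp add: mult_ac)
    qed simp
    finally show ?thesis using L by simp
  qed
  have i1: "integrable \<nu> f1"
  proof (rule integrableI_nonneg[OF mf1])
    have "(\<integral>\<^sup>+w. ennreal ((cmod (cnj (symb a w) * fourier (gauss 0) w))\<^sup>2) \<partial>\<nu>) < \<infinity>"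
      using mode_adjoint_fourier_in_L2(1)[OF \<nu> a, of 0] unfolding fourier_in_L2_def by blast
    moreover have "(cmod (cnj (symb a w) * fourier (gauss 0) w))\<^sup>2 = f1 w" for w
    proof -
      have "complex_of_real ((cmod (fourier (gauss 0) w))\<^sup>2) = of_real (2 * pi * exp (- w\<^sup>2))"
        unfolding complex_norm_square gauss_product by simp
      then have "(cmod (fourier (gauss 0) w))\<^sup>2 = 2 * pi * exp (- w\<^sup>2)" unfolding of_real_eq_iff .
      then show ?thesis by (simp add: f1_def norm_mult power_mult_distrib)
    qed
    ultimately show "(\<integral>\<^sup>+w. ennreal (f1 w) \<partial>\<nu>) < \<infinity>" by simp
  qed (use f12 in auto)
  have i2: "integrable lborel f2"
  proof (rule Bochner_Integration.integrable_bound[OF integrable_mult_right[OF integrable_spec, of "l\<^sup>2 / fejer_const * (2 * pi)"]])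
    have "f2 w \<le> l\<^sup>2 / fejer_const * (2 * pi) * spec w" for w
    proof -
      have "w\<^sup>2 * exp (- w\<^sup>2) \<le> 1"
      proof -
        have "w\<^sup>2 \<le> exp (w\<^sup>2)" using exp_ge_add_one_self[of "w\<^sup>2"] by linarith
        then show ?thesis by (simp add: exp_minus divide_inverse[symmetric] pos_divide_le_eq)
      qed
      then have "(l\<^sup>2 / fejer_const * (2 * pi) * spec w) * (w\<^sup>2 * exp (- w\<^sup>2)) \<le> (l\<^sup>2 / fejer_const * (2 * pi) * spec w) * 1"
        using fejer_const_pos spec_nonneg[of w] by (intro mult_left_mono) auto
      then show ?thesis by (simp add: f2_def mult_ac)
    qed
    then have "norm (f2 w) \<le> norm (l\<^sup>2 / fejer_const * (2 * pi) * spec w)" for w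
      using f12(2)[of w] unfolding real_norm_def by (metis abs_ge_self abs_of_nonneg order_trans)
    then show "AE w in lborel. norm (f2 w) \<le> norm (l\<^sup>2 / fejer_const * (2 * pi) * spec w)" by simp
  qed measurable
  \<comment> \<open>The total mass must be positive for the normalisation to probability laws; it
    is, because \<open>spec\<close> is positive off 0.\<close>
  have pos: "(LINT w|lborel. f2 w) > 0"
  proof -
    have "(LINT w|lborel. f2 w) \<noteq> 0"
    proof
      assume "(LINT w|lborel. f2 w) = 0"
      then have "AE w in lborel. f2 w = 0"
        using integral_nonneg_eq_0_iff_AE[OF i2] f12 by simp
      then have "AE w in (lborel :: real measure). False"
        using AE_neq_0
      proof eventually_elim
        fix w assume "f2 w = 0" "w \<noteq> 0"
        then show False using fejer_const_pos spec_pos[of w] l by (simp add: f2_def)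
      qed
      then show False by (simp add: eventually_False ae_filter_eq_bot_iff)
    qed
    moreover have "(LINT w|lborel. f2 w) \<ge> 0" using f12 by (intro Bochner_Integration.integral_nonneg) auto
    ultimately show ?thesis by simp
  qed
  show ?thesis
    using density_eqI_fourier[OF s\<nu> _ _ f12(1) i1 _ f12(2) i2 pos eq] by (simp add: f1_def[abs_def] f2_def[abs_def])
qed

text \<open>The weight \<open>f1\<close> in the identity of measures vanishes at most at 0, and
  absolute continuity gives this point no mass, so the weight can be divided out.\<close>

lemma nn_integral_spectral:
  assumes sol: "weak_stationary_solution M K a l \<nu> V" and a: "a > 0" and l: "l > 0"
    and g: "g \<in> borel_measurable borel" "\<And>w. g w \<ge> 0"
  shows "(\<integral>\<^sup>+w. ennreal (g w) \<partial>\<nu>) = ennreal (l\<^sup>2 / fejer_const) * (\<integral>\<^sup>+w. ennreal (g w * dens a w) \<partial>lborel)"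
proof -
  have \<nu>: "spectral_measure \<nu>" using sol unfolding weak_stationary_solution_def by (blast intro: operator_assoc_spectral)
  then have s\<nu>: "sets \<nu> = sets borel" by (simp add: spectral_measure_def)
  have m\<nu>: "f \<in> borel_measurable \<nu>" if "f \<in> borel_measurable borel" for f :: "real \<Rightarrow> ennreal"
    using measurable_cong_sets[OF s\<nu> refl] that by blast
  note [measurable] = g(1)
  define f1 where "f1 w = (cmod (symb a w))\<^sup>2 * (2 * pi * exp (- w\<^sup>2))" for w
  define f2 where "f2 w = l\<^sup>2 / fejer_const * spec w * w\<^sup>2 * (2 * pi * exp (- w\<^sup>2))" for w
  have [measurable]: "f1 \<in> borel_measurable borel" "f2 \<in> borel_measurable borel"
    unfolding f1_def f2_def by measurable
  have f12: "f1 w \<ge> 0" "f2 w \<ge> 0" for w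
    using fejer_const_pos spec_nonneg[of w] by (auto simp: f1_def f2_def)
  have f1_pos: "f1 w > 0" if "w \<noteq> 0" for w
    using dens_denominator(1)[OF a that] by (simp add: f1_def symb_def)
  have "AE w in \<nu>. w \<noteq> 0"
  proof (rule AE_I')
    have "{0::real} \<in> null_sets lborel" by (intro countable_imp_null_set_lborel) auto
    then show "{0::real} \<in> null_sets \<nu>"
      using \<nu> unfolding spectral_measure_def absolutely_continuous_def by blast
  qed auto
  then have "(\<integral>\<^sup>+w. ennreal (g w) \<partial>\<nu>) = (\<integral>\<^sup>+w. ennreal (f1 w) * ennreal (g w / f1 w) \<partial>\<nu>)"
  proof (intro nn_integral_cong_AE, eventually_elim)
    fix w :: real assume "w \<noteq> 0"
    then show "ennreal (g w) = ennreal (f1 w) * ennreal (g w / f1 w)"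
      using f1_pos[of w] by (simp flip: ennreal_mult')
  qed
  also have "\<dots> = (\<integral>\<^sup>+w. ennreal (g w / f1 w) \<partial>density \<nu> (\<lambda>w. ennreal (f1 w)))"
    by (rule nn_integral_density[symmetric]) (auto intro!: m\<nu>)
  also have "density \<nu> (\<lambda>w. ennreal (f1 w)) = density lborel (\<lambda>w. ennreal (f2 w))"
    using spectral_measure_identity[OF sol a l] by (simp add: f1_def[abs_def] f2_def[abs_def])
  also have "(\<integral>\<^sup>+w. ennreal (g w / f1 w) \<partial>density lborel (\<lambda>w. ennreal (f2 w))) = (\<integral>\<^sup>+w. ennreal (f2 w) * ennreal (g w / f1 w) \<partial>lborel)"
    by (rule nn_integral_density) auto
  also have "\<dots> = (\<integral>\<^sup>+w. ennreal (l\<^sup>2 / fejer_const) * ennreal (g w * dens a w) \<partial>lborel)"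
  proof (rule nn_integral_cong)
    fix w
    have "f2 w * (g w / f1 w) = l\<^sup>2 / fejer_const * (g w * dens a w)"
      by (simp add: f1_def f2_def dens_def symb_def)
    then show "ennreal (f2 w) * ennreal (g w / f1 w) = ennreal (l\<^sup>2 / fejer_const) * ennreal (g w * dens a w)"
      using f12 fejer_const_pos by (simp flip: ennreal_mult')
  qed
  also have "\<dots> = ennreal (l\<^sup>2 / fejer_const) * (\<integral>\<^sup>+w. ennreal (g w * dens a w) \<partial>lborel)"
    by (rule nn_integral_cmult) measurable
  finally show ?thesis .
qed

section \<open>Moments of the spectral measure and variances of a mode\<close>

definition cov_const :: real where
  "cov_const = ((pi + 4) + (4 * K 0 * (pi + 4) + 4 * fejer_const * K 0)) / fejer_const"

lemma cov_const_pos: "cov_const > 0"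
  using fejer_const_pos K0_pos by (simp add: cov_const_def add_pos_pos)

text \<open>The previous formula with g = 1 and g = w^2. \<open>cov_const\<close> adds the constants
  of both cases, so that it depends on K only and serves every mode.\<close>

lemma spectral_moments:
  assumes sol: "weak_stationary_solution M K a l \<nu> V" and a: "a > 0" and l: "l > 0"
  shows "(\<integral>\<^sup>+w. 1 \<partial>\<nu>) \<le> ennreal (cov_const * l\<^sup>2 / a)" and "(\<integral>\<^sup>+w. ennreal (w\<^sup>2) \<partial>\<nu>) \<le> ennreal (cov_const * l\<^sup>2)"
proof -
  define A where "A = pi + 4"
  define B where "B = 4 * K 0 * (pi + 4) + 4 * fejer_const * K 0"
  have A: "A \<ge> 0" and B: "B \<ge> 0" using K0_pos fejer_const_pos by (auto simp: A_def B_def)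
  have lc: "l\<^sup>2 / fejer_const \<ge> 0" using fejer_const_pos by simp
  have cc: "cov_const * l\<^sup>2 = l\<^sup>2 / fejer_const * (A + B)" by (simp add: cov_const_def A_def B_def)
  have "(\<integral>\<^sup>+w. 1 \<partial>\<nu>) = ennreal (l\<^sup>2 / fejer_const) * (\<integral>\<^sup>+w. ennreal (dens a w) \<partial>lborel)"
    using nn_integral_spectral[OF sol a l, of "\<lambda>_. 1"] by simp
  also have "\<dots> \<le> ennreal (l\<^sup>2 / fejer_const) * ennreal (A / a)"
    using nn_integral_dens[OF a] unfolding A_def by (rule mult_left_mono) simp
  also have "\<dots> = ennreal (l\<^sup>2 / fejer_const * (A / a))" using lc by (intro ennreal_mult'[symmetric])
  also have "\<dots> \<le> ennreal (cov_const * l\<^sup>2 / a)"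
  proof (rule ennreal_leI)
    have "l\<^sup>2 / fejer_const * A \<le> l\<^sup>2 / fejer_const * (A + B)" using lc B by (intro mult_left_mono) auto
    then have "l\<^sup>2 / fejer_const * A / a \<le> cov_const * l\<^sup>2 / a" unfolding cc using a by (intro divide_right_mono) auto
    then show "l\<^sup>2 / fejer_const * (A / a) \<le> cov_const * l\<^sup>2 / a" by simp
  qed
  finally show "(\<integral>\<^sup>+w. 1 \<partial>\<nu>) \<le> ennreal (cov_const * l\<^sup>2 / a)" .
  have "(\<integral>\<^sup>+w. ennreal (w\<^sup>2) \<partial>\<nu>) = ennreal (l\<^sup>2 / fejer_const) * (\<integral>\<^sup>+w. ennreal (w\<^sup>2 * dens a w) \<partial>lborel)"
    by (rule nn_integral_spectral[OF sol a l]) auto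
  also have "\<dots> \<le> ennreal (l\<^sup>2 / fejer_const) * ennreal B"
    using nn_integral_dens_square[OF a] unfolding B_def by (rule mult_left_mono) simp
  also have "\<dots> = ennreal (l\<^sup>2 / fejer_const * B)" using lc by (intro ennreal_mult'[symmetric])
  also have "\<dots> \<le> ennreal (cov_const * l\<^sup>2)"
    unfolding cc using lc A by (intro ennreal_leI mult_left_mono) auto
  finally show "(\<integral>\<^sup>+w. ennreal (w\<^sup>2) \<partial>\<nu>) \<le> ennreal (cov_const * l\<^sup>2)" .
qed

text \<open>The measure is finite, so the isometry may be used with the unimodular transforms of the
  Dirac distributions, and the covariance is the integral of cos ((t - s) y). The temporal increment
  then follows from 1 - cos x at most x^2 / 2 and the second moment.\<close>

lemma mode_variance:
  assumes M: "prob_space M" and sol: "weak_stationary_solution M K a l \<nu> V" and a: "a > 0" and l: "l > 0"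
    and dom: "\<And>t. dirac t \<in> op_dom \<nu>"
  defines "X \<equiv> \<lambda>t w. Re (V (dirac t) w)"
  shows "integrable M (\<lambda>w. X t w * X s w)"
    and "(LINT w|M. (X t w)\<^sup>2) \<le> cov_const * l\<^sup>2 / a"
    and "(LINT w|M. (X t w - X s w)\<^sup>2) \<le> cov_const * l\<^sup>2 * (t - s)\<^sup>2"
proof -
  interpret prob_space M by fact
  have op: "operator_assoc M \<nu> V" using sol by (simp add: weak_stationary_solution_def)
  then have \<nu>: "spectral_measure \<nu>" by (rule operator_assoc_spectral)
  then have s\<nu>: "sets \<nu> = sets borel" by (simp add: spectral_measure_def)
  note mom = spectral_moments[OF sol a l]
  have cl: "cov_const * l\<^sup>2 \<ge> 0" "cov_const * l\<^sup>2 / a \<ge> 0" using cov_const_pos a by auto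
  have V: "V (dirac t) \<in> borel_measurable M" "integrable M (\<lambda>w. (cmod (V (dirac t) w))\<^sup>2)"
    "AE w in M. Im (V (dirac t) w) = 0" for t
    using operator_assoc_L2[OF op dom] operator_assoc_real[OF op dom] by auto
  have Xm [measurable]: "X t \<in> borel_measurable M" for t
    unfolding X_def using V(1)[of t] by measurable
  have X2: "integrable M (\<lambda>w. (X t w)\<^sup>2)" for t
  proof (rule Bochner_Integration.integrable_bound[OF V(2)[of t]])
    have "(X t w)\<^sup>2 \<le> (cmod (V (dirac t) w))\<^sup>2" for w
      unfolding X_def using abs_Re_le_cmod by (metis abs_ge_zero power2_abs power_mono)
    then show "AE w in M. norm ((X t w)\<^sup>2) \<le> norm ((cmod (V (dirac t) w))\<^sup>2)" by simp
  qed measurable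
  show iXX: "integrable M (\<lambda>w. X t w * X s w)" for t s
  proof (rule Bochner_Integration.integrable_bound[OF Bochner_Integration.integrable_add[OF X2[of t] X2[of s]]])
    have "\<bar>x * y\<bar> \<le> x\<^sup>2 + y\<^sup>2" for x y :: real
    proof -
      have "0 \<le> (\<bar>x\<bar> - \<bar>y\<bar>)\<^sup>2" by simp
      then have "2 * (\<bar>x\<bar> * \<bar>y\<bar>) \<le> x\<^sup>2 + y\<^sup>2" by (simp add: power2_diff)
      moreover have "\<bar>x\<bar> * \<bar>y\<bar> \<ge> 0" by simp
      ultimately show ?thesis unfolding abs_mult by linarith
    qed
    then show "AE w in M. norm (X t w * X s w) \<le> norm ((X t w)\<^sup>2 + (X s w)\<^sup>2)"
      by (intro AE_I2) (simp add: order_trans[OF _ abs_ge_self])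
  qed measurable
  have m\<nu>: "f \<in> borel_measurable \<nu>" if "f \<in> borel_measurable borel" for f :: "real \<Rightarrow> 'b::topological_space"
    using measurable_cong_sets[OF s\<nu> refl] that by blast
  have "emeasure \<nu> (space \<nu>) < \<infinity>"
    using mom(1) by (simp add: le_less_trans)
  then interpret \<nu>: finite_measure \<nu> by (intro finite_measureI) auto
  define g where "g t y = exp (- \<i> * of_real t * complex_of_real y)" for t y
  have g_norm: "cmod (g t y) = 1" for t y by (simp add: g_def norm_exp_eq_Re)
  have gL2: "fourier_in_L2 \<nu> (dirac t) (g t)" for t
    unfolding fourier_in_L2_def g_def[abs_def]
    using is_function_fourier_dirac[of t] \<open>emeasure \<nu> (space \<nu>) < \<infinity>\<close> g_norm
    by (simp add: g_def)
  have cov: "(LINT w|M. X t w * X s w) = (LINT y|\<nu>. cos ((t - s) * y))" for t s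
  proof -
    have "(LINT w|M. V (dirac t) w * cnj (V (dirac s) w)) = (LINT y|\<nu>. g t y * cnj (g s y))"
      using operator_assoc_isometry[OF op dom dom gL2 gL2] .
    also have "\<dots> = (LINT y|\<nu>. cis (- ((t - s) * y)))"
    proof (rule Bochner_Integration.integral_cong)
      fix y
      show "g t y * cnj (g s y) = cis (- ((t - s) * y))"
        unfolding g_def cis_conv_exp by (simp add: exp_cnj algebra_simps flip: exp_add)
    qed simp
    finally have 1: "(LINT w|M. V (dirac t) w * cnj (V (dirac s) w)) = (LINT y|\<nu>. cis (- ((t - s) * y)))" .
    have "(LINT w|M. V (dirac t) w * cnj (V (dirac s) w)) = (LINT w|M. complex_of_real (X t w * X s w))"
    proof (rule integral_cong_AE)
      show "AE w in M. V (dirac t) w * cnj (V (dirac s) w) = complex_of_real (X t w * X s w)"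
        using V(3)[of t] V(3)[of s] by eventually_elim (simp add: X_def complex_eq_iff)
    next
      have [measurable]: "V (dirac t) \<in> borel_measurable M" for t by (rule V(1))
      have [measurable]: "cnj \<in> borel_measurable borel"
        by (intro borel_measurable_continuous_onI continuous_intros)
      show "(\<lambda>w. V (dirac t) w * cnj (V (dirac s) w)) \<in> borel_measurable M" by measurable
      show "(\<lambda>w. complex_of_real (X t w * X s w)) \<in> borel_measurable M" by measurable
    qed
    then have "complex_of_real (LINT w|M. X t w * X s w) = (LINT y|\<nu>. cis (- ((t - s) * y)))"
      using 1 by (simp only: integral_complex_of_real)
    then have "(LINT w|M. X t w * X s w) = Re (LINT y|\<nu>. cis (- ((t - s) * y)))"
      by (metis Re_complex_of_real)
    also have "\<dots> = (LINT y|\<nu>. Re (cis (- ((t - s) * y))))"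
    proof (rule integral_Re[symmetric])
      have "(\<lambda>y. cis (- ((t - s) * y))) \<in> borel_measurable borel"
        by (intro borel_measurable_continuous_onI continuous_intros)
      then show "integrable \<nu> (\<lambda>y. cis (- ((t - s) * y)))"
        by (intro \<nu>.integrable_const_bound[of _ 1]) (auto intro: m\<nu>)
    qed
    finally show ?thesis by simp
  qed
  have mass: "measure \<nu> (space \<nu>) \<le> cov_const * l\<^sup>2 / a"
    using mom(1) cl by (simp add: \<nu>.emeasure_eq_measure)
  have var: "(LINT w|M. (X t w)\<^sup>2) = measure \<nu> (space \<nu>)" for t
    using cov[of t t] by (simp add: power2_eq_square)
  then show "(LINT w|M. (X t w)\<^sup>2) \<le> cov_const * l\<^sup>2 / a" using mass by simp
  have my2: "(\<lambda>y::real. y\<^sup>2) \<in> borel_measurable \<nu>" by (rule m\<nu>) measurable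
  have iy2: "integrable \<nu> (\<lambda>y. y\<^sup>2)"
    by (rule integrableI_nonneg[OF my2]) (use mom(2) in \<open>auto simp: le_less_trans\<close>)
  have Iy2: "(LINT y|\<nu>. y\<^sup>2) \<le> cov_const * l\<^sup>2"
    using mom(2) cl(1) iy2 by (simp add: nn_integral_eq_integral)
  have icos: "integrable \<nu> (\<lambda>y. cos ((t - s) * y))"
  proof -
    have "(\<lambda>y. cos ((t - s) * y)) \<in> borel_measurable borel" by measurable
    then show ?thesis by (intro \<nu>.integrable_const_bound[of _ 1]) (auto intro: m\<nu>)
  qed
  have "(LINT w|M. (X t w - X s w)\<^sup>2) = (LINT w|M. (X t w)\<^sup>2 + (X s w)\<^sup>2 - 2 * (X t w * X s w))"
    by (rule Bochner_Integration.integral_cong) (auto simp: power2_diff)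
  also have "\<dots> = (LINT w|M. (X t w)\<^sup>2) + (LINT w|M. (X s w)\<^sup>2) - 2 * (LINT w|M. X t w * X s w)"
    using X2[of t] X2[of s] iXX[of t s] by simp
  also have "\<dots> = 2 * (measure \<nu> (space \<nu>) - (LINT y|\<nu>. cos ((t - s) * y)))"
    unfolding var cov by simp
  also have "\<dots> = 2 * (LINT y|\<nu>. 1 - cos ((t - s) * y))"
    using icos by (subst Bochner_Integration.integral_diff) auto
  also have "\<dots> \<le> 2 * (LINT y|\<nu>. (t - s)\<^sup>2 / 2 * y\<^sup>2)"
  proof (intro mult_left_mono integral_mono)
    show "1 - cos ((t - s) * y) \<le> (t - s)\<^sup>2 / 2 * y\<^sup>2" for y
      using one_minus_cos_le_square[of "(t - s) * y"] by (simp add: power_mult_distrib)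
  qed (use icos iy2 in auto)
  also have "\<dots> = (t - s)\<^sup>2 * (LINT y|\<nu>. y\<^sup>2)" by simp
  also have "\<dots> \<le> (t - s)\<^sup>2 * (cov_const * l\<^sup>2)" using Iy2 by (intro mult_left_mono) auto
  finally show "(LINT w|M. (X t w - X s w)\<^sup>2) \<le> cov_const * l\<^sup>2 * (t - s)\<^sup>2" by (simp add: mult.commute)
qed

end

section \<open>Gaussian increments\<close>

lemma normal_even_moment:
  assumes "\<sigma> > 0" and X: "distributed M lborel X (\<lambda>x. ennreal (normal_density 0 \<sigma> x))"
  shows "integrable M (\<lambda>w. X w ^ (2 * p))"
    and "(LINT w|M. X w ^ (2 * p)) = fact (2 * p) / (2 ^ p * fact p) * (\<sigma>\<^sup>2) ^ p"
proof -
  have nm: "has_bochner_integral lborel (\<lambda>x. normal_density 0 \<sigma> x * x ^ (2 * p)) (fact (2 * p) / ((2 / \<sigma>\<^sup>2) ^ p * fact p))"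
    using normal_moment_even[OF assms(1), of 0 p] by simp
  have m: "(\<lambda>x::real. x ^ (2 * p)) \<in> borel_measurable lborel" by measurable
  show "integrable M (\<lambda>w. X w ^ (2 * p))"
    using distributed_integrable[OF X m] nm by (simp add: has_bochner_integral_iff)
  show "(LINT w|M. X w ^ (2 * p)) = fact (2 * p) / (2 ^ p * fact p) * (\<sigma>\<^sup>2) ^ p"
    using distributed_integral[OF X m] nm by (simp add: has_bochner_integral_iff power_divide)
qed

text \<open>The sum is again normal, its moment of order 2 p is a constant times the p-th power of
  the variance, and Markov's inequality applies. Variances add, so the bound stays uniform in the
  number of summands if the series of variances converges.\<close>

lemma indep_gaussian_sum_tail:
  assumes M: "prob_space M" and I: "finite I"
    and indep: "prob_space.indep_vars M (\<lambda>_. borel) Y I"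
    and gauss: "\<And>k. k \<in> I \<Longrightarrow> centered_gaussian M (Y k)"
    and \<epsilon>: "\<epsilon> > 0"
  shows "measure M {w \<in> space M. \<epsilon> \<le> \<bar>\<Sum>k\<in>I. Y k w\<bar>}
    \<le> fact (2 * p) / (2 ^ p * fact p) * (\<Sum>k\<in>I. LINT w|M. (Y k w)\<^sup>2) ^ p / \<epsilon> ^ (2 * p)"
proof -
  interpret prob_space M by fact
  \<comment> \<open>Degenerate summands vanish almost surely and are removed, because normal
    densities need a positive standard deviation.\<close>
  define J where "J = {k \<in> I. \<not> (AE w in M. Y k w = 0)}"
  have J: "finite J" "J \<subseteq> I" using I by (auto simp: J_def)
  have Ym: "Y k \<in> borel_measurable M" if "k \<in> I" for k using gauss[OF that] by (simp add: centered_gaussian_def)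
  have "\<exists>\<sigma>. \<sigma> > 0 \<and> distributed M lborel (Y k) (\<lambda>x. ennreal (normal_density 0 \<sigma> x))" if "k \<in> J" for k
    using gauss[of k] that by (auto simp: J_def centered_gaussian_def)
  then obtain \<sigma> where \<sigma>: "\<And>k. k \<in> J \<Longrightarrow> \<sigma> k > 0"
      "\<And>k. k \<in> J \<Longrightarrow> distributed M lborel (Y k) (\<lambda>x. ennreal (normal_density 0 (\<sigma> k) x))"
    by metis
  define S where "S w = (\<Sum>k\<in>J. Y k w)" for w
  have [measurable]: "S \<in> borel_measurable M" unfolding S_def using Ym J by (intro borel_measurable_sum) auto
  have [measurable]: "(\<lambda>w. \<Sum>k\<in>I. Y k w) \<in> borel_measurable M" using Ym by (intro borel_measurable_sum) auto
  have "AE w in M. \<forall>k\<in>I - J. Y k w = 0"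
    using I by (subst AE_finite_all) (auto simp: J_def)
  then have SI: "AE w in M. (\<Sum>k\<in>I. Y k w) = S w"
    by eventually_elim (use I J in \<open>auto simp: S_def intro!: sum.mono_neutral_right\<close>)
  then have "measure M {w \<in> space M. \<epsilon> \<le> \<bar>\<Sum>k\<in>I. Y k w\<bar>} = measure M {w \<in> space M. \<epsilon> \<le> \<bar>S w\<bar>}"
    by (intro finite_measure_eq_AE) (auto elim: eventually_mono)
  also have "\<dots> \<le> fact (2 * p) / (2 ^ p * fact p) * (\<Sum>k\<in>J. LINT w|M. (Y k w)\<^sup>2) ^ p / \<epsilon> ^ (2 * p)"
  proof (cases "J = {}")
    case True
    then have "{w \<in> space M. \<epsilon> \<le> \<bar>S w\<bar>} = {}" using \<epsilon> by (auto simp: S_def)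
    then have "measure M {w \<in> space M. \<epsilon> \<le> \<bar>S w\<bar>} = 0" by (simp only: measure_empty)
    then show ?thesis using \<epsilon> True by (auto simp: power_0_left)
  next
    case False
    have var: "(LINT w|M. (Y k w)\<^sup>2) = (\<sigma> k)\<^sup>2" if "k \<in> J" for k
      using normal_even_moment(2)[OF \<sigma>(1)[OF that] \<sigma>(2)[OF that], of 1] by (simp add: fact_numeral)
    have "distributed M lborel S (\<lambda>x. ennreal (normal_density (\<Sum>k\<in>J. 0) (sqrt (\<Sum>k\<in>J. (\<sigma> k)\<^sup>2)) x))"
      unfolding S_def by (rule sum_indep_normal[OF J(1) False indep_vars_subset[OF indep J(2)] \<sigma>])
    then have S: "distributed M lborel S (\<lambda>x. ennreal (normal_density 0 (sqrt (\<Sum>k\<in>J. (\<sigma> k)\<^sup>2)) x))" by simp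
    have pos: "sqrt (\<Sum>k\<in>J. (\<sigma> k)\<^sup>2) > 0"
      using \<sigma>(1) False J(1) by (intro real_sqrt_gt_zero sum_pos zero_less_power) auto
    have sq: "(sqrt (\<Sum>k\<in>J. (\<sigma> k)\<^sup>2))\<^sup>2 = (\<Sum>k\<in>J. LINT w|M. (Y k w)\<^sup>2)"
      by (simp add: sum_nonneg var)
    have "{w \<in> space M. \<epsilon> \<le> \<bar>S w\<bar>} \<subseteq> {w \<in> space M. \<epsilon> ^ (2 * p) \<le> S w ^ (2 * p)}"
    proof clarify
      fix w assume "\<epsilon> \<le> \<bar>S w\<bar>"
      then have "\<epsilon> ^ (2 * p) \<le> \<bar>S w\<bar> ^ (2 * p)" using \<epsilon> by (intro power_mono) auto
      then show "\<epsilon> ^ (2 * p) \<le> S w ^ (2 * p)" by (simp add: power_even_abs)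
    qed
    then have "measure M {w \<in> space M. \<epsilon> \<le> \<bar>S w\<bar>} \<le> measure M {w \<in> space M. \<epsilon> ^ (2 * p) \<le> S w ^ (2 * p)}"
      by (intro finite_measure_mono) auto
    also have "\<dots> \<le> (LINT w|M. S w ^ (2 * p)) / \<epsilon> ^ (2 * p)"
      using normal_even_moment(1)[OF pos S] \<epsilon>
      by (intro integral_Markov_inequality_measure[where A = "{}"]) auto
    finally show ?thesis unfolding normal_even_moment(2)[OF pos S] sq .
  qed
  also have "\<dots> \<le> fact (2 * p) / (2 ^ p * fact p) * (\<Sum>k\<in>I. LINT w|M. (Y k w)\<^sup>2) ^ p / \<epsilon> ^ (2 * p)"
    using \<epsilon> J I by (intro divide_right_mono mult_left_mono power_mono sum_mono2 sum_nonneg) auto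
  finally show ?thesis .
qed

text \<open>Chebyshev's inequality in extended reals, so that single second moments may be
  infinite.\<close>

lemma measure_tendsto_0_if_L2:
  fixes X :: "nat \<Rightarrow> 'w \<Rightarrow> real"
  assumes M: "prob_space M" and X: "\<And>n. X n \<in> borel_measurable M"
    and lim: "(\<lambda>n. \<integral>\<^sup>+w. ennreal ((X n w)\<^sup>2) \<partial>M) \<longlonglongrightarrow> 0" and \<epsilon>: "\<epsilon> > 0"
  shows "(\<lambda>n. measure M {w \<in> space M. \<epsilon> \<le> \<bar>X n w\<bar>}) \<longlonglongrightarrow> 0"
proof -
  interpret prob_space M by fact
  note [measurable] = X
  have le: "emeasure M {w \<in> space M. \<epsilon> \<le> \<bar>X n w\<bar>} \<le> ennreal (1 / \<epsilon>\<^sup>2) * (\<integral>\<^sup>+w. ennreal ((X n w)\<^sup>2) \<partial>M)" for n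
  proof -
    have "emeasure M {w \<in> space M. \<epsilon> \<le> \<bar>X n w\<bar>} \<le> emeasure M {w \<in> space M. 1 \<le> ennreal (1 / \<epsilon>\<^sup>2) * ennreal ((X n w)\<^sup>2)}"
    proof (rule emeasure_mono)
      show "{w \<in> space M. \<epsilon> \<le> \<bar>X n w\<bar>} \<subseteq> {w \<in> space M. 1 \<le> ennreal (1 / \<epsilon>\<^sup>2) * ennreal ((X n w)\<^sup>2)}"
      proof clarify
        fix w assume "\<epsilon> \<le> \<bar>X n w\<bar>"
        then have "\<epsilon>\<^sup>2 \<le> \<bar>X n w\<bar>\<^sup>2" using \<epsilon> by (intro power_mono) auto
        then have "1 \<le> 1 / \<epsilon>\<^sup>2 * (X n w)\<^sup>2" using \<epsilon> by (simp add: field_simps)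
        then have "ennreal 1 \<le> ennreal (1 / \<epsilon>\<^sup>2 * (X n w)\<^sup>2)" by (rule ennreal_leI)
        moreover have "ennreal (1 / \<epsilon>\<^sup>2 * (X n w)\<^sup>2) = ennreal (1 / \<epsilon>\<^sup>2) * ennreal ((X n w)\<^sup>2)"
          by (rule ennreal_mult') simp
        ultimately show "1 \<le> ennreal (1 / \<epsilon>\<^sup>2) * ennreal ((X n w)\<^sup>2)" by (simp only: ennreal_1)
      qed
    qed measurable
    also have "\<dots> \<le> ennreal (1 / \<epsilon>\<^sup>2) * (\<integral>\<^sup>+w. ennreal ((X n w)\<^sup>2) * indicator (space M) w \<partial>M)"
      by (rule nn_integral_Markov_inequality) auto
    also have "(\<integral>\<^sup>+w. ennreal ((X n w)\<^sup>2) * indicator (space M) w \<partial>M) = (\<integral>\<^sup>+w. ennreal ((X n w)\<^sup>2) \<partial>M)"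
      by (rule nn_integral_cong) simp
    finally show ?thesis .
  qed
  have "(\<lambda>n. ennreal (1 / \<epsilon>\<^sup>2) * (\<integral>\<^sup>+w. ennreal ((X n w)\<^sup>2) \<partial>M)) \<longlonglongrightarrow> ennreal (1 / \<epsilon>\<^sup>2) * 0"
    using lim by (intro ennreal_tendsto_cmult) auto
  then have "(\<lambda>n. ennreal (1 / \<epsilon>\<^sup>2) * (\<integral>\<^sup>+w. ennreal ((X n w)\<^sup>2) \<partial>M)) \<longlonglongrightarrow> 0" by simp
  then have "(\<lambda>n. emeasure M {w \<in> space M. \<epsilon> \<le> \<bar>X n w\<bar>}) \<longlonglongrightarrow> 0"
    by (rule tendsto_sandwich[OF _ _ tendsto_const, rotated 2]) (use le in auto)
  then have "(\<lambda>n. ennreal (measure M {w \<in> space M. \<epsilon> \<le> \<bar>X n w\<bar>})) \<longlonglongrightarrow> ennreal 0"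
    by (simp add: emeasure_eq_measure)
  then show ?thesis by (subst (asm) tendsto_ennreal_iff) auto
qed

section \<open>Increments of a mode in time and space\<close>

lemma le_powr_interpolate:
  fixes m A B \<eta> :: real
  assumes "0 \<le> m" "m \<le> A" "m \<le> B" "0 < \<eta>" "\<eta> < 1"
  shows "m \<le> A powr \<eta> * B powr (1 - \<eta>)"
proof -
  have "m = m powr \<eta> * m powr (1 - \<eta>)"
    using assms by (cases "m = 0") (auto simp flip: powr_add)
  also have "\<dots> \<le> A powr \<eta> * B powr (1 - \<eta>)"
    using assms by (intro mult_mono powr_mono2) auto
  finally show ?thesis .
qed

text \<open>The decomposition a x - b y = x (a - b) + (x - y) b separates the increment in time,
  weighted by an eigenfunction, from the increment of the eigenfunction.\<close>

lemma weighted_difference_square: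
  fixes a b x y :: real
  shows "(a * x - b * y)\<^sup>2 \<le> 2 * (x\<^sup>2 * (a - b)\<^sup>2 + (x - y)\<^sup>2 * b\<^sup>2)"
proof -
  have "a * x - b * y = x * (a - b) + (x - y) * b" by (simp add: algebra_simps)
  moreover have "(p + q)\<^sup>2 \<le> 2 * (p\<^sup>2 + q\<^sup>2)" for p q :: real
    using sum_squares_bound[of p q] by (simp add: power2_sum)
  ultimately show ?thesis by (metis power_mult_distrib)
qed

text \<open>For close points this is the gradient bound on the domain. For points at distance at
  least \<delta> the supremum bound suffices, since |x - y| / \<delta> and the square root of
  \<alpha> k / \<alpha> 0 are both at least 1.\<close>

lemma spatial_increment:
  fixes D :: "(real ^ 'd) set"
  assumes D: "smooth_bounded_domain D"
    and \<alpha>0: "0 < \<alpha> 0" and mono: "mono \<alpha>" and B: "B > 0" and c: "\<And>k::nat. c k > (0::real)"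
    and e: "\<And>k \<xi>. \<xi> \<in> D \<Longrightarrow> \<bar>e k \<xi>\<bar> \<le> B * c k"
    and diff: "\<And>k \<xi>. \<xi> \<in> D \<Longrightarrow> e k differentiable (at \<xi>)"
    and grad: "\<And>k \<xi>. \<xi> \<in> D \<Longrightarrow> norm (gradient (e k) \<xi>) \<le> B * sqrt (\<alpha> k) * c k"
  shows "\<exists>G\<ge>0. \<forall>k. \<forall>x\<in>D. \<forall>y\<in>D. \<bar>e k x - e k y\<bar> \<le> G * sqrt (\<alpha> k) * c k * norm (x - y)"
proof -
  show ?thesis
  proof (rule smooth_domain_gradient_bound[OF D])
    fix C \<delta> :: real
    assume C: "\<delta> > 0" "C \<ge> 0" and
      lip: "\<And>f G x y. (\<And>\<xi>. \<xi> \<in> D \<Longrightarrow> f differentiable (at \<xi>)) \<Longrightarrow> (\<And>\<xi>. \<xi> \<in> D \<Longrightarrow> norm (gradient f \<xi>) \<le> G) \<Longrightarrow>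
         x \<in> D \<Longrightarrow> y \<in> D \<Longrightarrow> dist x y < \<delta> \<Longrightarrow> \<bar>f x - f y\<bar> \<le> C * G * norm (x - y)"
    define G where "G = C * B + 2 * B / (\<delta> * sqrt (\<alpha> 0))"
    have G1: "C * B \<le> G" and G2: "2 * B / (\<delta> * sqrt (\<alpha> 0)) \<le> G" and G0: "G \<ge> 0"
      using C B \<alpha>0 by (auto simp: G_def)
    have "\<bar>e k x - e k y\<bar> \<le> G * sqrt (\<alpha> k) * c k * norm (x - y)" if x: "x \<in> D" and y: "y \<in> D" for k x y
    proof -
      have s0: "sqrt (\<alpha> 0) > 0" "sqrt (\<alpha> 0) \<le> sqrt (\<alpha> k)" using \<alpha>0 monoD[OF mono, of 0 k] by auto
      have ck: "c k > 0" by (rule c)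
      show ?thesis
      proof (cases "dist x y < \<delta>")
        case True
        have "\<bar>e k x - e k y\<bar> \<le> C * (B * sqrt (\<alpha> k) * c k) * norm (x - y)"
          using diff grad x y True by (intro lip) auto
        also have "\<dots> = (C * B) * (sqrt (\<alpha> k) * c k * norm (x - y))" by simp
        also have "\<dots> \<le> G * (sqrt (\<alpha> k) * c k * norm (x - y))"
          using G1 s0 ck by (intro mult_right_mono mult_nonneg_nonneg) auto
        finally show ?thesis by (simp add: mult.assoc)
      next
        case False
        have "\<bar>e k x - e k y\<bar> \<le> 2 * B * c k * 1" using e[OF x, of k] e[OF y, of k] by linarith
        also have "\<dots> \<le> 2 * B * c k * ((norm (x - y) / \<delta>) * (sqrt (\<alpha> k) / sqrt (\<alpha> 0)))"
        proof (rule mult_left_mono)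
          have "1 \<le> norm (x - y) / \<delta>" using False C by (simp add: dist_norm)
          moreover have "1 \<le> sqrt (\<alpha> k) / sqrt (\<alpha> 0)" using s0 by simp
          ultimately have "1 * 1 \<le> (norm (x - y) / \<delta>) * (sqrt (\<alpha> k) / sqrt (\<alpha> 0))" by (intro mult_mono) auto
          then show "1 \<le> (norm (x - y) / \<delta>) * (sqrt (\<alpha> k) / sqrt (\<alpha> 0))" by simp
        qed (use B ck in auto)
        also have "\<dots> = (2 * B / (\<delta> * sqrt (\<alpha> 0))) * (sqrt (\<alpha> k) * c k * norm (x - y))" by simp
        also have "\<dots> \<le> G * (sqrt (\<alpha> k) * c k * norm (x - y))"
          using G2 s0 ck by (intro mult_right_mono mult_nonneg_nonneg) auto
        finally show ?thesis by (simp add: mult.assoc)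
      qed
    qed
    then show ?thesis using G0 by blast
  qed
qed

text \<open>Interpolating between the bounds of order \<open>1 / \<alpha>\<close> and \<open>1\<close> turns both the temporal and the spatial
  variance into \<open>\<alpha>\<^sup>-\<^sup>\<eta>\<close> times the power \<open>2 (1 - \<eta>)\<close> of the distance.\<close>

lemma mode_increment_bound:
  fixes \<tau> r :: real
  assumes \<eta>: "0 < \<eta>" "\<eta> < 1" and pos: "a > 0" "ck > 0" "Cc > 0" "B > 0" "G \<ge> 0" "\<tau> \<ge> 0" "r \<ge> 0"
    and T: "0 \<le> T" "T \<le> 4 * Cc * l\<^sup>2 / a" "T \<le> Cc * l\<^sup>2 * \<tau>\<^sup>2"
    and V: "0 \<le> V" "V \<le> Cc * l\<^sup>2 / a"
    and E: "\<bar>E\<bar> \<le> B * ck" and d: "\<bar>d\<bar> \<le> 2 * B * ck" "\<bar>d\<bar> \<le> G * sqrt a * ck * r"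
    and \<tau>r: "\<tau> \<le> \<rho>" "r \<le> \<rho>"
  shows "2 * (E\<^sup>2 * T + d\<^sup>2 * V) \<le> (2 * (4 * B\<^sup>2 * Cc + Cc * (4 * B\<^sup>2 + G\<^sup>2))) * (l\<^sup>2 * ck\<^sup>2 / a powr \<eta>) * (\<rho> powr (1 - \<eta>))\<^sup>2"
proof -
  define P where "P = (\<rho> powr (1 - \<eta>))\<^sup>2"
  have \<rho>0: "\<rho> \<ge> 0" using pos \<tau>r by linarith
  have sq_powr: "(t\<^sup>2) powr (1 - \<eta>) \<le> P" if "0 \<le> t" "t \<le> \<rho>" for t
  proof -
    have "(t\<^sup>2) powr (1 - \<eta>) = (t powr (1 - \<eta>))\<^sup>2"
      using that(1) by (simp add: power2_eq_square powr_mult)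
    also have "\<dots> \<le> P" unfolding P_def using that \<eta> by (intro power_mono powr_mono2) auto
    finally show ?thesis .
  qed
  have P0: "P \<ge> 0" by (simp add: P_def)
  have a\<eta>: "a powr \<eta> > 0" using pos by simp
  \<comment> \<open>The two bounds on the increment of an eigenfunction carry different constants;
    replacing their weighted geometric mean by the sum keeps the final constant free of
    powers.\<close>
  have young: "x powr \<eta> * y powr (1 - \<eta>) \<le> x + y" if "x \<ge> 0" "y \<ge> 0" for x y :: real
  proof -
    have "x powr \<eta> * y powr (1 - \<eta>) \<le> (max x y) powr \<eta> * (max x y) powr (1 - \<eta>)"
      using that \<eta> by (intro mult_mono powr_mono2) auto
    also have "\<dots> = max x y" using that by (cases "max x y = 0") (auto simp flip: powr_add)
    also have "\<dots> \<le> x + y" using that by simp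
    finally show ?thesis .
  qed
  have T': "T \<le> 4 * Cc * l\<^sup>2 / a powr \<eta> * P"
  proof -
    have Cl: "Cc * l\<^sup>2 \<ge> 0" using pos by simp
    have "T \<le> (4 * Cc * l\<^sup>2 / a) powr \<eta> * (Cc * l\<^sup>2 * \<tau>\<^sup>2) powr (1 - \<eta>)"
      using T \<eta> by (intro le_powr_interpolate) auto
    also have "(4 * Cc * l\<^sup>2 / a) powr \<eta> = (4 * Cc * l\<^sup>2) powr \<eta> / a powr \<eta>"
      by (rule powr_divide)
    also have "(Cc * l\<^sup>2 * \<tau>\<^sup>2) powr (1 - \<eta>) = (Cc * l\<^sup>2) powr (1 - \<eta>) * (\<tau>\<^sup>2) powr (1 - \<eta>)"
      by (rule powr_mult)
    also have "(4 * Cc * l\<^sup>2) powr \<eta> / a powr \<eta> * ((Cc * l\<^sup>2) powr (1 - \<eta>) * (\<tau>\<^sup>2) powr (1 - \<eta>))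
       \<le> (4 * Cc * l\<^sup>2) powr \<eta> / a powr \<eta> * ((4 * Cc * l\<^sup>2) powr (1 - \<eta>) * P)"
      using sq_powr[of \<tau>] \<tau>r pos Cl \<eta> by (intro mult_left_mono mult_mono powr_mono2) auto
    also have "\<dots> = ((4 * Cc * l\<^sup>2) powr \<eta> * (4 * Cc * l\<^sup>2) powr (1 - \<eta>)) / a powr \<eta> * P" by simp
    also have "(4 * Cc * l\<^sup>2) powr \<eta> * (4 * Cc * l\<^sup>2) powr (1 - \<eta>) = 4 * Cc * l\<^sup>2"
      using Cl by (cases "l = 0") (auto simp flip: powr_add)
    finally show ?thesis .
  qed
  have E2: "E\<^sup>2 \<le> B\<^sup>2 * ck\<^sup>2"
    using power_mono[OF E, of 2] by (simp add: power_mult_distrib)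
  have "E\<^sup>2 * T \<le> (B\<^sup>2 * ck\<^sup>2) * (4 * Cc * l\<^sup>2 / a powr \<eta> * P)"
    using E2 T' T(1) by (intro mult_mono) auto
  also have "\<dots> = (4 * B\<^sup>2 * Cc) * (l\<^sup>2 * ck\<^sup>2 / a powr \<eta>) * P" by simp
  finally have 1: "E\<^sup>2 * T \<le> (4 * B\<^sup>2 * Cc) * (l\<^sup>2 * ck\<^sup>2 / a powr \<eta>) * P" .
  have d1: "d\<^sup>2 \<le> 4 * B\<^sup>2 * ck\<^sup>2" using power_mono[OF d(1), of 2] by (simp add: power_mult_distrib)
  have d2: "d\<^sup>2 \<le> G\<^sup>2 * ck\<^sup>2 * (a * r\<^sup>2)" using power_mono[OF d(2), of 2] pos by (simp add: power_mult_distrib mult_ac)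
  have "d\<^sup>2 \<le> (4 * B\<^sup>2 * ck\<^sup>2) powr \<eta> * (G\<^sup>2 * ck\<^sup>2 * (a * r\<^sup>2)) powr (1 - \<eta>)"
    using d1 d2 \<eta> by (intro le_powr_interpolate) auto
  also have "(G\<^sup>2 * ck\<^sup>2 * (a * r\<^sup>2)) powr (1 - \<eta>) = (G\<^sup>2 * ck\<^sup>2) powr (1 - \<eta>) * (a powr (1 - \<eta>) * (r\<^sup>2) powr (1 - \<eta>))"
    by (simp only: powr_mult)
  also have "(4 * B\<^sup>2 * ck\<^sup>2) powr \<eta> * ((G\<^sup>2 * ck\<^sup>2) powr (1 - \<eta>) * (a powr (1 - \<eta>) * (r\<^sup>2) powr (1 - \<eta>))) =
    ((4 * B\<^sup>2 * ck\<^sup>2) powr \<eta> * (G\<^sup>2 * ck\<^sup>2) powr (1 - \<eta>)) * (a powr (1 - \<eta>) * (r\<^sup>2) powr (1 - \<eta>))" by simp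
  also have "\<dots> \<le> (4 * B\<^sup>2 * ck\<^sup>2 + G\<^sup>2 * ck\<^sup>2) * (a powr (1 - \<eta>) * P)"
    using young[of "4 * B\<^sup>2 * ck\<^sup>2" "G\<^sup>2 * ck\<^sup>2"] sq_powr[of r] \<tau>r pos by (intro mult_mono mult_left_mono) auto
  finally have d3: "d\<^sup>2 \<le> (4 * B\<^sup>2 * ck\<^sup>2 + G\<^sup>2 * ck\<^sup>2) * (a powr (1 - \<eta>) * P)" .
  have "a = a powr (1 - \<eta>) * a powr \<eta>" using pos by (simp flip: powr_add)
  \<comment> \<open>The gradient costs a^(1 - \<eta>) and the variance gains 1/a; together this is
    the same a^(-\<eta>) as for the increment in time.\<close>
  then have apow: "a powr (1 - \<eta>) / a = 1 / a powr \<eta>" using pos a\<eta> by (simp add: field_simps)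
  have "d\<^sup>2 * V \<le> ((4 * B\<^sup>2 * ck\<^sup>2 + G\<^sup>2 * ck\<^sup>2) * (a powr (1 - \<eta>) * P)) * (Cc * l\<^sup>2 / a)"
    using d3 V P0 by (intro mult_mono) auto
  also have "\<dots> = (Cc * (4 * B\<^sup>2 + G\<^sup>2)) * l\<^sup>2 * ck\<^sup>2 * P * (a powr (1 - \<eta>) / a)" by (simp add: algebra_simps)
  also have "\<dots> = (Cc * (4 * B\<^sup>2 + G\<^sup>2)) * (l\<^sup>2 * ck\<^sup>2 / a powr \<eta>) * P" unfolding apow by simp
  finally have 2: "d\<^sup>2 * V \<le> (Cc * (4 * B\<^sup>2 + G\<^sup>2)) * (l\<^sup>2 * ck\<^sup>2 / a powr \<eta>) * P" .
  have "2 * (E\<^sup>2 * T + d\<^sup>2 * V) \<le> 2 * ((4 * B\<^sup>2 * Cc) * (l\<^sup>2 * ck\<^sup>2 / a powr \<eta>) * P + (Cc * (4 * B\<^sup>2 + G\<^sup>2)) * (l\<^sup>2 * ck\<^sup>2 / a powr \<eta>) * P)"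
    by (intro mult_left_mono add_mono 1 2) auto
  also have "\<dots> = (2 * (4 * B\<^sup>2 * Cc + Cc * (4 * B\<^sup>2 + G\<^sup>2))) * (l\<^sup>2 * ck\<^sup>2 / a powr \<eta>) * P" by (simp add: algebra_simps)
  finally show ?thesis unfolding P_def .
qed

text \<open>The Gaussian clause sums over a set of distributions, in which equal Dirac distributions
  would be merged; hence the case distinction, with the coefficients combined if they
  coincide.\<close>

lemma mode_combination_gaussian:
  assumes op: "operator_assoc M \<nu> V" and dom: "\<And>t. dirac t \<in> op_dom \<nu>"
  shows "centered_gaussian M (\<lambda>w. Re (V (dirac t) w) * a - Re (V (dirac s) w) * b)"
proof (cases "dirac t = dirac s")
  case True
  have "centered_gaussian M (\<lambda>w. Re (\<Sum>f\<in>{dirac t}. of_real (a - b) * V f w))"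
    using dom by (intro operator_assoc_gaussian[OF op]) auto
  then show ?thesis using True by (simp add: algebra_simps)
next
  case False
  have "centered_gaussian M (\<lambda>w. Re (\<Sum>f\<in>{dirac t, dirac s}. (if f = dirac t then of_real a else - of_real b) * V f w))"
    using dom by (intro operator_assoc_gaussian[OF op]) auto
  then show ?thesis using False by (simp add: algebra_simps)
qed

text \<open>Partial sums are finite sums of independent Gaussians, so their tails obey a bound
  uniform in the number of terms. It passes to \<open>u\<close> through convergence in the mean
  square at the two points, at the cost of replacing \<epsilon> by \<epsilon> / 3.\<close>

lemma increment_tail:
  fixes D :: "(real ^ 'd) set" and e :: "nat \<Rightarrow> real ^ 'd \<Rightarrow> real" and u :: "real \<Rightarrow> real ^ 'd \<Rightarrow> 'w \<Rightarrow> real"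
  assumes "cm_kernel K" and D: "smooth_bounded_domain D"
    and \<alpha>0: "0 < \<alpha> 0" and mono: "mono \<alpha>" and B: "B > 0" and c: "\<And>k::nat. c k > (0::real)"
    and e: "\<And>k \<xi>. \<xi> \<in> D \<Longrightarrow> \<bar>e k \<xi>\<bar> \<le> B * c k"
    and diff: "\<And>k \<xi>. \<xi> \<in> D \<Longrightarrow> e k differentiable (at \<xi>)"
    and grad: "\<And>k \<xi>. \<xi> \<in> D \<Longrightarrow> norm (gradient (e k) \<xi>) \<le> B * sqrt (\<alpha> k) * c k"
    and lam: "\<And>k. lam k > 0" and \<eta>: "0 < \<eta>" "\<eta> < 1"
    and sum: "summable (\<lambda>k. (lam k)\<^sup>2 * (c k)\<^sup>2 / \<alpha> k powr \<eta>)"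
    and M: "prob_space M"
    and u: "\<And>t x. x \<in> D \<Longrightarrow> u t x \<in> borel_measurable M"
    and sol: "\<And>k. weak_stationary_solution M K (\<alpha> k) (lam k) (\<nu> k) (V k)"
    and indep: "prob_space.indep_vars M (\<lambda>k. Pi\<^sub>M (op_dom (\<nu> k)) (\<lambda>_. borel))
          (\<lambda>k w. \<lambda>f\<in>op_dom (\<nu> k). V k f w) UNIV"
    and dom: "\<And>k t. dirac t \<in> op_dom (\<nu> k)"
    and uk: "\<And>k t. uk k t \<in> borel_measurable M" "\<And>k t. AE w in M. V k (dirac t) w = complex_of_real (uk k t w)"
    and u_lim: "\<And>t x. x \<in> D \<Longrightarrow> (\<lambda>n. \<integral>\<^sup>+w. ennreal ((u t x w - (\<Sum>k<n. uk k t w * e k x))\<^sup>2) \<partial>M) \<longlonglongrightarrow> 0"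
  shows "\<exists>C. \<forall>z\<in>UNIV \<times> D. \<forall>z'\<in>UNIV \<times> D. \<forall>\<epsilon>>0.
    measure M {w \<in> space M. \<epsilon> \<le> \<bar>u (fst z) (snd z) w - u (fst z') (snd z') w\<bar>}
      \<le> C * (norm (z - z') powr (1 - \<eta>) / \<epsilon>) ^ (2 * p)"
proof -
  interpret prob_space M by fact
  interpret cm_kernel K by fact
  have \<alpha>: "\<alpha> k > 0" for k using \<alpha>0 monoD[OF mono, of 0 k] by simp
  obtain G where G: "G \<ge> 0" "\<And>k x y. x \<in> D \<Longrightarrow> y \<in> D \<Longrightarrow> \<bar>e k x - e k y\<bar> \<le> G * sqrt (\<alpha> k) * c k * norm (x - y)"
    using spatial_increment[OF D \<alpha>0 mono B c e diff grad] by blast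
  define S where "S = (\<Sum>k. (lam k)\<^sup>2 * (c k)\<^sup>2 / \<alpha> k powr \<eta>)"
  define Q where "Q = 2 * (4 * B\<^sup>2 * cov_const + cov_const * (4 * B\<^sup>2 + G\<^sup>2))"
  have Q: "Q \<ge> 0" using cov_const_pos by (simp add: Q_def)
  have op: "operator_assoc M (\<nu> k) (V k)" for k using sol by (simp add: weak_stationary_solution_def)
  \<comment> \<open>Independence and Gaussianity are known for the operators, so the coefficients
    \<open>uk\<close> are replaced by these almost surely equal real parts.\<close>
  define X where "X k t w = Re (V k (dirac t) w)" for k t w
  note mv = mode_variance[OF M sol \<alpha> lam dom, folded X_def]
  have Xm [measurable]: "X k t \<in> borel_measurable M" for k t
    unfolding X_def using operator_assoc_L2[OF op dom, of k t, THEN conjunct1] by measurable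
  have X_uk: "AE w in M. \<forall>k. uk k t w = X k t w" for t
    unfolding AE_all_countable
  proof
    fix k
    show "AE w in M. uk k t w = X k t w"
      using uk(2)[where k = k and t = t] by eventually_elim (simp add: X_def)
  qed
  define P where "P n t x w = (\<Sum>k<n. uk k t w * e k x)" for n t x w
  have [measurable]: "P n t x \<in> borel_measurable M" for n t x
    unfolding P_def using uk(1) by measurable
  define gm :: real where "gm = fact (2 * p) / (2 ^ p * fact p)"
  have gm: "gm \<ge> 0" by (simp add: gm_def)
  have partial: "measure M {w \<in> space M. \<epsilon> \<le> \<bar>P n t x w - P n s y w\<bar>} \<le> gm * (Q * S * (\<rho> powr (1 - \<eta>))\<^sup>2) ^ p / \<epsilon> ^ (2 * p)"
    if x: "x \<in> D" and y: "y \<in> D" and \<epsilon>: "\<epsilon> > 0" and \<rho>: "\<bar>t - s\<bar> \<le> \<rho>" "norm (x - y) \<le> \<rho>" for n t s x y \<epsilon> \<rho>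
  proof -
    define Y where "Y k w = X k t w * e k x - X k s w * e k y" for k w
    have [measurable]: "Y k \<in> borel_measurable M" for k unfolding Y_def by measurable
    \<comment> \<open>Each summand is a measurable function of the family of variables of its own
      mode, evaluated at two Dirac distributions.\<close>
    have iY: "indep_vars (\<lambda>_. borel) Y {..<n}"
    proof -
      have "indep_vars (\<lambda>_. borel) (\<lambda>k w. (\<lambda>v. Re (v (dirac t)) * e k x - Re (v (dirac s)) * e k y) (\<lambda>f\<in>op_dom (\<nu> k). V k f w)) UNIV"
      proof (rule indep_vars_compose2[OF indep])
        fix k
        have [measurable]: "(\<lambda>v. v (dirac t)) \<in> Pi\<^sub>M (op_dom (\<nu> k)) (\<lambda>_. borel) \<rightarrow>\<^sub>M (borel :: complex measure)" for t
          by (rule measurable_component_singleton[OF dom])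
        show "(\<lambda>v. Re (v (dirac t)) * e k x - Re (v (dirac s)) * e k y) \<in> Pi\<^sub>M (op_dom (\<nu> k)) (\<lambda>_. borel) \<rightarrow>\<^sub>M borel"
          by measurable
      qed
      moreover have "(\<lambda>k w. (\<lambda>v. Re (v (dirac t)) * e k x - Re (v (dirac s)) * e k y) (\<lambda>f\<in>op_dom (\<nu> k). V k f w)) = Y"
        by (simp add: fun_eq_iff Y_def X_def dom)
      ultimately have "indep_vars (\<lambda>_. borel) Y UNIV" by (simp only:)
      then show ?thesis by (rule indep_vars_subset) simp
    qed
    have gY: "centered_gaussian M (Y k)" for k
      unfolding Y_def[abs_def] X_def by (rule mode_combination_gaussian[OF op dom])
    have var: "(LINT w|M. (Y k w)\<^sup>2) \<le> Q * ((lam k)\<^sup>2 * (c k)\<^sup>2 / \<alpha> k powr \<eta>) * (\<rho> powr (1 - \<eta>))\<^sup>2" for k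
    proof -
      define T where "T = (LINT w|M. (X k t w - X k s w)\<^sup>2)"
      define W where "W = (LINT w|M. (X k s w)\<^sup>2)"
      have iXX: "integrable M (\<lambda>w. X k t w * X k s w)" for t s by (rule mv(1))
      have iX: "integrable M (\<lambda>w. (X k t w)\<^sup>2)" for t using iXX[of t t] by (simp add: power2_eq_square)
      have iT: "integrable M (\<lambda>w. (X k t w - X k s w)\<^sup>2)"
        unfolding power2_diff using iX iXX[of t s] by (simp add: mult.assoc)
      have T4: "T \<le> 4 * cov_const * (lam k)\<^sup>2 / \<alpha> k"
      proof -
        have "T \<le> (LINT w|M. 2 * (X k t w)\<^sup>2 + 2 * (X k s w)\<^sup>2)"
          unfolding T_def
        proof (rule integral_mono[OF iT])
          show "(X k t w - X k s w)\<^sup>2 \<le> 2 * (X k t w)\<^sup>2 + 2 * (X k s w)\<^sup>2" for w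
            using weighted_difference_square[of "X k t w" 1 "X k s w" 1] zero_le_power2[of "X k t w + X k s w"]
            by (simp add: power2_sum power2_diff)
        qed (use iX in simp)
        also have "\<dots> = 2 * (LINT w|M. (X k t w)\<^sup>2) + 2 * (LINT w|M. (X k s w)\<^sup>2)" using iX by simp
        also have "\<dots> \<le> 2 * (cov_const * (lam k)\<^sup>2 / \<alpha> k) + 2 * (cov_const * (lam k)\<^sup>2 / \<alpha> k)"
          using mv(2) by (intro add_mono mult_left_mono) auto
        finally show ?thesis by simp
      qed
      have "(LINT w|M. (Y k w)\<^sup>2) \<le> (LINT w|M. 2 * ((e k x)\<^sup>2 * (X k t w - X k s w)\<^sup>2 + (e k x - e k y)\<^sup>2 * (X k s w)\<^sup>2))"
      proof (rule integral_mono)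
        show "(Y k w)\<^sup>2 \<le> 2 * ((e k x)\<^sup>2 * (X k t w - X k s w)\<^sup>2 + (e k x - e k y)\<^sup>2 * (X k s w)\<^sup>2)" for w
          unfolding Y_def by (rule weighted_difference_square)
        show i2: "integrable M (\<lambda>w. 2 * ((e k x)\<^sup>2 * (X k t w - X k s w)\<^sup>2 + (e k x - e k y)\<^sup>2 * (X k s w)\<^sup>2))"
          using iT iX by simp
        show "integrable M (\<lambda>w. (Y k w)\<^sup>2)"
        proof (rule Bochner_Integration.integrable_bound[OF i2])
          have "(Y k w)\<^sup>2 \<le> 2 * ((e k x)\<^sup>2 * (X k t w - X k s w)\<^sup>2 + (e k x - e k y)\<^sup>2 * (X k s w)\<^sup>2)" for w
            unfolding Y_def by (rule weighted_difference_square)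
          then show "AE w in M. norm ((Y k w)\<^sup>2) \<le> norm (2 * ((e k x)\<^sup>2 * (X k t w - X k s w)\<^sup>2 + (e k x - e k y)\<^sup>2 * (X k s w)\<^sup>2))"
            by (intro AE_I2) simp
        qed measurable
      qed
      also have "\<dots> = 2 * ((e k x)\<^sup>2 * T + (e k x - e k y)\<^sup>2 * W)"
        using iT iX by (simp add: T_def W_def)
      also have "\<dots> \<le> Q * ((lam k)\<^sup>2 * (c k)\<^sup>2 / \<alpha> k powr \<eta>) * (\<rho> powr (1 - \<eta>))\<^sup>2"
        unfolding Q_def
      proof (rule mode_increment_bound[OF \<eta> \<alpha> c cov_const_pos B G(1) abs_ge_zero norm_ge_zero _ T4])
        show "0 \<le> T" "0 \<le> W" by (simp_all add: T_def W_def)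
        show "T \<le> cov_const * (lam k)\<^sup>2 * \<bar>t - s\<bar>\<^sup>2" using mv(3)[of k t s] by (simp add: T_def)
        show "W \<le> cov_const * (lam k)\<^sup>2 / \<alpha> k" using mv(2) by (simp add: W_def)
        show "\<bar>e k x\<bar> \<le> B * c k" by (rule e[OF x])
        show "\<bar>e k x - e k y\<bar> \<le> 2 * B * c k" using e[OF x, of k] e[OF y, of k] by linarith
        show "\<bar>e k x - e k y\<bar> \<le> G * sqrt (\<alpha> k) * c k * norm (x - y)" by (rule G(2)[OF x y])
      qed (use \<rho> in auto)
      finally show ?thesis .
    qed
    have "AE w in M. P n t x w - P n s y w = (\<Sum>k<n. Y k w)"
      using X_uk[of t] X_uk[of s]
      by eventually_elim (simp add: P_def Y_def sum_subtractf)
    then have "measure M {w \<in> space M. \<epsilon> \<le> \<bar>P n t x w - P n s y w\<bar>} = measure M {w \<in> space M. \<epsilon> \<le> \<bar>\<Sum>k<n. Y k w\<bar>}"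
      by (intro finite_measure_eq_AE) (auto elim: eventually_mono)
    also have "\<dots> \<le> gm * (\<Sum>k<n. LINT w|M. (Y k w)\<^sup>2) ^ p / \<epsilon> ^ (2 * p)"
      unfolding gm_def by (rule indep_gaussian_sum_tail[OF M _ iY gY \<epsilon>]) simp
    also have "\<dots> \<le> gm * (Q * S * (\<rho> powr (1 - \<eta>))\<^sup>2) ^ p / \<epsilon> ^ (2 * p)"
    proof (intro divide_right_mono mult_left_mono power_mono)
      have "(\<Sum>k<n. LINT w|M. (Y k w)\<^sup>2) \<le> (\<Sum>k<n. Q * ((lam k)\<^sup>2 * (c k)\<^sup>2 / \<alpha> k powr \<eta>) * (\<rho> powr (1 - \<eta>))\<^sup>2)"
        by (rule sum_mono) (rule var)
      also have "\<dots> = Q * (\<Sum>k<n. (lam k)\<^sup>2 * (c k)\<^sup>2 / \<alpha> k powr \<eta>) * (\<rho> powr (1 - \<eta>))\<^sup>2"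
        by (simp only: sum_distrib_left[symmetric] sum_distrib_right[symmetric])
      also have "\<dots> \<le> Q * S * (\<rho> powr (1 - \<eta>))\<^sup>2"
      proof (intro mult_right_mono mult_left_mono)
        show "(\<Sum>k<n. (lam k)\<^sup>2 * (c k)\<^sup>2 / \<alpha> k powr \<eta>) \<le> S"
          unfolding S_def by (rule sum_le_suminf[OF sum]) auto
      qed (use Q in auto)
      finally show "(\<Sum>k<n. LINT w|M. (Y k w)\<^sup>2) \<le> Q * S * (\<rho> powr (1 - \<eta>))\<^sup>2" .
    qed (use gm \<epsilon> in \<open>auto intro!: sum_nonneg\<close>)
    finally show ?thesis .
  qed
  have full: "measure M {w \<in> space M. \<epsilon> \<le> \<bar>u t x w - u s y w\<bar>} \<le> gm * (Q * S * (\<rho> powr (1 - \<eta>))\<^sup>2) ^ p / (\<epsilon> / 3) ^ (2 * p)"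
    if x: "x \<in> D" and y: "y \<in> D" and \<epsilon>: "\<epsilon> > 0" and \<rho>: "\<bar>t - s\<bar> \<le> \<rho>" "norm (x - y) \<le> \<rho>" for t s x y \<epsilon> \<rho>
  proof -
    have \<epsilon>3: "\<epsilon> / 3 > 0" using \<epsilon> by simp
    note [measurable] = u[OF x] u[OF y]
    define E where "E n t x = {w \<in> space M. \<epsilon> / 3 \<le> \<bar>u t x w - P n t x w\<bar>}" for n t x
    have Es: "E n t x \<in> sets M" "E n s y \<in> sets M" for n unfolding E_def by measurable
    have E0: "(\<lambda>n. measure M (E n t x)) \<longlonglongrightarrow> 0" if "x \<in> D" for t x
    proof -
      note [measurable] = u[OF that]
      show ?thesis
        unfolding E_def using u_lim[OF that, folded P_def] \<epsilon>3 by (intro measure_tendsto_0_if_L2[OF M]) measurable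
    qed
    define bnd where "bnd = gm * (Q * S * (\<rho> powr (1 - \<eta>))\<^sup>2) ^ p / (\<epsilon> / 3) ^ (2 * p)"
    have "(\<lambda>n. measure M (E n t x) + bnd + measure M (E n s y)) \<longlonglongrightarrow> 0 + bnd + 0"
      by (intro tendsto_intros E0 x y)
    then have lim': "(\<lambda>n. measure M (E n t x) + bnd + measure M (E n s y)) \<longlonglongrightarrow> bnd" by simp
    have "measure M {w \<in> space M. \<epsilon> \<le> \<bar>u t x w - u s y w\<bar>} \<le> measure M (E n t x) + bnd + measure M (E n s y)" for n
    proof -
      define F where "F = {w \<in> space M. \<epsilon> / 3 \<le> \<bar>P n t x w - P n s y w\<bar>}"
      have Fs: "F \<in> sets M" unfolding F_def by measurable
      have "{w \<in> space M. \<epsilon> \<le> \<bar>u t x w - u s y w\<bar>} \<subseteq> (E n t x \<union> F) \<union> E n s y"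
      proof (rule subsetI, rule ccontr)
        fix w assume w: "w \<in> {w \<in> space M. \<epsilon> \<le> \<bar>u t x w - u s y w\<bar>}" and "w \<notin> (E n t x \<union> F) \<union> E n s y"
        then have "\<bar>u t x w - P n t x w\<bar> < \<epsilon> / 3" "\<bar>P n t x w - P n s y w\<bar> < \<epsilon> / 3" "\<bar>u s y w - P n s y w\<bar> < \<epsilon> / 3"
          unfolding E_def F_def by auto
        moreover have "\<epsilon> \<le> \<bar>u t x w - u s y w\<bar>" using w by simp
        ultimately show False by linarith
      qed
      then have "measure M {w \<in> space M. \<epsilon> \<le> \<bar>u t x w - u s y w\<bar>} \<le> measure M ((E n t x \<union> F) \<union> E n s y)"
        using Es Fs by (intro finite_measure_mono) auto
      also have "\<dots> \<le> measure M (E n t x \<union> F) + measure M (E n s y)"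
        using Es Fs by (intro measure_Un_le) auto
      also have "measure M (E n t x \<union> F) \<le> measure M (E n t x) + measure M F"
        using Es Fs by (intro measure_Un_le) auto
      also have "measure M F \<le> bnd"
        unfolding F_def bnd_def by (rule partial[OF x y \<epsilon>3 \<rho>])
      finally show ?thesis by simp
    qed
    then have "measure M {w \<in> space M. \<epsilon> \<le> \<bar>u t x w - u s y w\<bar>} \<le> bnd"
      using LIMSEQ_le_const[OF lim'] by blast
    then show ?thesis by (simp add: bnd_def)
  qed
  show ?thesis
  proof (intro exI ballI allI impI)
    fix z z' :: "real \<times> (real ^ 'd)" and \<epsilon> :: real
    assume z: "z \<in> UNIV \<times> D" "z' \<in> UNIV \<times> D" and \<epsilon>: "\<epsilon> > 0"
    \<comment> \<open>The norm of the pair dominates both the time and the space distance, so one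
      quantity serves as bound for both.\<close>
    define \<rho> where "\<rho> = norm (z - z')"
    have \<rho>: "\<bar>fst z - fst z'\<bar> \<le> \<rho>" "norm (snd z - snd z') \<le> \<rho>"
      using norm_fst_le[of "fst (z - z')" "snd (z - z')"] norm_snd_le[of "snd (z - z')" "fst (z - z')"]
      unfolding prod.collapse by (auto simp: \<rho>_def)
    have "measure M {w \<in> space M. \<epsilon> \<le> \<bar>u (fst z) (snd z) w - u (fst z') (snd z') w\<bar>}
       \<le> gm * (Q * S * (\<rho> powr (1 - \<eta>))\<^sup>2) ^ p / (\<epsilon> / 3) ^ (2 * p)"
      using z by (intro full \<epsilon> \<rho>) auto
    also have "\<dots> = (gm * (Q * S) ^ p * 3 ^ (2 * p)) * (\<rho> powr (1 - \<eta>) / \<epsilon>) ^ (2 * p)"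
      by (simp add: power_mult_distrib power_divide power_mult)
    finally show "measure M {w \<in> space M. \<epsilon> \<le> \<bar>u (fst z) (snd z) w - u (fst z') (snd z') w\<bar>}
      \<le> (gm * (Q * S) ^ p * 3 ^ (2 * p)) * (norm (z - z') powr (1 - \<eta>) / \<epsilon>) ^ (2 * p)" by (simp add: \<rho>_def)
  qed
qed

section \<open>The modification on the product of time and space\<close>

lemma powr_add_le:
  fixes a b \<gamma> :: real
  assumes "a \<ge> 0" "b \<ge> 0" "\<gamma> > 0"
  shows "(a + b) powr \<gamma> \<le> 2 powr \<gamma> * (a powr \<gamma> + b powr \<gamma>)"
proof -
  have "(a + b) powr \<gamma> \<le> (2 * max a b) powr \<gamma>" using assms by (intro powr_mono2) auto
  also have "\<dots> = 2 powr \<gamma> * (max a b) powr \<gamma>" by (rule powr_mult)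
  also have "\<dots> \<le> 2 powr \<gamma> * (a powr \<gamma> + b powr \<gamma>)" by (intro mult_left_mono) (auto simp: max_def)
  finally show ?thesis .
qed

theorem theorem2p10:
  fixes D :: "(real ^ 'd) set"
    and DA :: "(real ^ 'd \<Rightarrow> complex) set"
    and A :: "(real ^ 'd \<Rightarrow> complex) \<Rightarrow> real ^ 'd \<Rightarrow> complex"
    and e :: "nat \<Rightarrow> real ^ 'd \<Rightarrow> real"
    and \<alpha> c lam :: "nat \<Rightarrow> real"
    and B \<eta> :: real
    and K :: "real \<Rightarrow> real"
    and M :: "'w measure"
    and F :: "nat \<Rightarrow> real \<Rightarrow> 'w \<Rightarrow> real"
    and u :: "real \<Rightarrow> real ^ 'd \<Rightarrow> 'w \<Rightarrow> real"
  assumes "smooth_bounded_domain D"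
    and "L2_self_adjoint D DA A" and "L2_negative D DA A"
    and "L2_orthonormal_basis D (\<lambda>k x. complex_of_real (e k x))"
    and "\<And>k. (\<lambda>x. complex_of_real (e k x)) \<in> DA"
    and "\<And>k. L2_eq D (A (\<lambda>x. complex_of_real (e k x))) (\<lambda>x. complex_of_real (- \<alpha> k * e k x))"
    and "0 < \<alpha> 0" and "mono \<alpha>" and "filterlim \<alpha> at_top sequentially"
    and "B > 0" and "\<And>k. c k > 0" and "mono c"
    and "\<And>k \<xi>. \<xi> \<in> D \<Longrightarrow> \<bar>e k \<xi>\<bar> \<le> B * c k"
    and "\<And>k \<xi>. \<xi> \<in> D \<Longrightarrow> e k differentiable (at \<xi>)"
    and "\<And>k \<xi>. \<xi> \<in> D \<Longrightarrow> norm (gradient (e k) \<xi>) \<le> B * sqrt (\<alpha> k) * c k"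
    and "continuous_on UNIV K" and "\<And>t. K t \<ge> 0" and "\<exists>t. K t \<noteq> 0"
    and "\<And>t. K (- t) = K t"
    and "eventually_decreasing_to_zero K" and "completely_monotone K"
    and "\<And>k. lam k > 0"
    and "0 < \<eta>" and "\<eta> < 1"
    and "summable (\<lambda>k. (lam k)\<^sup>2 * (c k)\<^sup>2 / \<alpha> k powr \<eta>)"
    and "prob_space M"
    and "forcing_noise M K F"
    and "stationary_solution M D K \<alpha> lam e u"
  shows "\<exists>U. modification M D u U \<and> (\<forall>\<gamma>. 0 < \<gamma> \<and> \<gamma> < 1 - \<eta> \<longrightarrow> holder_time_space M D \<gamma> U)"
proof -
  have kernel: "cm_kernel K"
    using assms(16-21) by (simp add: cm_kernel_def eventually_decreasing_to_zero_def)
  \<comment> \<open>Joint measurability gives measurable sections, because a point of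
    \<open>D\<close> belongs to the space of \<open>lebesgue_on D\<close>.\<close>
  have um: "u t x \<in> borel_measurable M" if "x \<in> D" for t x
  proof -
    have 1: "(\<lambda>(w, x). u t x w) \<in> borel_measurable (M \<Otimes>\<^sub>M lebesgue_on D)"
      using assms(28) unfolding stationary_solution_def by blast
    have 2: "(\<lambda>w. (w, x)) \<in> M \<rightarrow>\<^sub>M M \<Otimes>\<^sub>M lebesgue_on D"
      using that by (intro measurable_Pair measurable_ident_sets measurable_const) (auto simp: space_restrict_space)
    show ?thesis using measurable_compose[OF 2 1] by simp
  qed
  obtain \<nu> V uk where sol: "\<And>k. weak_stationary_solution M K (\<alpha> k) (lam k) (\<nu> k) (V k)"
    and indep: "prob_space.indep_vars M (\<lambda>k. Pi\<^sub>M (op_dom (\<nu> k)) (\<lambda>_. borel))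
          (\<lambda>k w. \<lambda>f\<in>op_dom (\<nu> k). V k f w) UNIV"
    and uk: "\<forall>k t. dirac t \<in> op_dom (\<nu> k) \<and> uk k t \<in> borel_measurable M \<and>
               (AE w in M. V k (dirac t) w = complex_of_real (uk k t w))"
    and lim: "\<forall>t. \<forall>x\<in>D. (\<lambda>n. \<integral>\<^sup>+w. ennreal ((u t x w - (\<Sum>k<n. uk k t w * e k x))\<^sup>2) \<partial>M) \<longlonglongrightarrow> 0"
    using assms(28) unfolding stationary_solution_def by (elim conjE exE) blast
  \<comment> \<open>Time and space are merged into one Euclidean parameter; the index set is
    unbounded in time, which is why the continuity theorem is local to balls.\<close>
  define X where "X z = u (fst z) (snd z)" for z
  have "\<exists>W. (\<forall>z\<in>UNIV \<times> D. W z \<in> borel_measurable M \<and> (AE w in M. W z w = X z w)) \<and>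
     (\<forall>\<gamma>. 0 < \<gamma> \<and> \<gamma> < 1 - \<eta> \<longrightarrow> (AE w in M. \<forall>R. \<exists>C. \<forall>z\<in>(UNIV \<times> D) \<inter> cball 0 R. \<forall>z'\<in>(UNIV \<times> D) \<inter> cball 0 R.
        \<bar>W z w - W z' w\<bar> \<le> C * norm (z - z') powr \<gamma>))"
  proof (rule kolmogorov_continuity_dyadic[OF assms(26)])
    show "X z \<in> borel_measurable M" if "z \<in> UNIV \<times> D" for z
      using that um by (auto simp: X_def)
    show "0 < 1 - \<eta>" using assms(24) by simp
    show "\<exists>C. \<forall>z\<in>UNIV \<times> D. \<forall>z'\<in>UNIV \<times> D. \<forall>\<epsilon>>0. measure M {w \<in> space M. \<epsilon> \<le> \<bar>X z w - X z' w\<bar>}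
        \<le> C * (norm (z - z') powr (1 - \<eta>) / \<epsilon>) ^ (2 * p)" for p
      unfolding X_def
      by (rule increment_tail[OF kernel assms(1) assms(7,8) assms(10,11) assms(13-15) assms(22-26) um sol indep])
        (use uk lim in auto)
  qed
  then obtain W where W: "\<forall>z\<in>UNIV \<times> D. W z \<in> borel_measurable M \<and> (AE w in M. W z w = X z w)"
    and hol: "\<forall>\<gamma>. 0 < \<gamma> \<and> \<gamma> < 1 - \<eta> \<longrightarrow> (AE w in M. \<forall>R. \<exists>C. \<forall>z\<in>(UNIV \<times> D) \<inter> cball 0 R. \<forall>z'\<in>(UNIV \<times> D) \<inter> cball 0 R.
        \<bar>W z w - W z' w\<bar> \<le> C * norm (z - z') powr \<gamma>)"
    by (elim exE conjE)
  have bD: "bounded D" using assms(1) by (simp add: smooth_bounded_domain_def)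
  then obtain b where b: "\<And>x. x \<in> D \<Longrightarrow> norm x \<le> b" by (auto simp: bounded_iff)
  show ?thesis
  proof (intro exI conjI allI impI)
    show "modification M D u (\<lambda>t x. W (t, x))"
      unfolding modification_def using W by (auto simp: X_def)
    fix \<gamma> assume \<gamma>: "0 < \<gamma> \<and> \<gamma> < 1 - \<eta>"
    show "holder_time_space M D \<gamma> (\<lambda>t x. W (t, x))"
      unfolding holder_time_space_def
      using hol[rule_format, OF \<gamma>]
    proof eventually_elim
      fix w
      assume *: "\<forall>R. \<exists>C. \<forall>z\<in>(UNIV \<times> D) \<inter> cball 0 R. \<forall>z'\<in>(UNIV \<times> D) \<inter> cball 0 R.
        \<bar>W z w - W z' w\<bar> \<le> C * norm (z - z') powr \<gamma>"
      show "\<forall>T>0. \<exists>C. \<forall>s\<in>{-T..T}. \<forall>t\<in>{-T..T}. \<forall>x\<in>D. \<forall>y\<in>D.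
        \<bar>W (t, x) w - W (s, y) w\<bar> \<le> C * (\<bar>t - s\<bar> powr \<gamma> + norm (x - y) powr \<gamma>)"
      proof (intro allI impI)
        fix T :: real assume "T > 0"
        obtain C where C: "\<And>z z'. z \<in> (UNIV \<times> D) \<inter> cball 0 (T + b) \<Longrightarrow> z' \<in> (UNIV \<times> D) \<inter> cball 0 (T + b) \<Longrightarrow>
            \<bar>W z w - W z' w\<bar> \<le> C * norm (z - z') powr \<gamma>"
          using *[rule_format, of "T + b"] by blast
        \<comment> \<open>The ball of radius T + b contains the time window times the domain, as
          \<open>b\<close> bounds the norm on \<open>D\<close>.\<close>
        have mem: "(t, x) \<in> (UNIV \<times> D) \<inter> cball 0 (T + b)" if "t \<in> {-T..T}" "x \<in> D" for t x
          using norm_Pair_le[of t x] b[OF that(2)] that by auto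
        have "\<bar>W (t, x) w - W (s, y) w\<bar> \<le> (\<bar>C\<bar> * 2 powr \<gamma>) * (\<bar>t - s\<bar> powr \<gamma> + norm (x - y) powr \<gamma>)"
          if "s \<in> {-T..T}" "t \<in> {-T..T}" "x \<in> D" "y \<in> D" for s t x y
        proof -
          have "\<bar>W (t, x) w - W (s, y) w\<bar> \<le> C * norm ((t, x) - (s, y)) powr \<gamma>"
            using that by (intro C mem)
          \<comment> \<open>The constant provided may be negative, and multiplying the next
            estimates by it needs a sign.\<close>
          also have "\<dots> \<le> \<bar>C\<bar> * norm ((t, x) - (s, y)) powr \<gamma>" by (intro mult_right_mono) auto
          also have "norm ((t, x) - (s, y)) powr \<gamma> \<le> (\<bar>t - s\<bar> + norm (x - y)) powr \<gamma>"
            using norm_Pair_le[of "t - s" "x - y"] \<gamma> by (intro powr_mono2) auto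
          also have "\<dots> \<le> 2 powr \<gamma> * (\<bar>t - s\<bar> powr \<gamma> + norm (x - y) powr \<gamma>)"
            using \<gamma> by (intro powr_add_le) auto
          finally show ?thesis by (simp add: mult_left_mono mult.assoc)
        qed
        then show "\<exists>C. \<forall>s\<in>{-T..T}. \<forall>t\<in>{-T..T}. \<forall>x\<in>D. \<forall>y\<in>D.
          \<bar>W (t, x) w - W (s, y) w\<bar> \<le> C * (\<bar>t - s\<bar> powr \<gamma> + norm (x - y) powr \<gamma>)" by blast
      qed
    qed
  qed
qed

end
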